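(* Let $y_1,\dots,y_n$ be i.i.d. from a distribution with c.d.f. $F_0$ on $\mathbb{R}$, differentiable with Lipschitz derivative $f_0$. Let $\theta_0=(\theta_{0,1},\dots,\theta_{0,k})$ with $F_0(\theta_{0,j})=p_j$ and $f_0(\theta_{0,j})>0$ for all $j$. Let the prior density $\pi$ on $\Theta$ be continuous at $\theta_0$ with $\pi(\theta_0)>0$, and let $\alpha$ be a finite measure on $\mathbb{R}$ with $A=\alpha(\mathbb{R})>0$ satisfying (Qn1) there is $L>0$ such that for each $j$, $\alpha(x,x']\le L|x-x'|$ for all $x<x'$ sufficiently close to $\theta_{0,j}$; (Qn2) $\alpha(S_j(\theta_0))>0$ for $j=1,\dots,k+1$; (Qn3) there is $M'>0$ with $\alpha(a,b]\ge M'F_0(a,b]$ for all $a<b$. Let $q_n=(q_{n,1},\dots,q_{n,k})$ with $q_{n,j}=\inf\{x:F_n(-\infty,x]\ge p_j\}$. Then $$\big\|p_{\sqrt n(\theta-q_n)\mid\mathbf{y}_n}-\mathcal{N}(0,\Sigma)\big\|_{TV}\to0\quad\text{in probability},$$ where $p_{\sqrt n(\theta-q_n)\mid\mathbf{y}_n}$ is the posterior law of $\sqrt n(\theta-q_n)$, $\Sigma=(T^\top HT)^{-1}$, $T\in\mathbb{R}^{k\times k}$ is lower bidiagonal with $T_{j,j}=f_0(\theta_{0,j})$, $T_{j,j-1}=-f_0(\theta_{0,j-1})$ ($j\ge2$), and $H=\mathrm{diag}(1/\Delta p_1,\dots,1/\Delta p_k)+\frac{1}{1-p_k}\mathbf{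1}\mathbf{1}^\top$.
   Context: Quantile model: fix $0<p_1<\dots<p_k<1$, $p_0=0$, $p_{k+1}=1$, $\Delta p_j=p_j-p_{j-1}$. $\Theta=\{\theta\in\mathbb{R}^k:\theta_1<\dots<\theta_k\}$, $\theta_0=-\infty,\theta_{k+1}=+\infty$ as interval endpoints, $S_j(\theta)=(\theta_{j-1},\theta_j]$ ($j\le k$), $S_{k+1}(\theta)=(\theta_k,\infty)$. $F_n$ is the empirical measure of $y_1,\dots,y_n$. The posterior density of $\theta$ is $$\pi(\theta\mid\mathbf{y}_n)\propto \frac{\Gamma(A+n)}{\Gamma(A)}\prod_{j=1}^{k+1}\frac{\Gamma(\alpha(S_j(\theta)))}{\Gamma(\alpha(S_j(\theta))+nF_n(S_j(\theta)))}(\Delta p_j)^{nF_n(S_j(\theta))}\pi(\theta),\quad\theta\in\Theta.$$ *)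

theory Defs
  imports "HOL-Probability.Probability" "HOL-Combinatorics.Permutations"
begin

text \<open>Vectors in R^k are functions nat => real, extensional on the index set {1..k}.
  Lebesgue measure on R^k:\<close>
definition lebk :: "nat \<Rightarrow> (nat \<Rightarrow> real) measure" where
  "lebk k = PiM {1..k} (\<lambda>_. lborel)"

definition Theta :: "nat \<Rightarrow> (nat \<Rightarrow> real) set" where
  "Theta k = {\<theta>. \<theta> \<in> extensional {1..k} \<and> (\<forall>j. 1 \<le> j \<longrightarrow> j < k \<longrightarrow> \<theta> j < \<theta> (Suc j))}"

text \<open>S_j(theta) = (theta_{j-1}, theta_j], with theta_0 = -infinity, theta_{k+1} = +infinity.\<close>
definition Sset :: "nat \<Rightarrow> (nat \<Rightarrow> real) \<Rightarrow> nat \<Rightarrow> real set" where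
  "Sset k \<theta> j = {x. (j = 1 \<or> \<theta> (j - 1) < x) \<and> (j = k + 1 \<or> x \<le> \<theta> j)}"

definition pext :: "nat \<Rightarrow> (nat \<Rightarrow> real) \<Rightarrow> nat \<Rightarrow> real" where
  "pext k p j = (if j = 0 then 0 else if j = k + 1 then 1 else p j)"

definition dp :: "nat \<Rightarrow> (nat \<Rightarrow> real) \<Rightarrow> nat \<Rightarrow> real" where
  "dp k p j = pext k p j - pext k p (j - 1)"

definition cnt :: "nat \<Rightarrow> (nat \<Rightarrow> real) \<Rightarrow> real set \<Rightarrow> nat" where
  "cnt n y S = card {i \<in> {1..n}. y i \<in> S}"

definition qemp :: "nat \<Rightarrow> (nat \<Rightarrow> real) \<Rightarrow> (nat \<Rightarrow> real) \<Rightarrow> nat \<Rightarrow> real" where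
  "qemp n y p j = Inf {x. real (cnt n y {..x}) / real n \<ge> p j}"

text \<open>Likelihood factor of the posterior; Gamma(a)/Gamma(a+m) is written as 1/pochhammer a m
  (equal for a > 0).\<close>
definition lik :: "nat \<Rightarrow> (nat \<Rightarrow> real) \<Rightarrow> real measure \<Rightarrow> nat \<Rightarrow> (nat \<Rightarrow> real)
                   \<Rightarrow> (nat \<Rightarrow> real) \<Rightarrow> real" where
  "lik k p \<alpha> n y \<theta> =
     Gamma (measure \<alpha> UNIV + real n) / Gamma (measure \<alpha> UNIV) *
     (\<Prod>j\<in>{1..k+1}. (1 / pochhammer (measure \<alpha> (Sset k \<theta> j)) (cnt n y (Sset k \<theta> j)))
                       * dp k p j ^ cnt n y (Sset k \<theta> j))"

definition posterior :: "nat \<Rightarrow> (nat \<Rightarrow> real) \<Rightarrow> real measure \<Rightarrow> ((nat \<Rightarrow> real) \<Rightarrow> real)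
                          \<Rightarrow> nat \<Rightarrow> (nat \<Rightarrow> real) \<Rightarrow> (nat \<Rightarrow> real) measure" where
  "posterior k p \<alpha> pri n y =
     (let u = (\<lambda>\<theta>. ennreal (indicator (Theta k) \<theta> * lik k p \<alpha> n y \<theta> * pri \<theta>));
          Z = (\<integral>\<^sup>+ \<theta>. u \<theta> \<partial>lebk k)
      in density (lebk k) (\<lambda>\<theta>. u \<theta> / Z))"

definition posterior_loc :: "nat \<Rightarrow> (nat \<Rightarrow> real) \<Rightarrow> real measure \<Rightarrow> ((nat \<Rightarrow> real) \<Rightarrow> real)
                          \<Rightarrow> nat \<Rightarrow> (nat \<Rightarrow> real) \<Rightarrow> (nat \<Rightarrow> real) measure" where
  "posterior_loc k p \<alpha> pri n y =
     distr (posterior k p \<alpha> pri n y) (lebk k)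
       (\<lambda>\<theta>. \<lambda>j\<in>{1..k}. sqrt (real n) * (\<theta> j - qemp n y p j))"

definition detk :: "nat \<Rightarrow> (nat \<Rightarrow> nat \<Rightarrow> real) \<Rightarrow> real" where
  "detk k M = (\<Sum>\<sigma> | \<sigma> permutes {1..k}. of_int (sign \<sigma>) * (\<Prod>i\<in>{1..k}. M i (\<sigma> i)))"

definition Tmat :: "nat \<Rightarrow> (real \<Rightarrow> real) \<Rightarrow> (nat \<Rightarrow> real) \<Rightarrow> nat \<Rightarrow> nat \<Rightarrow> real" where
  "Tmat k f0 \<theta>0 i j =
     (if i = j then f0 (\<theta>0 j) else if i \<ge> 2 \<and> j = i - 1 then - f0 (\<theta>0 j) else 0)"

definition Hmat :: "nat \<Rightarrow> (nat \<Rightarrow> real) \<Rightarrow> nat \<Rightarrow> nat \<Rightarrow> real" where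
  "Hmat k p i j = (if i = j then 1 / dp k p i else 0) + 1 / (1 - p k)"

definition SigmaInv :: "nat \<Rightarrow> (nat \<Rightarrow> real) \<Rightarrow> (real \<Rightarrow> real) \<Rightarrow> (nat \<Rightarrow> real)
                         \<Rightarrow> nat \<Rightarrow> nat \<Rightarrow> real" where
  "SigmaInv k p f0 \<theta>0 i j =
     (\<Sum>a\<in>{1..k}. \<Sum>b\<in>{1..k}. Tmat k f0 \<theta>0 a i * Hmat k p a b * Tmat k f0 \<theta>0 b j)"

text \<open>The k-variate normal law N(0, Sigma) given by its precision matrix Q = Sigma^{-1}:
  density (2 pi)^(-k/2) det(Sigma)^(-1/2) exp(-x^T Sigma^{-1} x / 2).\<close>
definition normal_prec :: "nat \<Rightarrow> (nat \<Rightarrow> nat \<Rightarrow> real) \<Rightarrow> (nat \<Rightarrow> real) measure" where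
  "normal_prec k Q = density (lebk k)
     (\<lambda>x. ennreal ((2 * pi) powr (- real k / 2) * sqrt (detk k Q)
        * exp (- (\<Sum>i\<in>{1..k}. \<Sum>j\<in>{1..k}. x i * Q i j * x j) / 2)))"

definition tv_dist :: "'a measure \<Rightarrow> 'a measure \<Rightarrow> real" where
  "tv_dist M N = (SUP A \<in> sets M. \<bar>measure M A - measure N A\<bar>)"

end

theory Submission
  imports Defs "HOL-Real_Asymp.Real_Asymp" "Jordan_Normal_Form.Determinant"
begin

text \<open>
  Write \<open>N\<^sub>j\<close> for the number of observations in \<open>S\<^sub>j(\<theta>)\<close>. Relative to a reference value not
  depending on \<open>\<theta>\<close>, the likelihood is a product over \<open>j\<close> of factors that behave like
  \<open>exp (- (N\<^sub>j - n \<Delta>p\<^sub>j)\<^sup>2 / (2 n \<Delta>p\<^sub>j))\<close>; comparing rising factorials directly makes Stirling's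
  formula unnecessary, and (Qn1) makes the dependence of \<open>\<alpha>(S\<^sub>j(\<theta>))\<close> on \<open>\<theta>\<close> negligible at
  the scale \<open>1 / sqrt n\<close>. At \<open>\<theta> = q\<^sub>n + h / sqrt n\<close> the standardised counts converge to
  \<open>f\<^sub>j h\<^sub>j - f\<^sub>i h\<^sub>i (i = j - 1)\<close>, which gives the quadratic form \<open>h\<^sup>T T\<^sup>T H T h\<close>.

  Near \<open>\<theta>\<^sub>0\<close> the linear growth of the empirical process provides a Gaussian dominating function.
  Away from \<open>\<theta>\<^sub>0\<close> the product is exponentially small except for the factors \<open>1 / \<alpha>(S\<^sub>j(\<theta>))\<close>, which
  are unbounded; by (Qn3) they are dominated by \<open>\<Prod>\<^sub>j (1 + N\<^sub>j / (n F\<^sub>0(S\<^sub>j(\<theta>))))\<close>, whose expectation over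
  the data is at most \<open>exp (k + 1)\<close> for every fixed \<open>\<theta>\<close>, so that its prior integral is bounded in
  probability by Markov's inequality.

  Everything else is deterministic: for sequences of samples with well-behaved counts, dominated
  convergence yields convergence of the rescaled densities in \<open>L\<^sub>1\<close>, hence in total variation.
\<close>

text \<open>Changing the parameter of a rising factorial of length at most n from a0 to a changes it
  by a factor of at most a constant times n to the power |a - a0|. The base measure therefore has to
  satisfy |a - a0| ln n -> 0, which a Lipschitz bound over distances of order 1 / sqrt n provides
  with room to spare.

  Two limits compete. The bound K on the centred counts is fixed while n grows, but the probability
  of bad samples vanishes only if K grows as well. The deterministic part is thus made uniform over
  all samples with a given K, by turning a failure of uniformity into a sequence of samples; K is
  released only at the very end, by a diagonal choice.

  Total variation is a supremum over all measurable sets, so convergence in probability is expressed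
  through measurable sets that contain the event of a large distance.

  Rescaling by sqrt n costs a Jacobian n^(k/2), and the bounds away from \<theta>0 lose further
  powers of n. A factor exp (- d n) beats all of them, so crude constants suffice everywhere except
  in the pointwise limit.\<close>

section \<open>Likelihood factors\<close>

text \<open>
  \<open>Efac D a0 n a N\<close> is the ratio of \<open>(n D)^N \<Gamma>(a) / \<Gamma>(a + N)\<close> to its value at \<open>a = a0\<close> and
  \<open>N = nat \<lfloor>n D\<rfloor>\<close>. For \<open>a = 0 < N\<close> it is \<open>0\<close> (division by zero), in agreement with \<open>lik\<close>.
\<close>
definition Efac :: "real \<Rightarrow> real \<Rightarrow> nat \<Rightarrow> real \<Rightarrow> nat \<Rightarrow> real" where
  "Efac D a0 n a N =
     pochhammer a0 (nat \<lfloor>real n * D\<rfloor>) / pochhammer a N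
       * ((real n * D) ^ N / (real n * D) ^ nat \<lfloor>real n * D\<rfloor>)"

section \<open>Gaussian upper bound for one factor\<close>

lemma pochhammer_split:
  fixes a :: real
  assumes "N \<le> M"
  shows "pochhammer a M = pochhammer a N * (\<Prod>i\<in>{N..<M}. a + real i)"
proof -
  have "{0..<M} = {0..<N} \<union> {N..<M}" using assms by auto
  then show ?thesis
    unfolding pochhammer_prod by (simp add: prod.union_disjoint)
qed

text \<open>With N0 = nat floor(n D), the factors of index between N0 and N are ratios of n D to a +
  i with i starting next to n D, hence close to 1. Splitting at the smaller of N and N0 separates
  this Gaussian part from the ratio of rising factorials. Below N0 the remaining factors involve a0
  instead of a.\<close>

lemma Efac_ge:
  assumes a: "a > 0" and nD: "real n * D > 0" and N: "nat \<lfloor>real n * D\<rfloor> \<le> N"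
  defines "N0 \<equiv> nat \<lfloor>real n * D\<rfloor>"
  shows "Efac D a0 n a N = pochhammer a0 N0 / pochhammer a N0 * (\<Prod>i\<in>{N0..<N}. real n * D / (a + real i))"
proof -
  have "(real n * D) ^ N = (real n * D) ^ N0 * (\<Prod>i\<in>{N0..<N}. real n * D)"
    using N by (simp add: N0_def flip: power_add)
  then show ?thesis
    using nD pochhammer_split[OF N, of a] by (auto simp: Efac_def N0_def prod_dividef)
qed

lemma Efac_less:
  assumes a: "a > 0" "a0 > 0" and nD: "real n * D > 0" and N: "N \<le> nat \<lfloor>real n * D\<rfloor>"
  defines "N0 \<equiv> nat \<lfloor>real n * D\<rfloor>"
  shows "Efac D a0 n a N = pochhammer a0 N / pochhammer a N * (\<Prod>i\<in>{N..<N0}. (a0 + real i) / (real n * D))"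
proof -
  have "(real n * D) ^ N0 = (real n * D) ^ N * (\<Prod>i\<in>{N..<N0}. real n * D)"
    using N by (simp add: N0_def flip: power_add)
  then show ?thesis
    using nD pochhammer_split[OF N, of a0] by (auto simp: Efac_def N0_def prod_dividef)
qed

lemma sum_real_lessThan: "(\<Sum>l<d. real l) = real d * (real d - 1) / 2"
  by (induction d) (auto simp: field_simps)

lemma Efac_nonneg: "a0 > 0 \<Longrightarrow> a \<ge> 0 \<Longrightarrow> D \<ge> 0 \<Longrightarrow> Efac D a0 n a N \<ge> 0"
  unfolding Efac_def pochhammer_prod
  by (intro mult_nonneg_nonneg divide_nonneg_nonneg prod_nonneg) auto

text \<open>The factor with offset l is at most exp ((1 - l) / (N0 + l)), so the product decays like
  exp (- d^2 / (2 n)). Giving up half of this rate leaves room for the linear term in d and for the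
  rounding of n D. The a0 in the constant only matches the bound for N below N0.\<close>

lemma Efac_bound_ge:
  assumes a: "a > 0" "a0 > 0" and D: "0 < D" and n: "real n * D \<ge> 1" and Nn: "N \<le> n"
    and N: "nat \<lfloor>real n * D\<rfloor> \<le> N"
  defines "N0 \<equiv> nat \<lfloor>real n * D\<rfloor>"
  shows "Efac D a0 n a N \<le> pochhammer a0 N0 / pochhammer a N0 * exp (3 + a0)
           * exp (- (real N - real n * D)\<^sup>2 / (4 * real n))"
proof -
  define d where "d = N - N0"
  have N0: "N0 \<ge> 1" "real N0 \<le> real n * D" "real n * D < real N0 + 1"
    using n by (auto simp: N0_def) linarith+
  have np: "real n > 0" using n D by (metis less_numeral_extra(1) linorder_not_less mult_eq_0_iff not_less0 of_nat_0_less_iff gr0I of_nat_0 zero_less_one)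
  have Nd: "N = N0 + d" using N by (simp add: d_def N0_def)
  have dn: "real d \<le> real n" using Nn Nd by linarith
  have "(\<Prod>i\<in>{N0..<N}. real n * D / (a + real i)) = (\<Prod>l<d. real n * D / (a + real (N0 + l)))"
    unfolding Nd by (rule prod.reindex_bij_witness[of _ "\<lambda>l. l + N0" "\<lambda>i. i - N0"]) auto
  \<comment> \<open>For l \<ge> 1 the exponent is not positive, and enlarging its denominator from
    N0 + l to n weakens the bound. For l = 0 this would go the wrong way, so that factor is bounded
    through exp 1 instead.\<close>
  also have "\<dots> \<le> (\<Prod>l<d. exp ((if l = 0 then 1 else 0) + (1 - real l) / real n))"
  proof (rule prod_mono, safe)
    fix l assume l: "l < d"
    show "0 \<le> real n * D / (a + real (N0 + l))" using a D by simp
    have ln: "real (N0 + l) \<le> real n" using l Nd Nn by linarith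
    have "real n * D / (a + real (N0 + l)) \<le> (real N0 + 1) / real (N0 + l)"
      using N0 a by (intro frac_le) auto
    also have "\<dots> = 1 + (1 - real l) / real (N0 + l)"
      using N0 by (simp add: field_simps)
    also have "\<dots> \<le> exp ((1 - real l) / real (N0 + l))" by (rule exp_ge_add_one_self)
    also have "\<dots> \<le> exp ((if l = 0 then 1 else 0) + (1 - real l) / real n)"
    proof (cases "l = 0")
      case True
      have "1 / real N0 \<le> 1" using N0(1) by simp
      then show ?thesis using True by (simp add: add_increasing2)
    next
      case False
      then have "(real l - 1) / real n \<le> (real l - 1) / real (N0 + l)"
        using ln N0 by (intro divide_left_mono) auto
      then have "(1 - real l) / real (N0 + l) \<le> (1 - real l) / real n"
        by (metis divide_minus_left minus_diff_eq neg_le_iff_le)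
      then show ?thesis using False by simp
    qed
    finally show "real n * D / (a + real (N0 + l)) \<le> exp ((if l = 0 then 1 else 0) + (1 - real l) / real n)" .
  qed
  also have "\<dots> = exp (\<Sum>l<d. (if l = 0 then 1 else 0) + (1 - real l) / real n)"
    by (simp add: exp_sum)
  also have "\<dots> \<le> exp (3 - (real N - real n * D)\<^sup>2 / (4 * real n))"
  proof -
    have "(\<Sum>l<d. (if l = 0 then 1 else 0::real)) \<le> 1" by (cases d) (auto simp: sum.delta)
    moreover have "(\<Sum>l<d. (1 - real l) / real n) = (real d - real d * (real d - 1) / 2) / real n"
      by (simp add: sum_subtractf sum_real_lessThan flip: sum_divide_distrib)
    moreover have "(real d - real d * (real d - 1) / 2) / real n \<le> 2 - (real N - real n * D)\<^sup>2 / (4 * real n)"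
    proof -
      \<comment> \<open>Rounding: if d > 0 then N exceeds n D by at most d, and if d = 0 they differ
        by less than 1, whence the extra 1.\<close>
      have "(real N - real n * D)\<^sup>2 \<le> (real d)\<^sup>2 + 1"
      proof (cases "d = 0")
        case True
        then show ?thesis using N0 Nd by (simp add: power2_eq_square abs_square_le_1 flip: power2_eq_square)
      next
        case False
        then have "\<bar>real N - real n * D\<bar> \<le> real d" using N0 Nd by auto
        then have "(real N - real n * D)\<^sup>2 \<le> (real d)\<^sup>2" by (metis abs_ge_zero power2_abs power_mono)
        then show ?thesis by simp
      qed
      moreover have "4 * (real d - real d * (real d - 1) / 2) = 6 * real d - 2 * (real d)\<^sup>2"
        by (simp add: power2_eq_square field_simps)
      moreover have "real n \<ge> 1" "(real d)\<^sup>2 \<ge> 0" using np by auto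
      ultimately have *: "4 * (real d - real d * (real d - 1) / 2) \<le> 8 * real n - (real N - real n * D)\<^sup>2"
        using dn by linarith
      have "(real d - real d * (real d - 1) / 2) / real n
          \<le> (2 * real n - (real N - real n * D)\<^sup>2 / 4) / real n"
      proof (rule divide_right_mono)
        have "q \<le> 2 * r - Y / 4" if "4 * q \<le> 8 * r - Y" for q r Y :: real using that by linarith
        from this[OF *] show "real d - real d * (real d - 1) / 2 \<le> 2 * real n - (real N - real n * D)\<^sup>2 / 4" .
      qed simp
      also have "\<dots> = 2 - (real N - real n * D)\<^sup>2 / (4 * real n)"
        using np by (simp add: diff_divide_distrib)
      finally show ?thesis .
    qed
    ultimately show ?thesis by (simp add: sum.distrib)
  qed
  finally have *: "(\<Prod>i\<in>{N0..<N}. real n * D / (a + real i)) \<le> exp (3 - (real N - real n * D)\<^sup>2 / (4 * real n))" .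
  have "exp (3 - (real N - real n * D)\<^sup>2 / (4 * real n)) \<le> exp (3 + a0) * exp (- (real N - real n * D)\<^sup>2 / (4 * real n))"
    using a by (simp flip: exp_add)
  with * have *: "(\<Prod>i\<in>{N0..<N}. real n * D / (a + real i)) \<le> exp (3 + a0) * exp (- (real N - real n * D)\<^sup>2 / (4 * real n))"
    by linarith
  have "pochhammer a0 N0 / pochhammer a N0 \<ge> 0" using a by (simp add: pochhammer_pos less_imp_le)
  from mult_left_mono[OF * this] show ?thesis
    using Efac_ge[OF a(1), of n D N a0] n N unfolding N0_def by (simp only: mult.assoc)
qed

text \<open>Here the product runs down from N0 - 1 and a0 enters every factor. The d terms a0 / (n
  D) add up to at most a0 because d \<le> N0 \<le> n D, which is the a0 in the exponent. Then
  \<open>D \<le> 1\<close> weakens the rate from n D to n.\<close>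

lemma Efac_bound_less:
  assumes a: "a > 0" "a0 > 0" and D: "0 < D" "D \<le> 1" and n: "real n * D \<ge> 1"
    and N: "N \<le> nat \<lfloor>real n * D\<rfloor>"
  shows "Efac D a0 n a N \<le> pochhammer a0 N / pochhammer a N * exp (3 + a0)
           * exp (- (real N - real n * D)\<^sup>2 / (4 * real n))"
proof -
  define N0 where "N0 \<equiv> nat \<lfloor>real n * D\<rfloor>"
  define d where "d = N0 - N"
  have N0: "N0 \<ge> 1" "real N0 \<le> real n * D" "real n * D < real N0 + 1"
    using n by (auto simp: N0_def) linarith+
  have np: "real n \<ge> 1" using n D mult_left_le[of D "real n"] by simp
  have nDn: "real n * D \<le> real n" using D by (simp add: mult_left_le)
  have Nd: "N0 = N + d" using N by (simp add: d_def N0_def)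
  have "(\<Prod>i\<in>{N..<N0}. (a0 + real i) / (real n * D)) = (\<Prod>l<d. (a0 + real (N0 - 1 - l)) / (real n * D))"
    by (rule prod.reindex_bij_witness[of _ "\<lambda>l. N0 - 1 - l" "\<lambda>i. N0 - 1 - i"]) (use Nd in auto)
  also have "\<dots> \<le> (\<Prod>l<d. exp ((a0 - real l) / (real n * D)))"
  proof (rule prod_mono, safe)
    fix l assume l: "l < d"
    show "0 \<le> (a0 + real (N0 - 1 - l)) / (real n * D)" using a D by simp
    have "real (N0 - 1 - l) = real N0 - 1 - real l" using l Nd by simp
    then have "(a0 + real (N0 - 1 - l)) / (real n * D) \<le> (real n * D + a0 - real l) / (real n * D)"
      using N0 n by (intro divide_right_mono) auto
    also have "\<dots> = 1 + (a0 - real l) / (real n * D)" proof -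
      have "real n * D \<noteq> 0" using n by linarith
      then show ?thesis by (simp add: divide_simps)
    qed
    also have "\<dots> \<le> exp ((a0 - real l) / (real n * D))" by (rule exp_ge_add_one_self)
    finally show "(a0 + real (N0 - 1 - l)) / (real n * D) \<le> exp ((a0 - real l) / (real n * D))" .
  qed
  also have "\<dots> = exp (\<Sum>l<d. (a0 - real l) / (real n * D))" by (simp add: exp_sum)
  also have "\<dots> \<le> exp (3 + a0 - (real N - real n * D)\<^sup>2 / (4 * real n))"
  proof -
    have "(\<Sum>l<d. (a0 - real l) / (real n * D)) = (real d * a0 - real d * (real d - 1) / 2) / (real n * D)"
      by (simp add: sum_subtractf sum_real_lessThan flip: sum_divide_distrib)
    also have "\<dots> = real d / (real n * D) * a0 + real d / (real n * D) / 2 - (real d)\<^sup>2 / (real n * D) / 2"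
      by (simp add: power2_eq_square diff_divide_distrib right_diff_distrib)
    also have "\<dots> \<le> 1 * a0 + 1 / 2 - (real d)\<^sup>2 / real n / 2"
    proof -
      have "real d / (real n * D) \<le> 1" using Nd N0 n by simp
      moreover have "(real d)\<^sup>2 / real n \<le> (real d)\<^sup>2 / (real n * D)"
        using nDn n np by (intro divide_left_mono) auto
      ultimately show ?thesis using a by (intro diff_mono add_mono mult_right_mono divide_right_mono) auto
    qed
    also have "\<dots> \<le> 3 + a0 - (real N - real n * D)\<^sup>2 / (4 * real n)"
    proof -
      have "\<bar>real N - real n * D\<bar> \<le> real d + 1" using Nd N0 by auto
      then have "(real N - real n * D)\<^sup>2 \<le> (real d + 1)\<^sup>2"
        by (metis abs_ge_zero power2_abs power_mono)
      also have "\<dots> \<le> 2 * (real d)\<^sup>2 + 2"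
        using zero_le_power2[of "real d - 1"] by (simp add: power2_eq_square algebra_simps)
      finally have "(real N - real n * D)\<^sup>2 \<le> 2 * (real d)\<^sup>2 + 10 * real n" using np by linarith
      then have "(real N - real n * D)\<^sup>2 / (4 * real n) \<le> (2 * (real d)\<^sup>2 + 10 * real n) / (4 * real n)"
        by (intro divide_right_mono) auto
      also have "\<dots> = (real d)\<^sup>2 / real n / 2 + 5 / 2" using np by (simp add: add_divide_distrib)
      finally show ?thesis by simp
    qed
    finally show ?thesis by simp
  qed
  finally have *: "(\<Prod>i\<in>{N..<N0}. (a0 + real i) / (real n * D)) \<le> exp (3 + a0) * exp (- (real N - real n * D)\<^sup>2 / (4 * real n))"
    by (simp flip: exp_add)
  have "pochhammer a0 N / pochhammer a N \<ge> 0" using a by (simp add: pochhammer_pos less_imp_le)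
  from mult_left_mono[OF * this] show ?thesis
    using Efac_less[OF a, of n D N] n N unfolding N0_def by (simp only: mult.assoc)
qed

lemma Efac_bound:
  assumes "a > 0" "a0 > 0" "0 < D" "D \<le> 1" "real n * D \<ge> 1" "N \<le> n"
  defines "N' \<equiv> min N (nat \<lfloor>real n * D\<rfloor>)"
  shows "Efac D a0 n a N \<le> pochhammer a0 N' / pochhammer a N' * exp (3 + a0)
           * exp (- (real N - real n * D)\<^sup>2 / (4 * real n))"
  using Efac_bound_less[of a a0 D n N] Efac_bound_ge[of a a0 D n N] assms(1-6)
  unfolding N'_def by (cases "N \<le> nat \<lfloor>real n * D\<rfloor>") (simp_all add: min_def)

section \<open>Ratios of rising factorials\<close>

lemma sum_inverse_le_ln:
  assumes "N \<le> n" "n \<ge> 1"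
  shows "(\<Sum>i\<in>{1..<N}. 1 / real i) \<le> 1 + ln (real n)"
proof -
  have "(\<Sum>i\<in>{1..<Suc n}. 1 / real i) \<le> 1 + ln (real n)"
    using assms(2)
  proof (induction n rule: dec_induct)
    case base
    then show ?case by simp
  next
    case (step m)
    have "ln (real m / real (Suc m)) \<le> real m / real (Suc m) - 1"
      using step by (intro ln_le_minus_one) auto
    also have "\<dots> = - (1 / real (Suc m))" by (simp add: field_simps)
    finally have "1 / real (Suc m) \<le> ln (real (Suc m)) - ln (real m)"
      using step by (simp add: ln_div)
    then show ?case using step by simp
  qed
  moreover have "(\<Sum>i\<in>{1..<N}. 1 / real i) \<le> (\<Sum>i\<in>{1..<Suc n}. 1 / real i)"
    using assms by (intro sum_mono2) auto
  ultimately show ?thesis by linarith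
qed

text \<open>Each factor (b + i) / (a + i) is at most exp (|a - b| / (lo + i)), and the harmonic sum
  over i < N is logarithmic in n. This serves cells near those of \<theta>0, whose masses stay above
  a positive lo.\<close>

lemma pochhammer_ratio_le:
  fixes a b lo :: real
  assumes lo: "lo > 0" "a \<ge> lo" "b \<ge> lo" and N: "N \<le> n" "n \<ge> 1"
  shows "pochhammer b N / pochhammer a N \<le> exp (\<bar>a - b\<bar> * (1 / lo + 1 + ln (real n)))"
proof -
  have "pochhammer b N / pochhammer a N = (\<Prod>i\<in>{0..<N}. (b + real i) / (a + real i))"
    by (simp add: pochhammer_prod prod_dividef)
  also have "\<dots> \<le> (\<Prod>i\<in>{0..<N}. exp (\<bar>a - b\<bar> / (lo + real i)))"
  proof (rule prod_mono, safe)
    fix i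
    show "0 \<le> (b + real i) / (a + real i)" using lo by simp
    have "(b + real i) / (a + real i) = 1 + (b - a) / (a + real i)" using lo by (simp add: field_simps)
    also have "\<dots> \<le> 1 + \<bar>a - b\<bar> / (lo + real i)"
      using lo by (intro add_left_mono frac_le) auto
    also have "\<dots> \<le> exp (\<bar>a - b\<bar> / (lo + real i))" by (rule exp_ge_add_one_self)
    finally show "(b + real i) / (a + real i) \<le> exp (\<bar>a - b\<bar> / (lo + real i))" .
  qed
  also have "\<dots> = exp (\<bar>a - b\<bar> * (\<Sum>i\<in>{0..<N}. 1 / (lo + real i)))"
    by (simp add: exp_sum sum_distrib_left)
  also have "\<dots> \<le> exp (\<bar>a - b\<bar> * (1 / lo + 1 + ln (real n)))"
  proof -
    have "(\<Sum>i\<in>{0..<N}. 1 / (lo + real i)) \<le> 1 / lo + (\<Sum>i\<in>{1..<N}. 1 / real i)"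
    proof (cases "N = 0")
      case False
      then have "{0..<N} = insert 0 {1..<N}" by auto
      moreover have "(\<Sum>i\<in>{1..<N}. 1 / (lo + real i)) \<le> (\<Sum>i\<in>{1..<N}. 1 / real i)"
        using lo by (intro sum_mono frac_le) auto
      ultimately show ?thesis by simp
    qed (use lo in auto)
    also have "\<dots> \<le> 1 / lo + (1 + ln (real n))" using sum_inverse_le_ln[OF N] by simp
    finally show ?thesis by (simp add: mult_left_mono add.assoc)
  qed
  finally show ?thesis .
qed

text \<open>For masses that may approach 0 only the factor i = 0 is singular. The remaining factors
  are at most 1 + A / i and together polynomial in n.\<close>

lemma pochhammer_ratio_le_poly:
  fixes a b A :: real
  assumes a: "0 < a" "0 < b" "b \<le> A" and N: "1 \<le> N" "N \<le> n"
  shows "pochhammer b N / pochhammer a N \<le> A / a * exp (A * (1 + ln (real n)))"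
proof -
  have "{0..<N} = insert 0 {1..<N}" using N by auto
  then have "pochhammer b N / pochhammer a N = b / a * (\<Prod>i\<in>{1..<N}. (b + real i) / (a + real i))"
    by (simp add: pochhammer_prod prod_dividef)
  also have "\<dots> \<le> A / a * (\<Prod>i\<in>{1..<N}. exp (A * (1 / real i)))"
  proof (intro mult_mono prod_mono, safe)
    fix i assume i: "i \<in> {1..<N}"
    show "0 \<le> (b + real i) / (a + real i)" using a by simp
    have "(b + real i) / (a + real i) \<le> (A + real i) / real i" using a i by (intro frac_le) auto
    also have "\<dots> = 1 + A * (1 / real i)" using i by (simp add: field_simps)
    also have "\<dots> \<le> exp (A * (1 / real i))" by (rule exp_ge_add_one_self)
    finally show "(b + real i) / (a + real i) \<le> exp (A * (1 / real i))" .
  next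
    show "0 \<le> (\<Prod>i = 1..<N. (b + real i) / (a + real i))" using a by (intro prod_nonneg) auto
  qed (use a in \<open>auto simp: divide_right_mono\<close>)
  also have "(\<Prod>i\<in>{1..<N}. exp (A * (1 / real i))) = exp (A * (\<Sum>i\<in>{1..<N}. 1 / real i))"
    by (simp add: exp_sum sum_distrib_left)
  also have "A / a * \<dots> \<le> A / a * exp (A * (1 + ln (real n)))"
    using a N sum_inverse_le_ln[of N n] by (intro mult_left_mono) (auto intro!: mult_left_mono)
  finally show ?thesis .
qed


section \<open>Pointwise limit of one factor\<close>

lemma sum_ln_near_linear:
  fixes X :: "nat \<Rightarrow> real" and M B s :: real
  assumes M: "M > 0" and B: "B \<ge> 0" and s: "\<bar>s\<bar> = 1"
    and X: "\<And>l. l < d \<Longrightarrow> \<bar>X l - s * real l / M\<bar> \<le> B / M"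
    and small: "(real d + B) / M \<le> 1/2"
  shows "\<bar>(\<Sum>l<d. ln (1 + X l)) - s * (real d)\<^sup>2 / (2 * M)\<bar>
           \<le> (B + 1) * real d / M + 2 * real d * (real d + B)\<^sup>2 / M\<^sup>2"
proof -
  have Xb: "\<bar>X l\<bar> \<le> (real d + B) / M" if "l < d" for l
  proof -
    have "\<bar>X l\<bar> \<le> \<bar>s * real l / M\<bar> + B / M" using X[OF that] by linarith
    also have "\<bar>s * real l / M\<bar> = real l / M" using M s by (simp add: abs_mult)
    also have "real l / M + B / M \<le> (real d + B) / M"
      using that M by (simp add: divide_right_mono flip: add_divide_distrib)
    finally show ?thesis .
  qed
  have *: "\<bar>ln (1 + X l) - s * real l / M\<bar> \<le> B / M + 2 * (real d + B)\<^sup>2 / M\<^sup>2" if "l < d" for l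
  proof -
    have "\<bar>ln (1 + X l) - X l\<bar> \<le> 2 * (X l)\<^sup>2"
      using Xb[OF that] small by (intro abs_ln_one_plus_x_minus_x_bound) linarith
    also have "(X l)\<^sup>2 \<le> ((real d + B) / M)\<^sup>2"
      using Xb[OF that] by (metis abs_ge_zero power2_abs power_mono)
    finally have "\<bar>ln (1 + X l) - X l\<bar> \<le> 2 * (real d + B)\<^sup>2 / M\<^sup>2" by (simp add: power_divide)
    then show ?thesis using X[OF that] by linarith
  qed
  \<comment> \<open>The exact sum is s d (d - 1) / (2 M). Its deviation from s d^2 / (2 M) is at
    most d / M and accounts for the 1 in \<open>B + 1\<close>.\<close>
  have lin: "(\<Sum>l<d. s * real l / M) = s * (real d)\<^sup>2 / (2 * M) - s * real d / (2 * M)"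
  proof -
    have "(\<Sum>l<d. s * real l / M) = s * (\<Sum>l<d. real l) / M"
      by (simp add: sum_distrib_left sum_divide_distrib)
    then show ?thesis using M by (simp add: sum_real_lessThan field_simps power2_eq_square)
  qed
  have "\<bar>(\<Sum>l<d. ln (1 + X l)) - (\<Sum>l<d. s * real l / M)\<bar>
          \<le> (\<Sum>l<d. \<bar>ln (1 + X l) - s * real l / M\<bar>)"
    by (simp add: sum_subtractf[symmetric] sum_abs)
  also have "\<dots> \<le> (\<Sum>l<d. B / M + 2 * (real d + B)\<^sup>2 / M\<^sup>2)"
    using * by (intro sum_mono) auto
  also have "\<dots> = B * real d / M + 2 * real d * (real d + B)\<^sup>2 / M\<^sup>2"
    by (simp add: algebra_simps)
  finally have "\<bar>(\<Sum>l<d. ln (1 + X l)) - (\<Sum>l<d. s * real l / M)\<bar>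
     \<le> B * real d / M + 2 * real d * (real d + B)\<^sup>2 / M\<^sup>2" .
  moreover have "\<bar>s * real d / (2 * M)\<bar> \<le> real d / M"
    using M s by (simp add: abs_mult divide_simps)
  moreover have "(B + 1) * real d / M = B * real d / M + real d / M" by (simp add: distrib_right add_divide_distrib)
  ultimately show ?thesis unfolding lin by linarith
qed

text \<open>The factors between N and N0 are, up to inversion, 1 + X l with X l within (A + 2) / M
  of s l / M, where s = 1 above N0 and s = -1 below. Above N0 they are the inverses of 1 + X l, so
  both cases produce - d^2 / (2 M).\<close>

lemma Efac_eq_exp:
  fixes n N :: nat
  assumes a: "a > 0" "a0 > 0" "a \<le> A" "a0 \<le> A" and nD: "real n * D \<ge> 1"
  defines "N0 \<equiv> nat \<lfloor>real n * D\<rfloor>" and "M \<equiv> real n * D"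
  defines "N' \<equiv> min N N0" and "d \<equiv> \<bar>real N - real N0\<bar>"
  assumes small: "(d + A + 2) / M \<le> 1 / 2"
  shows "\<exists>t. Efac D a0 n a N = pochhammer a0 N' / pochhammer a N' * exp t \<and>
             \<bar>t + d\<^sup>2 / (2 * M)\<bar> \<le> (A + 3) * d / M + 2 * d * (d + A + 2)\<^sup>2 / M\<^sup>2"
proof -
  have N0: "N0 \<ge> 1" "real N0 \<le> M" "M < real N0 + 1" and M: "M \<ge> 1"
    using nD by (auto simp: N0_def M_def) linarith+
  show ?thesis
  proof (cases "N0 \<le> N")
    case True
    define e where "e = N - N0"
    have Ne: "N = N0 + e" and de: "d = real e" using True by (auto simp: e_def d_def)
    define X where "X l = (a + real (N0 + l)) / M - 1" for l
    have Xl: "\<bar>X l - 1 * real l / M\<bar> \<le> (A + 2) / M" if "l < e" for l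
    proof -
      have "X l - 1 * real l / M = (a + real N0 - M) / M"
        using M by (simp add: X_def field_simps)
      then show ?thesis using a M N0 by (simp add: abs_mult divide_simps)
    qed
    have pos: "1 + X l > 0" for l using a M by (simp add: X_def add_pos_nonneg)
    have "(\<Prod>i\<in>{N0..<N}. M / (a + real i)) = (\<Prod>l<e. M / (a + real (N0 + l)))"
      unfolding Ne by (rule prod.reindex_bij_witness[of _ "\<lambda>l. l + N0" "\<lambda>i. i - N0"]) auto
    also have "\<dots> = (\<Prod>l<e. exp (- ln (1 + X l)))"
      using pos M by (intro prod.cong) (auto simp: exp_minus X_def)
    also have "\<dots> = exp (- (\<Sum>l<e. ln (1 + X l)))" by (simp add: exp_sum sum_negf[symmetric])
    finally have eq: "Efac D a0 n a N = pochhammer a0 N' / pochhammer a N' * exp (- (\<Sum>l<e. ln (1 + X l)))"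
      using Efac_ge[OF a(1), of n D N a0] True nD by (simp add: N'_def M_def N0_def min_def)
    have "\<bar>(\<Sum>l<e. ln (1 + X l)) - 1 * (real e)\<^sup>2 / (2 * M)\<bar>
        \<le> ((A + 2) + 1) * real e / M + 2 * real e * (real e + (A + 2))\<^sup>2 / M\<^sup>2"
      using Xl M a small de by (intro sum_ln_near_linear) (auto simp: algebra_simps)
    then show ?thesis
      using eq by (intro exI[of _ "- (\<Sum>l<e. ln (1 + X l))"]) (simp add: de algebra_simps abs_minus_commute)
  next
    case False
    define e where "e = N0 - N"
    have Ne: "N0 = N + e" and de: "d = real e" using False by (auto simp: e_def d_def)
    define X where "X l = (a0 + real (N0 - 1 - l)) / M - 1" for l
    have Xl: "\<bar>X l - (- 1) * real l / M\<bar> \<le> (A + 2) / M" if "l < e" for l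
    proof -
      have "real (N0 - 1 - l) = real N0 - 1 - real l" using that Ne by simp
      then have "X l - (- 1) * real l / M = (a0 + real N0 - 1 - M) / M"
        using M by (simp add: X_def field_simps)
      then show ?thesis using a M N0 by (simp add: abs_mult divide_simps)
    qed
    have pos: "1 + X l > 0" for l using a M by (simp add: X_def add_pos_nonneg)
    have "(\<Prod>i\<in>{N..<N0}. (a0 + real i) / M) = (\<Prod>l<e. (a0 + real (N0 - 1 - l)) / M)"
      by (rule prod.reindex_bij_witness[of _ "\<lambda>l. N0 - 1 - l" "\<lambda>i. N0 - 1 - i"]) (use Ne in auto)
    also have "\<dots> = (\<Prod>l<e. exp (ln (1 + X l)))"
      using pos M by (intro prod.cong) (auto simp: X_def)
    also have "\<dots> = exp (\<Sum>l<e. ln (1 + X l))" by (simp add: exp_sum)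
    finally have eq: "Efac D a0 n a N = pochhammer a0 N' / pochhammer a N' * exp (\<Sum>l<e. ln (1 + X l))"
      using Efac_less[OF a(1,2), of n D N] False nD by (simp add: N'_def M_def N0_def min_def)
    have "\<bar>(\<Sum>l<e. ln (1 + X l)) - (- 1) * (real e)\<^sup>2 / (2 * M)\<bar>
        \<le> ((A + 2) + 1) * real e / M + 2 * real e * (real e + (A + 2))\<^sup>2 / M\<^sup>2"
      using Xl M a small de by (intro sum_ln_near_linear) (auto simp: algebra_simps)
    then show ?thesis
      using eq by (intro exI[of _ "\<Sum>l<e. ln (1 + X l)"]) (simp add: de algebra_simps)
  qed
qed

text \<open>With d of order sqrt n and M of order n, the errors d / M and d^3 / M^2 vanish and d^2 /
  (2 M) tends to z^2 / (2 D). The hypothesis on \<open>a\<close> carries a logarithm because of the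
  harmonic sum in \<open>pochhammer_ratio_le\<close>.\<close>

lemma Efac_tendsto:
  fixes n N :: "nat \<Rightarrow> nat" and a :: "nat \<Rightarrow> real"
  assumes D: "0 < D" and a0: "0 < a0"
    and n: "filterlim n at_top sequentially"
    and z: "(\<lambda>m. (real (N m) - real (n m) * D) / sqrt (real (n m))) \<longlonglongrightarrow> z"
    and a: "(\<lambda>m. (a m - a0) * ln (real (n m))) \<longlonglongrightarrow> 0"
    and Nn: "\<And>m. N m \<le> n m"
  shows "(\<lambda>m. Efac D a0 (n m) (a m) (N m)) \<longlonglongrightarrow> exp (- z\<^sup>2 / (2 * D))"
proof -
  define A where "A = a0 + a0 / 2"
  define M where "M m = real (n m) * D" for m
  define N0 where "N0 m = nat \<lfloor>real (n m) * D\<rfloor>" for m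
  define d where "d m = \<bar>real (N m) - real (N0 m)\<bar>" for m
  define s where "s m = sqrt (real (n m))" for m
  have rn: "filterlim (\<lambda>m. real (n m)) at_top sequentially"
    by (rule filterlim_compose[OF filterlim_real_sequentially n])
  have s: "filterlim s at_top sequentially"
    unfolding s_def by (rule filterlim_compose[OF sqrt_at_top rn])
  have si: "(\<lambda>m. 1 / s m) \<longlonglongrightarrow> 0"
    using s by (intro tendsto_divide_0[OF tendsto_const] filterlim_at_top_imp_at_infinity)
  have evn: "eventually (\<lambda>m. real (n m) \<ge> max 3 (1 / D)) sequentially"
    using rn unfolding filterlim_at_top by blast
  have ev1: "eventually (\<lambda>m. M m \<ge> 1 \<and> real (n m) \<ge> 3 \<and> ln (real (n m)) \<ge> 1 \<and> s m > 0) sequentially"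
    using evn
  proof eventually_elim
    case (elim m)
    have "exp 1 \<le> (3::real)" using exp_le by simp
    also have "\<dots> \<le> real (n m)" using elim by simp
    finally have "ln (real (n m)) \<ge> 1"
      by (metis exp_gt_zero ln_exp ln_le_cancel_iff order_less_le_trans)
    then show ?case using elim D by (simp add: M_def s_def field_simps)
  qed
  have a_lim: "(\<lambda>m. a m - a0) \<longlonglongrightarrow> 0"
  proof (rule Lim_null_comparison[OF _ tendsto_rabs_zero[OF a]])
    show "eventually (\<lambda>m. norm (a m - a0) \<le> \<bar>(a m - a0) * ln (real (n m))\<bar>) sequentially"
      using ev1
    proof eventually_elim
      case (elim m)
      have "\<bar>a m - a0\<bar> * 1 \<le> \<bar>a m - a0\<bar> * \<bar>ln (real (n m))\<bar>"
        using elim by (intro mult_left_mono) auto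
      then show ?case by (simp add: abs_mult)
    qed
  qed
  have ev2: "eventually (\<lambda>m. a0 / 2 \<le> a m \<and> a m \<le> A) sequentially"
  proof -
    have "eventually (\<lambda>m. \<bar>a m - a0\<bar> < a0 / 2) sequentially"
      using tendstoD[OF a_lim, of "a0 / 2"] a0 by (simp add: dist_real_def)
    then show ?thesis by eventually_elim (unfold A_def, linarith)
  qed
  have N0diff: "\<bar>real (N0 m) - M m\<bar> \<le> 1" for m
    using D by (simp add: N0_def M_def) linarith
  have ds: "(\<lambda>m. d m / s m) \<longlonglongrightarrow> \<bar>z\<bar>"
  proof -
    have "(\<lambda>m. (real (N m) - real (N0 m)) / s m - (real (N m) - M m) / s m) \<longlonglongrightarrow> 0"
    proof (rule Lim_null_comparison[OF _ si], rule always_eventually, rule allI)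
      fix m
      have "(real (N m) - real (N0 m)) / s m - (real (N m) - M m) / s m = (M m - real (N0 m)) / s m"
        by (simp flip: diff_divide_distrib)
      then show "norm ((real (N m) - real (N0 m)) / s m - (real (N m) - M m) / s m) \<le> 1 / s m"
        using N0diff[of m] by (simp add: s_def abs_mult abs_minus_commute divide_right_mono)
    qed
    from tendsto_add[OF this z[folded s_def M_def]]
    have "(\<lambda>m. (real (N m) - real (N0 m)) / s m) \<longlonglongrightarrow> z" by (simp add: s_def M_def)
    from tendsto_rabs[OF this] show ?thesis by (simp add: d_def s_def)
  qed
  have ss: "s m * s m = real (n m)" for m by (simp add: s_def)
  have Mi: "(\<lambda>m. s m / M m) \<longlonglongrightarrow> 0"
  proof -
    have "s m / M m = (1 / s m) * (1 / D)" for m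
      unfolding M_def ss[of m, symmetric] by simp
    then show ?thesis using tendsto_mult_left_zero[OF si, of "1 / D"] by simp
  qed
  have dM: "(\<lambda>m. d m / M m) \<longlonglongrightarrow> 0"
  proof (rule Lim_transform_eventually)
    show "(\<lambda>m. (d m / s m) * (s m / M m)) \<longlonglongrightarrow> 0" using tendsto_mult[OF ds Mi] by simp
    show "eventually (\<lambda>m. (d m / s m) * (s m / M m) = d m / M m) sequentially"
      using ev1 by eventually_elim auto
  qed
  have iM: "(\<lambda>m. 1 / M m) \<longlonglongrightarrow> 0"
  proof (rule Lim_transform_eventually)
    show "(\<lambda>m. (1 / s m) * (s m / M m)) \<longlonglongrightarrow> 0" using tendsto_mult[OF si Mi] by simp
    show "eventually (\<lambda>m. (1 / s m) * (s m / M m) = 1 / M m) sequentially"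
      using ev1 by eventually_elim auto
  qed
  have d2: "(\<lambda>m. (d m)\<^sup>2 / (2 * M m)) \<longlonglongrightarrow> z\<^sup>2 / (2 * D)"
  proof (rule Lim_transform_eventually)
    show "(\<lambda>m. (d m / s m)\<^sup>2 / (2 * D)) \<longlonglongrightarrow> z\<^sup>2 / (2 * D)"
      using tendsto_divide[OF tendsto_power[OF ds, of 2] tendsto_const[of "2 * D"]] D by simp
    show "eventually (\<lambda>m. (d m / s m)\<^sup>2 / (2 * D) = (d m)\<^sup>2 / (2 * M m)) sequentially"
      using ev1 by eventually_elim (use D ss in \<open>simp add: M_def power_divide power2_eq_square\<close>)
  qed
  define err where "err m = (A + 3) * d m / M m + 2 * d m * (d m + A + 2)\<^sup>2 / (M m)\<^sup>2" for m
  have err: "err \<longlonglongrightarrow> 0"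
  proof (rule Lim_transform_eventually)
    have 1: "(\<lambda>m. d m / s m + (A + 2) * (1 / s m)) \<longlonglongrightarrow> \<bar>z\<bar> + (A + 2) * 0"
      by (intro tendsto_intros ds si)
    have 2: "(\<lambda>m. s m / M m * s m) \<longlonglongrightarrow> 1 / D"
    proof (rule Lim_transform_eventually[OF tendsto_const])
      show "eventually (\<lambda>m. 1 / D = s m / M m * s m) sequentially"
        using ev1 by eventually_elim (use D ss in \<open>auto simp: M_def field_simps\<close>)
    qed
    have "(\<lambda>m. (A + 3) * (d m / M m) + 2 * (d m / M m) * ((d m / s m + (A + 2) * (1 / s m))\<^sup>2 * (s m / M m * s m)))
        \<longlonglongrightarrow> (A + 3) * 0 + 2 * 0 * ((\<bar>z\<bar> + (A + 2) * 0)\<^sup>2 * (1 / D))"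
      by (intro tendsto_intros 1 2 dM)
    then show "(\<lambda>m. (A + 3) * (d m / M m) + 2 * (d m / M m) * ((d m / s m + (A + 2) * (1 / s m))\<^sup>2 * (s m / M m * s m))) \<longlonglongrightarrow> 0"
      by simp
    show "eventually (\<lambda>m. (A + 3) * (d m / M m) + 2 * (d m / M m) * ((d m / s m + (A + 2) * (1 / s m))\<^sup>2 * (s m / M m * s m)) = err m) sequentially"
      using ev1
    proof eventually_elim
      case (elim m)
      then have "d m / s m + (A + 2) * (1 / s m) = (d m + A + 2) / s m" by (simp add: field_simps)
      then show ?case using elim by (simp add: err_def power_divide power2_eq_square field_simps)
    qed
  qed
  have small: "eventually (\<lambda>m. (d m + A + 2) / M m \<le> 1 / 2) sequentially"
  proof -
    have "(\<lambda>m. d m / M m + (A + 2) * (1 / M m)) \<longlonglongrightarrow> 0 + (A + 2) * 0"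
      by (intro tendsto_intros dM iM)
    then have "eventually (\<lambda>m. d m / M m + (A + 2) * (1 / M m) < 1 / 2) sequentially"
      by (intro order_tendstoD(2)) auto
    then show ?thesis by eventually_elim (simp add: add_divide_distrib)
  qed
  define P where "P m = pochhammer a0 (min (N m) (N0 m)) / pochhammer (a m) (min (N m) (N0 m))" for m
  define b where "b m = \<bar>a m - a0\<bar> * (1 / (a0/2) + 1 + ln (real (n m)))" for m
  have b: "b \<longlonglongrightarrow> 0"
  proof -
    have "(\<lambda>m. \<bar>a m - a0\<bar> * (1 / (a0/2) + 1) + \<bar>a m - a0\<bar> * ln (real (n m))) \<longlonglongrightarrow> 0 * (1 / (a0/2) + 1) + 0"
    proof (intro tendsto_intros tendsto_rabs_zero[OF a_lim])
      show "(\<lambda>m. \<bar>a m - a0\<bar> * ln (real (n m))) \<longlonglongrightarrow> 0"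
      proof (rule Lim_transform_eventually[OF tendsto_rabs_zero[OF a]])
        show "eventually (\<lambda>m. \<bar>(a m - a0) * ln (real (n m))\<bar> = \<bar>a m - a0\<bar> * ln (real (n m))) sequentially"
          using ev1 by eventually_elim (auto simp: abs_mult)
      qed
    qed
    then show ?thesis by (simp add: b_def[abs_def] algebra_simps)
  qed
  have Pb: "eventually (\<lambda>m. exp (- b m) \<le> P m \<and> P m \<le> exp (b m)) sequentially"
    using ev1 ev2
  proof eventually_elim
    case (elim m)
    have n1: "n m \<ge> 1" using elim by simp
    have le: "min (N m) (N0 m) \<le> n m" using Nn[of m] by simp
    have pos: "pochhammer a0 (min (N m) (N0 m)) > 0" "pochhammer (a m) (min (N m) (N0 m)) > 0"
      using a0 elim by (auto intro!: pochhammer_pos)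
    have "P m \<le> exp (b m)"
      using pochhammer_ratio_le[OF _ _ _ le n1, of "a0/2" "a m" a0] a0 elim by (simp add: P_def b_def)
    \<comment> \<open>The bound on ratios is symmetric in the two parameters, so exchanging them
      controls the reciprocal.\<close>
    moreover have "1 / P m \<le> exp (b m)"
      using pochhammer_ratio_le[OF _ _ _ le n1, of "a0/2" a0 "a m"] a0 elim
      by (simp add: P_def b_def abs_minus_commute)
    moreover have "P m > 0" using pos by (simp add: P_def)
    ultimately show ?case by (simp add: exp_minus field_simps)
  qed
  have P1: "P \<longlonglongrightarrow> 1"
  proof (rule tendsto_sandwich)
    show "eventually (\<lambda>m. exp (- b m) \<le> P m) sequentially" "eventually (\<lambda>m. P m \<le> exp (b m)) sequentially"
      using Pb by (auto elim: eventually_mono)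
    show "(\<lambda>m. exp (- b m)) \<longlonglongrightarrow> 1" using tendsto_exp[OF tendsto_minus[OF b]] by simp
    show "(\<lambda>m. exp (b m)) \<longlonglongrightarrow> 1" using tendsto_exp[OF b] by simp
  qed
  have "\<forall>m. \<exists>t. M m \<ge> 1 \<and> a0 / 2 \<le> a m \<and> a m \<le> A \<and> (d m + A + 2) / M m \<le> 1 / 2 \<longrightarrow>
      Efac D a0 (n m) (a m) (N m) = P m * exp t \<and> \<bar>t + (d m)\<^sup>2 / (2 * M m)\<bar> \<le> err m"
  proof (intro allI)
    fix m
    show "\<exists>t. M m \<ge> 1 \<and> a0 / 2 \<le> a m \<and> a m \<le> A \<and> (d m + A + 2) / M m \<le> 1 / 2 \<longrightarrow>
      Efac D a0 (n m) (a m) (N m) = P m * exp t \<and> \<bar>t + (d m)\<^sup>2 / (2 * M m)\<bar> \<le> err m"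
    proof (cases "M m \<ge> 1 \<and> a0 / 2 \<le> a m \<and> a m \<le> A \<and> (d m + A + 2) / M m \<le> 1 / 2")
      case True
      then have "a m > 0" "a0 \<le> A" using a0 by (auto simp: A_def)
      with Efac_eq_exp[of "a m" a0 A "n m" D "N m"] True a0
      show ?thesis unfolding M_def N0_def d_def P_def err_def by auto
    qed auto
  qed
  then obtain t where t: "\<And>m. M m \<ge> 1 \<and> a0 / 2 \<le> a m \<and> a m \<le> A \<and> (d m + A + 2) / M m \<le> 1 / 2 \<Longrightarrow>
      Efac D a0 (n m) (a m) (N m) = P m * exp (t m) \<and> \<bar>t m + (d m)\<^sup>2 / (2 * M m)\<bar> \<le> err m"
    by metis
  have ev: "eventually (\<lambda>m. Efac D a0 (n m) (a m) (N m) = P m * exp (t m) \<and> \<bar>t m + (d m)\<^sup>2 / (2 * M m)\<bar> \<le> err m) sequentially"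
    using ev1 ev2 small by eventually_elim (use t in auto)
  have "(\<lambda>m. t m + (d m)\<^sup>2 / (2 * M m)) \<longlonglongrightarrow> 0"
    by (rule Lim_null_comparison[OF _ err]) (use ev in \<open>auto elim: eventually_mono\<close>)
  from tendsto_diff[OF this d2] have "t \<longlonglongrightarrow> - (z\<^sup>2 / (2 * D))" by simp
  from tendsto_mult[OF P1 tendsto_exp[OF this]]
  have "(\<lambda>m. P m * exp (t m)) \<longlonglongrightarrow> exp (- z\<^sup>2 / (2 * D))" by simp
  then show ?thesis
    by (rule Lim_transform_eventually) (use ev in \<open>auto elim: eventually_mono\<close>)
qed

section \<open>The Gaussian limit\<close>

lemma nn_integral_gaussian:
  assumes e: "e > 0"
  shows "(\<integral>\<^sup>+ x. ennreal (exp (- e * (x - t)\<^sup>2 / 2)) \<partial>lborel) = ennreal (sqrt (2 * pi / e))"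
proof -
  have s: "1 / sqrt e > 0" using e by simp
  have eq: "exp (- e * (x - t)\<^sup>2 / 2) = sqrt (2 * pi / e) * normal_density t (1 / sqrt e) x" for x
    using e by (simp add: normal_density_def power_divide real_sqrt_divide real_sqrt_mult field_simps)
  have "(\<integral>\<^sup>+ x. ennreal (normal_density t (1 / sqrt e) x) \<partial>lborel) = 1"
    using prob_space.emeasure_space_1[OF prob_space_normal_density[OF s, of t]]
    by (simp add: emeasure_density)
  then show ?thesis
    unfolding eq using e by (simp add: ennreal_mult' nn_integral_cmult normal_density_nonneg)
qed

lemma borel_measurable_lborel_component:
  "i \<in> I \<Longrightarrow> (\<lambda>x. x i :: real) \<in> borel_measurable (PiM I (\<lambda>_. lborel))"
  using measurable_component_singleton[of i I "\<lambda>_. lborel :: real measure"] by simp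

text \<open>Each factor is centred at a multiple of the next coordinate, the last one at a multiple
  of t. Integrating the coordinates in the order 1, ..., k, every integral is invariant under that
  shift. The induction needs t arbitrary, because the coordinate split off takes the place of t in
  the inner integral.\<close>

lemma nn_integral_triangular_gaussian:
  fixes e c :: "nat \<Rightarrow> real"
  assumes "\<And>j. j \<in> {1..k} \<Longrightarrow> e j > 0"
  shows "(\<integral>\<^sup>+ x. (\<Prod>j\<in>{1..k}. ennreal (exp (- e j * (x j - c j * (if j = k then t else x (Suc j)))\<^sup>2 / 2))) \<partial>lebk k)
           = (\<Prod>j\<in>{1..k}. ennreal (sqrt (2 * pi / e j)))"
  using assms
proof (induction k arbitrary: t)
  case 0
  interpret product_sigma_finite "\<lambda>_::nat. lborel :: real measure"
    by standard
  show ?case using nn_integral_empty[of "\<lambda>_. 1"] by (simp add: lebk_def)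
next
  case (Suc k)
  interpret product_sigma_finite "\<lambda>_::nat. lborel :: real measure"
    by standard
  define G where "G x j = ennreal (exp (- e j * (x j - c j * (if j = Suc k then t else x (Suc j)))\<^sup>2 / 2))" for x :: "nat \<Rightarrow> real" and j
  have ins: "{1..Suc k} = insert (Suc k) {1..k}" by auto
  have meas: "(\<lambda>x. \<Prod>j\<in>{1..Suc k}. G x j) \<in> borel_measurable (PiM (insert (Suc k) {1..k}) (\<lambda>_. lborel))"
  proof (rule borel_measurable_prod_ennreal)
    fix j assume j: "j \<in> {1..Suc k}"
    have "(\<lambda>x. if j = Suc k then t else x (Suc j)) \<in> borel_measurable (PiM (insert (Suc k) {1..k}) (\<lambda>_. lborel))"
      using j by (cases "j = Suc k") (auto intro!: borel_measurable_lborel_component)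
    moreover have "(\<lambda>x. x j :: real) \<in> borel_measurable (PiM (insert (Suc k) {1..k}) (\<lambda>_. lborel))"
      by (rule borel_measurable_lborel_component) (use j in auto)
    ultimately show "(\<lambda>x. G x j) \<in> borel_measurable (PiM (insert (Suc k) {1..k}) (\<lambda>_. lborel))"
      unfolding G_def by measurable
  qed
  have "(\<integral>\<^sup>+ x. (\<Prod>j\<in>{1..Suc k}. G x j) \<partial>lebk (Suc k))
      = (\<integral>\<^sup>+ y. \<integral>\<^sup>+ x. (\<Prod>j\<in>{1..Suc k}. G (x(Suc k := y)) j) \<partial>lebk k \<partial>lborel)"
    unfolding lebk_def ins
    by (rule product_nn_integral_insert_rev[OF _ _ meas[unfolded ins]]) auto
  also have "\<dots> = (\<integral>\<^sup>+ y. \<integral>\<^sup>+ x. ennreal (exp (- e (Suc k) * (y - c (Suc k) * t)\<^sup>2 / 2)) *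
      (\<Prod>j\<in>{1..k}. ennreal (exp (- e j * (x j - c j * (if j = k then y else x (Suc j)))\<^sup>2 / 2))) \<partial>lebk k \<partial>lborel)"
    unfolding ins by (intro nn_integral_cong, subst prod.insert)
      (auto simp: G_def intro!: arg_cong2[where f = "(*)"] prod.cong)
  also have "\<dots> = (\<integral>\<^sup>+ y. ennreal (exp (- e (Suc k) * (y - c (Suc k) * t)\<^sup>2 / 2)) *
      (\<Prod>j\<in>{1..k}. ennreal (sqrt (2 * pi / e j))) \<partial>lborel)"
  proof (rule nn_integral_cong)
    fix y :: real
    have m: "(\<lambda>x. \<Prod>j\<in>{1..k}. ennreal (exp (- e j * (x j - c j * (if j = k then y else x (Suc j)))\<^sup>2 / 2))) \<in> borel_measurable (lebk k)"
    proof (rule borel_measurable_prod_ennreal)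
      fix j assume j: "j \<in> {1..k}"
      have "(\<lambda>x. if j = k then y else x (Suc j)) \<in> borel_measurable (lebk k)"
        using j by (cases "j = k") (auto simp: lebk_def)
      moreover have "(\<lambda>x. x j :: real) \<in> borel_measurable (lebk k)"
        using j by (auto simp: lebk_def)
      ultimately show "(\<lambda>x. ennreal (exp (- e j * (x j - c j * (if j = k then y else x (Suc j)))\<^sup>2 / 2))) \<in> borel_measurable (lebk k)"
        by measurable
    qed
    show "(\<integral>\<^sup>+ x. ennreal (exp (- e (Suc k) * (y - c (Suc k) * t)\<^sup>2 / 2)) *
      (\<Prod>j\<in>{1..k}. ennreal (exp (- e j * (x j - c j * (if j = k then y else x (Suc j)))\<^sup>2 / 2))) \<partial>lebk k)
      = ennreal (exp (- e (Suc k) * (y - c (Suc k) * t)\<^sup>2 / 2)) * (\<Prod>j\<in>{1..k}. ennreal (sqrt (2 * pi / e j)))"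
      using m Suc.IH[of y] Suc.prems by (simp add: nn_integral_cmult)
  qed
  also have "\<dots> = (\<Prod>j\<in>{1..Suc k}. ennreal (sqrt (2 * pi / e j)))"
  proof -
    have "(\<lambda>y. ennreal (exp (- e (Suc k) * (y - c (Suc k) * t)\<^sup>2 / 2))) \<in> borel_measurable lborel"
      by simp
    then show ?thesis
      unfolding ins using nn_integral_gaussian[OF Suc.prems[of "Suc k"], of "c (Suc k) * t"]
      by (simp only: nn_integral_multc) simp
  qed
  finally show ?case unfolding G_def .
qed

text \<open>
  Completing squares from the left brings the Brownian-bridge form into triangular shape, from
  which both the determinant and the Gaussian integral can be read off.
\<close>
lemma telescoping_quadratic:
  fixes p w :: "nat \<Rightarrow> real"
  assumes "m \<ge> 1" "\<And>j. 1 \<le> j \<Longrightarrow> j \<le> m \<Longrightarrow> p j > 0" "\<And>j. 1 \<le> j \<Longrightarrow> j < m \<Longrightarrow> p j < p (Suc j)"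
  assumes "w 0 = 0" "p 0 = 0"
  shows "(\<Sum>a\<in>{1..m}. (w a - w (a - 1))\<^sup>2 / (p a - p (a - 1)))
       = (\<Sum>j\<in>{1..<m}. p (Suc j) / (p j * (p (Suc j) - p j)) * (w j - p j / p (Suc j) * w (Suc j))\<^sup>2) + (w m)\<^sup>2 / p m"
  using assms
proof (induction m rule: dec_induct)
  case base
  then show ?case by simp
next
  case (step m)
  have pos: "p m > 0" "p (Suc m) - p m > 0" "p (Suc m) > 0" using step by auto
  have *: "x\<^sup>2 / P + (y - x)\<^sup>2 / (R - P) = R / (P * (R - P)) * (x - P / R * y)\<^sup>2 + y\<^sup>2 / R"
    if "P > 0" "R - P > 0" "R > 0" for x y P R :: real
  proof -
    have "R / (P * (R - P)) * (x - P / R * y)\<^sup>2 + y\<^sup>2 / R = ((R * x - P * y)\<^sup>2 + P * (R - P) * y\<^sup>2) / (R * P * (R - P))"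
      using that by (simp add: divide_simps power2_eq_square) (simp add: algebra_simps)
    also have "(R * x - P * y)\<^sup>2 + P * (R - P) * y\<^sup>2 = R * (x\<^sup>2 * (R - P) + (y - x)\<^sup>2 * P)"
      by (simp add: power2_eq_square algebra_simps)
    also have "\<dots> / (R * P * (R - P)) = x\<^sup>2 / P + (y - x)\<^sup>2 / (R - P)"
      using that by (simp add: add_frac_eq mult_ac)
    finally show ?thesis ..
  qed
  show ?case
    using step.IH step.prems step.hyps *[OF pos, of "w m" "w (Suc m)"] by simp
qed

text \<open>Polarisation at sums of unit vectors. It turns equality of two quadratic forms into
  equality of matrices, which the permutation formula for the determinant asks for.\<close>

lemma symmetric_quadratic_zero:
  fixes M :: "nat \<Rightarrow> nat \<Rightarrow> real"
  assumes fin: "finite I" and sym: "\<And>i j. i \<in> I \<Longrightarrow> j \<in> I \<Longrightarrow> M i j = M j i"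
    and z: "\<And>x. (\<Sum>i\<in>I. \<Sum>j\<in>I. x i * M i j * x j) = 0"
    and ij: "i \<in> I" "j \<in> I"
  shows "M i j = 0"
proof -
  have bil: "(\<Sum>a\<in>I. \<Sum>b\<in>I. (if a = u then 1 else 0) * M a b * (if b = v then 1 else 0)) = M u v"
    if "u \<in> I" "v \<in> I" for u v
  proof -
    have "(\<Sum>a\<in>I. \<Sum>b\<in>I. (if a = u then 1 else 0) * M a b * (if b = v then 1 else 0))
        = (\<Sum>a\<in>I. if a = u then M a v else 0)"
      using that fin by (intro sum.cong refl) (simp add: if_distrib sum.delta cong: if_cong)
    then show ?thesis using that fin by (simp add: sum.delta)
  qed
  let ?\<delta> = "\<lambda>u a. if a = u then 1 else 0 :: real"
  have "0 = (\<Sum>a\<in>I. \<Sum>b\<in>I. (?\<delta> i a + ?\<delta> j a) * M a b * (?\<delta> i b + ?\<delta> j b))"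
    using z[of "\<lambda>a. ?\<delta> i a + ?\<delta> j a"] by simp
  also have "\<dots> = (\<Sum>a\<in>I. \<Sum>b\<in>I. ?\<delta> i a * M a b * ?\<delta> i b) + (\<Sum>a\<in>I. \<Sum>b\<in>I. ?\<delta> j a * M a b * ?\<delta> j b)
      + (\<Sum>a\<in>I. \<Sum>b\<in>I. ?\<delta> i a * M a b * ?\<delta> j b) + (\<Sum>a\<in>I. \<Sum>b\<in>I. ?\<delta> j a * M a b * ?\<delta> i b)"
    by (simp only: distrib_left distrib_right sum.distrib)
  also have "\<dots> = 0 + 0 + M i j + M j i"
    using z[of "?\<delta> i"] z[of "?\<delta> j"] bil ij by simp
  finally show ?thesis using sym[OF ij] by simp
qed

text \<open>Bordering with a unit row and column moves the index set from \<open>{1..k}\<close> to the range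
  \<open>{0..<Suc k}\<close> used for matrices without touching the determinant.\<close>
definition bordered :: "nat \<Rightarrow> (nat \<Rightarrow> nat \<Rightarrow> real) \<Rightarrow> real mat" where
  "bordered k M = mat (Suc k) (Suc k) (\<lambda>(i, j). if i = 0 \<or> j = 0 then (if i = j then 1 else 0) else M i j)"

text \<open>A permutation that moves 0 picks a zero of the unit row; those that fix 0 are exactly
  the permutations of {1..k}.\<close>

lemma det_bordered: "Determinant.det (bordered k M) = detk k M"
proof -
  let ?A = "bordered k M"
  have A: "?A \<in> carrier_mat (Suc k) (Suc k)" by (simp add: bordered_def)
  have fin: "finite {\<sigma>. \<sigma> permutes {0..<Suc k}}" by (rule finite_permutations) simp
  have sub: "{\<sigma>. \<sigma> permutes {1..k}} \<subseteq> {\<sigma>. \<sigma> permutes {0..<Suc k}}"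
    by (auto intro: permutes_subset)
  have "Determinant.det ?A = (\<Sum>\<sigma> | \<sigma> permutes {0..<Suc k}. of_int (sign \<sigma>) * (\<Prod>i = 0..<Suc k. ?A $$ (i, \<sigma> i)))"
    using det_def'[OF A] by simp
  also have "\<dots> = (\<Sum>\<sigma> | \<sigma> permutes {1..k}. of_int (sign \<sigma>) * (\<Prod>i = 0..<Suc k. ?A $$ (i, \<sigma> i)))"
  proof (rule sum.mono_neutral_right[OF fin sub], rule ballI)
    fix \<sigma> assume "\<sigma> \<in> {\<sigma>. \<sigma> permutes {0..<Suc k}} - {\<sigma>. \<sigma> permutes {1..k}}"
    then have s: "\<sigma> permutes {0..<Suc k}" "\<not> \<sigma> permutes {1..k}" by auto
    have "\<sigma> 0 \<noteq> 0"
    proof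
      assume 0: "\<sigma> 0 = 0"
      have "\<sigma> permutes {1..k}"
        by (rule permutes_superset[OF s(1)]) (use 0 in \<open>auto simp: Suc_le_eq\<close>)
      with s show False by simp
    qed
    moreover have "\<sigma> 0 < Suc k" using permutes_in_image[OF s(1), of 0] by simp
    ultimately have "?A $$ (0, \<sigma> 0) = 0" by (simp add: bordered_def)
    then have "(\<Prod>i = 0..<Suc k. ?A $$ (i, \<sigma> i)) = 0" by (intro prod_zero) auto
    then show "of_int (sign \<sigma>) * (\<Prod>i = 0..<Suc k. ?A $$ (i, \<sigma> i)) = 0" by simp
  qed
  also have "\<dots> = detk k M"
    unfolding detk_def
  proof (rule sum.cong[OF refl])
    fix \<sigma> assume s: "\<sigma> \<in> {\<sigma>. \<sigma> permutes {1..k}}"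
    have "{0..<Suc k} = insert 0 {1..k}" by auto
    moreover have "\<sigma> 0 = 0" using s by (auto simp: permutes_def)
    moreover have \<sigma>: "\<sigma> i \<in> {1..k}" if "i \<in> {1..k}" for i
      using permutes_in_image[of \<sigma> "{1..k}" i] s that by blast
    ultimately have "(\<Prod>i = 0..<Suc k. ?A $$ (i, \<sigma> i)) = (\<Prod>i\<in>{1..k}. M i (\<sigma> i))"
      using \<sigma> by (force simp: bordered_def less_Suc_eq_le intro!: prod.cong)
    then show "of_int (sign \<sigma>) * (\<Prod>i = 0..<Suc k. ?A $$ (i, \<sigma> i)) = of_int (sign \<sigma>) * (\<Prod>i\<in>{1..k}. M i (\<sigma> i))"
      by simp
  qed
  finally show ?thesis .
qed

lemma det_bordered_triangular:
  assumes "\<And>i j. i \<in> {1..k} \<Longrightarrow> j \<in> {1..k} \<Longrightarrow> j < i \<Longrightarrow> V i j = 0"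
  shows "Determinant.det (bordered k V) = (\<Prod>i\<in>{1..k}. V i i)"
proof -
  have "upper_triangular (bordered k V)"
    using assms by (auto simp: upper_triangular_def bordered_def)
  then have "Determinant.det (bordered k V) = prod_list (diag_mat (bordered k V))"
    by (rule det_upper_triangular[of _ "Suc k"]) (simp add: bordered_def)
  also have "\<dots> = (\<Prod>i = 0..<Suc k. bordered k V $$ (i, i))"
    by (simp add: prod_list_diag_prod) (simp add: bordered_def)
  also have "{0..<Suc k} = insert 0 {1..k}" by auto
  finally show ?thesis by (auto simp: bordered_def)
qed

text \<open>Bordering commutes with the product V^T diag(e) V, since the unit corner contributes
  only 1 times 1. Multiplicativity of the determinant and triangularity do the rest.\<close>

lemma detk_triangular_congruence:
  assumes V: "\<And>i j. i \<in> {1..k} \<Longrightarrow> j \<in> {1..k} \<Longrightarrow> j < i \<Longrightarrow> V i j = 0"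
    and Q: "\<And>i j. i \<in> {1..k} \<Longrightarrow> j \<in> {1..k} \<Longrightarrow> Q i j = (\<Sum>l\<in>{1..k}. V l i * e l * V l j)"
  shows "detk k Q = (\<Prod>i\<in>{1..k}. e i * (V i i)\<^sup>2)"
proof -
  let ?W = "bordered k V" and ?EW = "bordered k (\<lambda>l j. e l * V l j)"
  have W: "?W \<in> carrier_mat (Suc k) (Suc k)" "?EW \<in> carrier_mat (Suc k) (Suc k)"
    by (simp_all add: bordered_def)
  have "bordered k Q = transpose_mat ?W * ?EW"
  proof (rule eq_matI)
    fix i j assume "i < dim_row (transpose_mat ?W * ?EW)" "j < dim_col (transpose_mat ?W * ?EW)"
    then have ij: "i < Suc k" "j < Suc k" by (simp_all add: bordered_def)
    have "(transpose_mat ?W * ?EW) $$ (i, j) = (\<Sum>l = 0..<Suc k. ?W $$ (l, i) * ?EW $$ (l, j))"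
      using ij by (simp add: bordered_def scalar_prod_def)
    also have "{0..<Suc k} = insert 0 {1..k}" by auto
    also have "(\<Sum>l\<in>insert 0 {1..k}. ?W $$ (l, i) * ?EW $$ (l, j)) = bordered k Q $$ (i, j)"
      using ij by (auto simp: bordered_def Q mult.assoc intro!: sum.cong)
    finally show "bordered k Q $$ (i, j) = (transpose_mat ?W * ?EW) $$ (i, j)" ..
  qed (simp_all add: bordered_def)
  then have "detk k Q = Determinant.det (transpose_mat ?W * ?EW)" by (simp flip: det_bordered)
  also have "\<dots> = Determinant.det ?W * Determinant.det ?EW"
    using W by (subst Determinant.det_mult[of _ "Suc k"]) (auto simp: Determinant.det_transpose[OF W(1)])
  also have "\<dots> = (\<Prod>i\<in>{1..k}. V i i) * (\<Prod>i\<in>{1..k}. e i * V i i)"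
    using V by (subst (1 2) det_bordered_triangular) auto
  finally show ?thesis by (simp add: prod.distrib power2_eq_square mult_ac)
qed

text \<open>The value 0 at the fictitious indices 0 and k + 1 encodes that the infinite end points
  do not move. Sums over all k + 1 cells can then be written uniformly, whatever a vector holds
  outside {1..k}.\<close>

definition slope :: "nat \<Rightarrow> (real \<Rightarrow> real) \<Rightarrow> (nat \<Rightarrow> real) \<Rightarrow> nat \<Rightarrow> real" where
  "slope k f0 \<theta>0 j = (if j \<in> {1..k} then f0 (\<theta>0 j) else 0)"

section \<open>The precision matrix as a sum of squares\<close>

context
  fixes k :: nat and p :: "nat \<Rightarrow> real" and f0 :: "real \<Rightarrow> real" and \<theta>0 :: "nat \<Rightarrow> real"
  assumes k: "k \<ge> 1"
    and p_range: "\<forall>j\<in>{1..k}. 0 < p j \<and> p j < 1"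
    and p_mono: "\<forall>j. 1 \<le> j \<longrightarrow> j < k \<longrightarrow> p j < p (Suc j)"
    and f0_pos: "\<forall>j\<in>{1..k}. f0 (\<theta>0 j) > 0"
begin

abbreviation "slp \<equiv> slope k f0 \<theta>0"

text \<open>With u = T x, the diagonal part of H contributes the first k squares. The rank-one part
  contributes the squared sum of the u a, divided by 1 - p k. That sum telescopes to
  \<open>slp k * x k\<close>, so this is the square belonging to the last cell.\<close>

lemma SigmaInv_quadratic:
  "(\<Sum>i\<in>{1..k}. \<Sum>j\<in>{1..k}. x i * SigmaInv k p f0 \<theta>0 i j * x j)
     = (\<Sum>a\<in>{1..k+1}. (slp a * x a - slp (a - 1) * x (a - 1))\<^sup>2 / dp k p a)"
proof -
  let ?I = "{1..k}"
  define u where "u a = (\<Sum>i\<in>?I. Tmat k f0 \<theta>0 a i * x i)" for a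
  have u: "u a = slp a * x a - slp (a - 1) * x (a - 1)" if "a \<in> ?I" for a
  proof -
    have "u a = (\<Sum>i\<in>?I. (if i = a then slp a * x a else 0) - (if i = a - 1 then slp (a - 1) * x (a - 1) else 0))"
      unfolding u_def using that by (intro sum.cong refl) (auto simp: Tmat_def slope_def)
    also have "\<dots> = slp a * x a - (if a - 1 \<in> ?I then slp (a - 1) * x (a - 1) else 0)"
      using that by (simp add: sum_subtractf sum.delta)
    finally show ?thesis by (auto simp: slope_def)
  qed
  have "(\<Sum>i\<in>?I. \<Sum>j\<in>?I. x i * SigmaInv k p f0 \<theta>0 i j * x j)
      = (\<Sum>i\<in>?I. \<Sum>j\<in>?I. \<Sum>a\<in>?I. \<Sum>b\<in>?I. (Tmat k f0 \<theta>0 a i * x i) * Hmat k p a b * (Tmat k f0 \<theta>0 b j * x j))"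
    unfolding SigmaInv_def by (simp add: sum_distrib_left sum_distrib_right mult_ac)
  also have "\<dots> = (\<Sum>a\<in>?I. \<Sum>b\<in>?I. \<Sum>i\<in>?I. \<Sum>j\<in>?I. (Tmat k f0 \<theta>0 a i * x i) * Hmat k p a b * (Tmat k f0 \<theta>0 b j * x j))"
  proof -
    have "(\<Sum>i\<in>?I. \<Sum>j\<in>?I. \<Sum>a\<in>?I. \<Sum>b\<in>?I. h i j a b) = (\<Sum>a\<in>?I. \<Sum>b\<in>?I. \<Sum>i\<in>?I. \<Sum>j\<in>?I. h i j a b)"
      for h :: "nat \<Rightarrow> nat \<Rightarrow> nat \<Rightarrow> nat \<Rightarrow> real"
    proof -
      have "(\<Sum>i\<in>?I. \<Sum>j\<in>?I. \<Sum>a\<in>?I. \<Sum>b\<in>?I. h i j a b) = (\<Sum>i\<in>?I. \<Sum>a\<in>?I. \<Sum>b\<in>?I. \<Sum>j\<in>?I. h i j a b)"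
        
      proof (rule sum.cong[OF refl])
        fix i assume "i \<in> ?I"
        have "(\<Sum>j\<in>?I. \<Sum>a\<in>?I. \<Sum>b\<in>?I. h i j a b) = (\<Sum>a\<in>?I. \<Sum>j\<in>?I. \<Sum>b\<in>?I. h i j a b)"
          by (rule sum.swap)
        also have "\<dots> = (\<Sum>a\<in>?I. \<Sum>b\<in>?I. \<Sum>j\<in>?I. h i j a b)"
          by (intro sum.cong refl sum.swap)
        finally show "(\<Sum>j\<in>?I. \<Sum>a\<in>?I. \<Sum>b\<in>?I. h i j a b) = (\<Sum>a\<in>?I. \<Sum>b\<in>?I. \<Sum>j\<in>?I. h i j a b)" .
      qed
      also have "\<dots> = (\<Sum>a\<in>?I. \<Sum>b\<in>?I. \<Sum>i\<in>?I. \<Sum>j\<in>?I. h i j a b)"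
      proof -
        have "(\<Sum>i\<in>?I. \<Sum>a\<in>?I. \<Sum>b\<in>?I. \<Sum>j\<in>?I. h i j a b) = (\<Sum>a\<in>?I. \<Sum>i\<in>?I. \<Sum>b\<in>?I. \<Sum>j\<in>?I. h i j a b)"
          by (rule sum.swap)
        also have "\<dots> = (\<Sum>a\<in>?I. \<Sum>b\<in>?I. \<Sum>i\<in>?I. \<Sum>j\<in>?I. h i j a b)"
          by (intro sum.cong refl sum.swap)
        finally show ?thesis .
      qed
      finally show ?thesis .
    qed
    then show ?thesis by this
  qed
  also have "\<dots> = (\<Sum>a\<in>?I. \<Sum>b\<in>?I. u a * Hmat k p a b * u b)"
    unfolding u_def by (simp only: sum_distrib_left[symmetric] sum_distrib_right[symmetric])
  also have "\<dots> = (\<Sum>a\<in>?I. \<Sum>b\<in>?I. (if b = a then (u a)\<^sup>2 / dp k p a else 0) + u a * u b / (1 - p k))"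
    by (intro sum.cong refl) (auto simp: Hmat_def power2_eq_square distrib_left distrib_right)
  also have "\<dots> = (\<Sum>a\<in>?I. (u a)\<^sup>2 / dp k p a) + (\<Sum>a\<in>?I. u a)\<^sup>2 / (1 - p k)"
    by (simp add: sum.distrib sum.delta power2_eq_square sum_product sum_divide_distrib)
  also have "(\<Sum>a\<in>?I. u a) = slp k * x k"
  proof -
    have "(\<Sum>a\<in>?I. u a) = (\<Sum>a\<in>{Suc 0..k}. slp a * x a - slp (a - 1) * x (a - 1))"
      using u by (intro sum.cong) auto
    also have "\<dots> = slp k * x k - slp 0 * x 0"
      by (rule sum_telescope'') simp
    finally show ?thesis by (simp add: slope_def)
  qed
  also have "(\<Sum>a\<in>?I. (u a)\<^sup>2 / dp k p a) = (\<Sum>a\<in>?I. (slp a * x a - slp (a - 1) * x (a - 1))\<^sup>2 / dp k p a)"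
    using u by (intro sum.cong) auto
  also have "\<dots> + (slp k * x k)\<^sup>2 / (1 - p k) = (\<Sum>a\<in>{1..k+1}. (slp a * x a - slp (a - 1) * x (a - 1))\<^sup>2 / dp k p a)"
  proof -
    have "dp k p (k + 1) = 1 - p k" using k by (simp add: dp_def pext_def)
    then show ?thesis by (simp add: slope_def)
  qed
  finally show ?thesis .
qed

text \<open>For Brownian motion W, given its value at time p (j + 1), the mean of W at time p j is
  \<open>cw j\<close> times that value and the variance is the inverse of \<open>cweight j\<close>.
  For j = k the next time is 1, where the bridge is tied to 0, hence
  \<open>cw k = 0\<close>.\<close>

definition "cw j = (if j = k then 0 else p j / p (Suc j))"
definition "cweight j = pext k p (Suc j) / (p j * (pext k p (Suc j) - p j))"

lemma cweight_pos: "j \<in> {1..k} \<Longrightarrow> cweight j > 0"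
  using p_range p_mono by (auto simp: cweight_def pext_def intro!: divide_pos_pos mult_pos_pos add_pos_pos)

lemma SigmaInv_triangular_quadratic:
  "(\<Sum>i\<in>{1..k}. \<Sum>j\<in>{1..k}. x i * SigmaInv k p f0 \<theta>0 i j * x j)
     = (\<Sum>j\<in>{1..k}. cweight j * (slp j * x j - cw j * slp (Suc j) * x (Suc j))\<^sup>2)"
proof -
  define P where "P = pext k p"
  define w where "w a = slp a * x a" for a
  have P: "P 0 = 0" "P (k + 1) = 1" "\<And>j. j \<in> {1..k} \<Longrightarrow> P j = p j" by (auto simp: P_def pext_def)
  have "(\<Sum>a\<in>{1..k+1}. (w a - w (a - 1))\<^sup>2 / (P a - P (a - 1)))
       = (\<Sum>j\<in>{1..<k+1}. P (Suc j) / (P j * (P (Suc j) - P j)) * (w j - P j / P (Suc j) * w (Suc j))\<^sup>2) + (w (k+1))\<^sup>2 / P (k+1)"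
  proof (rule telescoping_quadratic)
    show "P j > 0" if "1 \<le> j" "j \<le> k + 1" for j using that p_range by (auto simp: P_def pext_def)
    show "P j < P (Suc j)" if "1 \<le> j" "j < k + 1" for j
      using that p_range p_mono by (auto simp: P_def pext_def)
  qed (auto simp: w_def slope_def P)
  also have "w (k + 1) = 0" by (simp add: w_def slope_def)
  also have "{1..<k+1} = {1..k}" by auto
  also have "(\<Sum>j\<in>{1..k}. P (Suc j) / (P j * (P (Suc j) - P j)) * (w j - P j / P (Suc j) * w (Suc j))\<^sup>2)
      = (\<Sum>j\<in>{1..k}. cweight j * (slp j * x j - cw j * slp (Suc j) * x (Suc j))\<^sup>2)"
  proof (intro sum.cong refl)
    fix j assume j: "j \<in> {1..k}"
    show "P (Suc j) / (P j * (P (Suc j) - P j)) * (w j - P j / P (Suc j) * w (Suc j))\<^sup>2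
      = cweight j * (slp j * x j - cw j * slp (Suc j) * x (Suc j))\<^sup>2"
      using j by (auto simp: cweight_def cw_def w_def P_def pext_def slope_def mult.assoc)
  qed
  finally show ?thesis unfolding SigmaInv_quadratic w_def P_def dp_def by simp
qed

text \<open>Row l of the bidiagonal \<open>V\<close> is the linear form in the l-th square.
  Agreement of \<open>SigmaInv\<close> with V^T diag(cweight) V follows from equality of the
  quadratic forms and symmetry, without computing entries.\<close>

lemma detk_SigmaInv: "detk k (SigmaInv k p f0 \<theta>0) = (\<Prod>j\<in>{1..k}. cweight j * (slp j)\<^sup>2)"
proof -
  define V where "V l j = (if j = l then slp l else if j = Suc l then - cw l * slp (Suc l) else 0)" for l j
  define S where "S = SigmaInv k p f0 \<theta>0"
  define R where "R i j = (\<Sum>l\<in>{1..k}. V l i * cweight l * V l j)" for i j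
  have Vx: "(\<Sum>i\<in>{1..k}. V l i * x i) = slp l * x l - cw l * slp (Suc l) * x (Suc l)" if "l \<in> {1..k}" for l x
  proof -
    have "(\<Sum>i\<in>{1..k}. V l i * x i) = (\<Sum>i\<in>{1..k}. (if i = l then slp l * x l else 0) +
         (if i = Suc l then - cw l * slp (Suc l) * x (Suc l) else 0))"
      by (intro sum.cong) (auto simp: V_def)
    also have "\<dots> = slp l * x l + (if Suc l \<in> {1..k} then - cw l * slp (Suc l) * x (Suc l) else 0)"
      using that by (simp add: sum.distrib sum.delta)
    finally show ?thesis by (auto simp: slope_def)
  qed
  have Rq: "(\<Sum>i\<in>{1..k}. \<Sum>j\<in>{1..k}. x i * R i j * x j)
     = (\<Sum>j\<in>{1..k}. cweight j * (slp j * x j - cw j * slp (Suc j) * x (Suc j))\<^sup>2)" for x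
  proof -
    have "(\<Sum>i\<in>{1..k}. \<Sum>j\<in>{1..k}. x i * R i j * x j)
        = (\<Sum>i\<in>{1..k}. \<Sum>j\<in>{1..k}. \<Sum>l\<in>{1..k}. cweight l * ((V l i * x i) * (V l j * x j)))"
      unfolding R_def by (simp add: sum_distrib_left sum_distrib_right mult_ac)
    also have "\<dots> = (\<Sum>i\<in>{1..k}. \<Sum>l\<in>{1..k}. \<Sum>j\<in>{1..k}. cweight l * ((V l i * x i) * (V l j * x j)))"
      by (intro sum.cong refl sum.swap)
    also have "\<dots> = (\<Sum>l\<in>{1..k}. \<Sum>i\<in>{1..k}. \<Sum>j\<in>{1..k}. cweight l * ((V l i * x i) * (V l j * x j)))"
      by (rule sum.swap)
    also have "\<dots> = (\<Sum>l\<in>{1..k}. cweight l * (\<Sum>i\<in>{1..k}. V l i * x i)\<^sup>2)"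
      by (simp only: sum_distrib_left[symmetric] sum_distrib_right[symmetric] power2_eq_square)
    also have "\<dots> = (\<Sum>j\<in>{1..k}. cweight j * (slp j * x j - cw j * slp (Suc j) * x (Suc j))\<^sup>2)"
      using Vx by (intro sum.cong) auto
    finally show ?thesis .
  qed
  have Ssym: "S i j = S j i" for i j
  proof -
    have "S i j = (\<Sum>b\<in>{1..k}. \<Sum>a\<in>{1..k}. Tmat k f0 \<theta>0 a i * Hmat k p a b * Tmat k f0 \<theta>0 b j)"
      unfolding S_def SigmaInv_def by (rule sum.swap)
    also have "\<dots> = S j i"
      unfolding S_def SigmaInv_def by (intro sum.cong refl) (auto simp: Hmat_def)
    finally show ?thesis .
  qed
  have eq: "S i j = R i j" if "i \<in> {1..k}" "j \<in> {1..k}" for i j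
  proof -
    have "S i j - R i j = 0"
    proof (rule symmetric_quadratic_zero[where I = "{1..k}" and M = "\<lambda>i j. S i j - R i j"])
      show "S i j - R i j = S j i - R j i" for i j
        using Ssym[of i j] by (simp add: R_def mult_ac)
      show "(\<Sum>i\<in>{1..k}. \<Sum>j\<in>{1..k}. x i * (S i j - R i j) * x j) = 0" for x
        using Rq[of x] SigmaInv_triangular_quadratic[of x]
        by (simp add: S_def left_diff_distrib right_diff_distrib sum_subtractf)
    qed (use that in auto)
    then show ?thesis by simp
  qed
  have "detk k S = (\<Prod>i\<in>{1..k}. cweight i * (V i i)\<^sup>2)"
    by (rule detk_triangular_congruence) (use eq in \<open>auto simp: V_def R_def\<close>)
  then show ?thesis by (simp add: S_def V_def)
qed

text \<open>Pulling \<open>slp j\<close> out of each square brings it to the form of the triangular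
  Gaussian integral with e j = cweight j times the square of \<open>slp j\<close>. The product of
  these e j is also the determinant, so the constants cancel.\<close>

lemma nn_integral_SigmaInv_density:
  "(\<integral>\<^sup>+ x. ennreal ((2 * pi) powr (- real k / 2) * sqrt (detk k (SigmaInv k p f0 \<theta>0))
     * exp (- (\<Sum>i\<in>{1..k}. \<Sum>j\<in>{1..k}. x i * SigmaInv k p f0 \<theta>0 i j * x j) / 2)) \<partial>lebk k) = 1"
proof -
  define e where "e j = cweight j * (slp j)\<^sup>2" for j
  define c where "c j = cw j * slp (Suc j) / slp j" for j
  have sl: "slp j > 0" if "j \<in> {1..k}" for j using that f0_pos by (simp add: slope_def)
  have e: "e j > 0" if "j \<in> {1..k}" for j
    using cweight_pos[OF that] sl[OF that] by (simp add: e_def)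
  have ex: "ennreal (exp (- (\<Sum>i\<in>{1..k}. \<Sum>j\<in>{1..k}. x i * SigmaInv k p f0 \<theta>0 i j * x j) / 2))
     = (\<Prod>j\<in>{1..k}. ennreal (exp (- e j * (x j - c j * (if j = k then 0 else x (Suc j)))\<^sup>2 / 2)))" for x
  proof -
    have "(\<Sum>i\<in>{1..k}. \<Sum>j\<in>{1..k}. x i * SigmaInv k p f0 \<theta>0 i j * x j)
        = (\<Sum>j\<in>{1..k}. e j * (x j - c j * (if j = k then 0 else x (Suc j)))\<^sup>2)"
      unfolding SigmaInv_triangular_quadratic
    proof (intro sum.cong refl)
      fix j assume j: "j \<in> {1..k}"
      have "slp j * x j - cw j * slp (Suc j) * x (Suc j) = slp j * (x j - c j * (if j = k then 0 else x (Suc j)))"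
        using sl[OF j] by (auto simp: c_def cw_def field_simps)
      then show "cweight j * (slp j * x j - cw j * slp (Suc j) * x (Suc j))\<^sup>2 = e j * (x j - c j * (if j = k then 0 else x (Suc j)))\<^sup>2"
        by (simp add: e_def power_mult_distrib mult_ac)
    qed
    then have "exp (- (\<Sum>i\<in>{1..k}. \<Sum>j\<in>{1..k}. x i * SigmaInv k p f0 \<theta>0 i j * x j) / 2)
       = (\<Prod>j\<in>{1..k}. exp (- e j * (x j - c j * (if j = k then 0 else x (Suc j)))\<^sup>2 / 2))"
      by (simp add: sum_negf[symmetric] sum_divide_distrib flip: exp_sum)
    then show ?thesis by (simp add: prod_ennreal)
  qed
  define C where "C = (2 * pi) powr (- real k / 2) * sqrt (detk k (SigmaInv k p f0 \<theta>0))"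
  have det: "detk k (SigmaInv k p f0 \<theta>0) > 0"
    unfolding detk_SigmaInv e_def[symmetric] by (rule prod_pos) (rule e)
  then have C0: "C \<ge> 0" by (simp add: C_def)
  have "(\<integral>\<^sup>+ x. ennreal (C * exp (- (\<Sum>i\<in>{1..k}. \<Sum>j\<in>{1..k}. x i * SigmaInv k p f0 \<theta>0 i j * x j) / 2)) \<partial>lebk k)
     = ennreal C * (\<integral>\<^sup>+ x. ennreal (exp (- (\<Sum>i\<in>{1..k}. \<Sum>j\<in>{1..k}. x i * SigmaInv k p f0 \<theta>0 i j * x j) / 2)) \<partial>lebk k)"
    using C0 by (subst nn_integral_cmult[symmetric]) (auto simp: ennreal_mult' lebk_def intro!: measurable_compose[OF _ measurable_ennreal])
  also have "\<dots> = ennreal C * (\<Prod>j\<in>{1..k}. ennreal (sqrt (2 * pi / e j)))"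
    unfolding ex using nn_integral_triangular_gaussian[of k e c 0] e by simp
  also have "\<dots> = ennreal (C * (\<Prod>j\<in>{1..k}. sqrt (2 * pi / e j)))"
    using e C0 by (subst prod_ennreal) (auto simp: ennreal_mult' less_imp_le)
  also have "C * (\<Prod>j\<in>{1..k}. sqrt (2 * pi / e j)) = 1"
  proof -
    have "(\<Prod>j\<in>{1..k}. sqrt (2 * pi / e j)) = sqrt (\<Prod>j\<in>{1..k}. 2 * pi / e j)"
      by (induction k) (auto simp: real_sqrt_mult[symmetric])
    also have "(\<Prod>j\<in>{1..k}. 2 * pi / e j) = (2 * pi) ^ k / detk k (SigmaInv k p f0 \<theta>0)"
      unfolding detk_SigmaInv by (simp add: prod_dividef e_def)
    finally have 1: "(\<Prod>j\<in>{1..k}. sqrt (2 * pi / e j)) = sqrt ((2 * pi) ^ k) / sqrt (detk k (SigmaInv k p f0 \<theta>0))"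
      by (simp add: real_sqrt_divide)
    have 2: "sqrt ((2 * pi) ^ k) = (2 * pi) powr (real k / 2)"
    proof -
      have "(2 * pi) ^ k = (2 * pi) powr real k" by (rule powr_realpow[symmetric]) simp
      then have "sqrt ((2 * pi) ^ k) = ((2 * pi) powr real k) powr (1 / 2)" by (simp only: powr_half_sqrt powr_ge_zero)
      then show ?thesis by (simp only: powr_powr) simp
    qed
    from det show ?thesis unfolding C_def 1 2 by (simp add: powr_minus field_simps)
  qed
  finally show ?thesis by (simp add: C_def)
qed

end

section \<open>Change of variables and total variation\<close>

lemma space_lebk: "space (lebk k) = extensional {1..k}"
  by (auto simp: lebk_def space_PiM PiE_def)

lemma measurable_lebk_component: "j \<in> {1..k} \<Longrightarrow> (\<lambda>x. x j :: real) \<in> borel_measurable (lebk k)"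
  using measurable_component_singleton[of j "{1..k}" "\<lambda>_. lborel :: real measure"] by (simp add: lebk_def)

lemma measurable_lebk_restrict:
  assumes "\<And>j. j \<in> {1..k} \<Longrightarrow> (\<lambda>x. f x j :: real) \<in> borel_measurable M"
  shows "(\<lambda>x. \<lambda>j\<in>{1..k}. f x j) \<in> measurable M (lebk k)"
  unfolding lebk_def by (rule measurable_restrict) (use assms in auto)

lemma measurable_lebk_affine: "(\<lambda>h. \<lambda>j\<in>{1..k}. q j + h j / r) \<in> measurable (lebk k) (lebk k)"
  by (intro measurable_lebk_restrict borel_measurable_add borel_measurable_divide
      borel_measurable_const measurable_lebk_component)

lemma nn_integral_lebk_affine:
  fixes q :: "nat \<Rightarrow> real"
  assumes r: "r > 0" and f: "f \<in> borel_measurable (lebk k)"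
  shows "(\<integral>\<^sup>+ h. f (\<lambda>j\<in>{1..k}. q j + h j / r) \<partial>lebk k) = ennreal (r ^ k) * (\<integral>\<^sup>+ x. f x \<partial>lebk k)"
proof -
  interpret product_sigma_finite "\<lambda>_::nat. lborel :: real measure" by standard
  define T where "T h = (\<lambda>j\<in>{1..k}. q j + h j / r)" for h :: "nat \<Rightarrow> real"
  have T: "T \<in> measurable (lebk k) (lebk k)" unfolding T_def by (rule measurable_lebk_affine)
  have one: "emeasure lborel ((\<lambda>x. t + x / r) -` A) = ennreal r * emeasure lborel A"
    if A: "A \<in> sets lborel" for t and A :: "real set"
  proof -
    have "emeasure lborel A = emeasure (density (distr lborel borel (\<lambda>x. t + (1 / r) * x)) (\<lambda>_. ennreal \<bar>1 / r\<bar>)) A"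
      using r by (subst lborel_real_affine[of "1 / r" t]) auto
    also have "\<dots> = ennreal (1 / r) * emeasure lborel ((\<lambda>x. t + x / r) -` A)"
      using A r by (subst emeasure_density_const) (auto simp: emeasure_distr)
    finally have "ennreal r * emeasure lborel A = (ennreal r * ennreal (1 / r)) * emeasure lborel ((\<lambda>x. t + x / r) -` A)"
      by (simp add: mult.assoc)
    then show ?thesis using r by (simp flip: ennreal_mult)
  qed
  \<comment> \<open>The product measure is determined by its values on boxes. There each coordinate
    contributes a factor r by the one-dimensional scaling, and the density (1 / r)^k cancels these
    factors.\<close>
  have eq: "density (distr (lebk k) (lebk k) T) (\<lambda>_. ennreal ((1 / r) ^ k)) = PiM {1..k} (\<lambda>_. lborel)"
  proof (rule PiM_eqI)
    fix A :: "nat \<Rightarrow> real set" assume A: "\<And>i. i \<in> {1..k} \<Longrightarrow> A i \<in> sets lborel"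
    have E: "Pi\<^sub>E {1..k} A \<in> sets (lebk k)"
      unfolding lebk_def using A by (intro sets_PiM_I_finite) auto
    have pre: "T -` Pi\<^sub>E {1..k} A \<inter> space (lebk k) = Pi\<^sub>E {1..k} (\<lambda>j. (\<lambda>x. q j + x / r) -` A j)"
      by (auto simp: T_def space_lebk PiE_iff extensional_def)
    have "emeasure (density (distr (lebk k) (lebk k) T) (\<lambda>_. ennreal ((1 / r) ^ k))) (Pi\<^sub>E {1..k} A)
        = ennreal ((1 / r) ^ k) * emeasure (PiM {1..k} (\<lambda>_. lborel)) (Pi\<^sub>E {1..k} (\<lambda>j. (\<lambda>x. q j + x / r) -` A j))"
    proof -
      have "emeasure (density (distr (lebk k) (lebk k) T) (\<lambda>_. ennreal ((1 / r) ^ k))) (Pi\<^sub>E {1..k} A)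
          = ennreal ((1 / r) ^ k) * emeasure (distr (lebk k) (lebk k) T) (Pi\<^sub>E {1..k} A)"
        by (rule emeasure_density_const) (use E in simp)
      also have "emeasure (distr (lebk k) (lebk k) T) (Pi\<^sub>E {1..k} A)
          = emeasure (lebk k) (Pi\<^sub>E {1..k} (\<lambda>j. (\<lambda>x. q j + x / r) -` A j))"
        unfolding emeasure_distr[OF T E] pre ..
      finally show ?thesis by (simp only: lebk_def)
    qed
    also have "\<dots> = ennreal ((1 / r) ^ k) * (\<Prod>j\<in>{1..k}. emeasure lborel ((\<lambda>x. q j + x / r) -` A j))"
      by (subst emeasure_PiM) (use A in \<open>auto intro!: measurable_sets_borel[where M = borel]\<close>)
    also have "\<dots> = ennreal ((1 / r) ^ k) * (\<Prod>j\<in>{1..k}. ennreal r * emeasure lborel (A j))"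
      using A one by (intro arg_cong2[where f = "(*)"] refl prod.cong) auto
    also have "\<dots> = (ennreal ((1 / r) ^ k) * ennreal (r ^ k)) * (\<Prod>j\<in>{1..k}. emeasure lborel (A j))"
      using r by (simp add: prod.distrib ennreal_power mult.assoc)
    also have "ennreal ((1 / r) ^ k) * ennreal (r ^ k) = 1"
      using r by (simp add: power_divide flip: ennreal_mult)
    finally show "emeasure (density (distr (lebk k) (lebk k) T) (\<lambda>_. ennreal ((1 / r) ^ k))) (Pi\<^sub>E {1..k} A)
       = (\<Prod>j\<in>{1..k}. emeasure lborel (A j))" by simp
  qed (simp_all add: lebk_def)
  have "(\<integral>\<^sup>+ x. f x \<partial>lebk k) = (\<integral>\<^sup>+ x. f x \<partial>density (distr (lebk k) (lebk k) T) (\<lambda>_. ennreal ((1 / r) ^ k)))"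
    unfolding eq by (simp add: lebk_def)
  also have "\<dots> = ennreal ((1 / r) ^ k) * (\<integral>\<^sup>+ h. f (T h) \<partial>lebk k)"
    using f T by (simp add: nn_integral_density nn_integral_distr nn_integral_cmult)
  finally have "ennreal (r ^ k) * (\<integral>\<^sup>+ x. f x \<partial>lebk k) = (ennreal (r ^ k) * ennreal ((1 / r) ^ k)) * (\<integral>\<^sup>+ h. f (T h) \<partial>lebk k)"
    by (simp add: mult.assoc)
  also have "ennreal (r ^ k) * ennreal ((1 / r) ^ k) = 1"
    using r by (simp add: power_divide flip: ennreal_mult)
  finally show ?thesis unfolding T_def by (simp only: mult_1)
qed

text \<open>The constant c and the Jacobian r^k occur in numerator and normalising integral alike,
  and they cancel in \<open>ennreal\<close> because they are positive and finite. The normalising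
  integral itself may be 0 or infinite, so the identity is available for every sample.\<close>

lemma distr_normalized_density_affine:
  fixes q :: "nat \<Rightarrow> real" and r c :: real
  assumes r: "r > 0" and c: "c > 0" and v: "v \<in> borel_measurable (lebk k)"
  defines "T \<equiv> \<lambda>h. \<lambda>j\<in>{1..k}. q j + h j / r"
  shows "distr (density (lebk k) (\<lambda>\<theta>. (ennreal c * v \<theta>) / (\<integral>\<^sup>+ \<theta>. ennreal c * v \<theta> \<partial>lebk k))) (lebk k)
            (\<lambda>\<theta>. \<lambda>j\<in>{1..k}. r * (\<theta> j - q j))
       = density (lebk k) (\<lambda>h. v (T h) / (\<integral>\<^sup>+ h. v (T h) \<partial>lebk k))"
    (is "?L = ?R")
proof (rule measure_eqI)
  have T: "T \<in> measurable (lebk k) (lebk k)" unfolding T_def by (rule measurable_lebk_affine)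
  have vT: "(\<lambda>h. v (T h)) \<in> borel_measurable (lebk k)" using T v by (rule measurable_compose)
  let ?S = "\<lambda>\<theta>. \<lambda>j\<in>{1..k}. r * (\<theta> j - q j)"
  have S: "?S \<in> measurable (lebk k) (lebk k)"
    by (intro measurable_lebk_restrict borel_measurable_times borel_measurable_diff
      borel_measurable_const measurable_lebk_component)
  show "sets ?L = sets ?R" by simp
  fix A assume "A \<in> sets ?L"
  then have A[measurable]: "A \<in> sets (lebk k)" by simp
  define Z where "Z = (\<integral>\<^sup>+ \<theta>. v \<theta> \<partial>lebk k)"
  have Z: "(\<integral>\<^sup>+ h. v (T h) \<partial>lebk k) = ennreal (r ^ k) * Z"
    unfolding T_def Z_def by (rule nn_integral_lebk_affine[OF r v])
  have cancel: "(ennreal b * x) / (ennreal b * y) = x / y" if "b > 0" for b x y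
    using that divide_mult_eq[of "ennreal b" x y] by (simp add: mult.commute)
  have ind: "(\<lambda>x. indicator A (?S x) :: ennreal) \<in> borel_measurable (lebk k)"
    by (rule measurable_compose[OF S]) simp
  have "emeasure ?L A = (\<integral>\<^sup>+ \<theta>. v \<theta> / Z * indicator A (?S \<theta>) \<partial>lebk k)"
  proof -
    have "emeasure ?L A = emeasure (density (lebk k) (\<lambda>\<theta>. v \<theta> / Z)) (?S -` A \<inter> space (lebk k))"
      using S A v c by (subst emeasure_distr) (auto simp: nn_integral_cmult cancel Z_def)
    also have "\<dots> = (\<integral>\<^sup>+ \<theta>. v \<theta> / Z * indicator (?S -` A \<inter> space (lebk k)) \<theta> \<partial>lebk k)"
      using S A v by (subst emeasure_density) auto
    also have "\<dots> = (\<integral>\<^sup>+ \<theta>. v \<theta> / Z * indicator A (?S \<theta>) \<partial>lebk k)"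
      by (intro nn_integral_cong) (auto simp: indicator_def)
    finally show ?thesis .
  qed
  moreover have "emeasure ?R A = (\<integral>\<^sup>+ \<theta>. v \<theta> / Z * indicator A (?S \<theta>) \<partial>lebk k)"
  proof -
    have inv: "?S (T h) = h" if "h \<in> space (lebk k)" for h
      using that r by (auto simp: T_def space_lebk extensional_def fun_eq_iff)
    have "emeasure ?R A = (\<integral>\<^sup>+ h. v (T h) / (ennreal (r ^ k) * Z) * indicator A h \<partial>lebk k)"
      using vT A by (subst emeasure_density) (auto simp: Z)
    also have "\<dots> = (\<integral>\<^sup>+ h. v (T h) / (ennreal (r ^ k) * Z) * indicator A (?S (T h)) \<partial>lebk k)"
      using inv by (intro nn_integral_cong) simp
    also have "\<dots> = ennreal (r ^ k) * (\<integral>\<^sup>+ \<theta>. v \<theta> / (ennreal (r ^ k) * Z) * indicator A (?S \<theta>) \<partial>lebk k)"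
      unfolding T_def by (rule nn_integral_lebk_affine[OF r]) (use v ind in measurable)
    also have "\<dots> = (\<integral>\<^sup>+ \<theta>. ennreal (r ^ k) * (v \<theta> / (ennreal (r ^ k) * Z) * indicator A (?S \<theta>)) \<partial>lebk k)"
      by (rule nn_integral_cmult[symmetric]) (use v ind in measurable)
    also have "\<dots> = (\<integral>\<^sup>+ \<theta>. v \<theta> / Z * indicator A (?S \<theta>) \<partial>lebk k)"
      using r by (intro nn_integral_cong) (simp add: ennreal_times_divide cancel flip: mult.assoc)
    finally show ?thesis .
  qed
  ultimately show "emeasure ?L A = emeasure ?R A" by simp
qed

text \<open>For a set with f-mass a and g-mass b, the difference a / F - b / G splits into a / F - a
  / G and (a - b) / G. Each is at most e / G in absolute value, since the total masses differ by at
  most e and a \<le> F. The condition \<open>e < G\<close> keeps F positive.\<close>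

lemma tv_dist_normalized_le:
  fixes f g :: "'a \<Rightarrow> real"
  assumes f: "f \<in> borel_measurable M" "\<And>x. x \<in> space M \<Longrightarrow> f x \<ge> 0"
    and g: "g \<in> borel_measurable M" "\<And>x. x \<in> space M \<Longrightarrow> g x \<ge> 0"
    and G: "(\<integral>\<^sup>+ x. ennreal (g x) \<partial>M) = ennreal G" "G > 0"
    and e: "(\<integral>\<^sup>+ x. ennreal \<bar>f x - g x\<bar> \<partial>M) \<le> ennreal e" "e < G" and e0: "0 \<le> e"
  shows "tv_dist (density M (\<lambda>x. ennreal (f x) / (\<integral>\<^sup>+ x. ennreal (f x) \<partial>M)))
                 (density M (\<lambda>x. ennreal (g x) / ennreal G)) \<le> 2 * e / G"
proof -
  have ig: "integrable M g"
    using g G by (intro integrableI_nonneg) (auto intro!: AE_I2)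
  have id: "integrable M (\<lambda>x. f x - g x)"
    using f g e by (intro integrableI_bounded) (auto intro: le_less_trans)
  have "integrable M (\<lambda>x. (f x - g x) + g x)" by (intro Bochner_Integration.integrable_add id ig)
  then have if': "integrable M f" by simp
  define F where "F = (LINT x|M. f x)"
  have Geq: "G = (LINT x|M. g x)"
    using G g by (subst integral_eq_nn_integral) (auto intro!: AE_I2)
  have nF: "(\<integral>\<^sup>+ x. ennreal (f x) \<partial>M) = ennreal F"
    unfolding F_def using f by (intro nn_integral_eq_integral if') (auto intro!: AE_I2)
  have bd: "\<bar>(LINT x:A|M. f x) - (LINT x:A|M. g x)\<bar> \<le> e" if A: "A \<in> sets M" for A
  proof -
    have s: "set_integrable M A f" "set_integrable M A g" "set_integrable M A (\<lambda>x. f x - g x)"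
      unfolding set_integrable_def using A if' ig id by (auto simp del: real_scaleR_def intro!: integrable_mult_indicator)
    have "(LINT x:A|M. f x) - (LINT x:A|M. g x) = (LINT x:A|M. f x - g x)"
      using set_integral_diff[OF s(1,2)] by simp
    also have "\<bar>\<dots>\<bar> \<le> (LINT x:A|M. \<bar>f x - g x\<bar>)"
      using set_integral_norm_bound[OF s(3)] by simp
    also have "\<dots> \<le> (LINT x|M. \<bar>f x - g x\<bar>)"
      unfolding set_lebesgue_integral_def using id A
      by (intro integral_mono integrable_mult_indicator integrable_abs) (auto simp: indicator_def)
    also have "\<dots> \<le> e"
      using e e0 by (subst integral_eq_nn_integral) (use f g in \<open>auto intro!: enn2real_leI\<close>)
    finally show ?thesis .
  qed
  have FG: "\<bar>F - G\<bar> \<le> e"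
    using bd[OF sets.top] unfolding F_def Geq set_lebesgue_integral_def
    using if' ig by (simp cong: Bochner_Integration.integral_cong)
  then have F: "F > 0" using e by linarith
  have meas: "measure (density M (\<lambda>x. ennreal (h x) / ennreal H)) A = (LINT x:A|M. h x) / H"
    if h: "h \<in> borel_measurable M" "\<And>x. x \<in> space M \<Longrightarrow> h x \<ge> 0" "integrable M h" and H: "H > 0" and A: "A \<in> sets M"
    for h :: "'a \<Rightarrow> real" and H A
  proof -
    have "emeasure (density M (\<lambda>x. ennreal (h x) / ennreal H)) A = (\<integral>\<^sup>+ x. ennreal (indicator A x * h x / H) \<partial>M)"
      using h H A by (subst emeasure_density) (auto intro!: nn_integral_cong simp: divide_ennreal indicator_def)
    also have "\<dots> = ennreal (LINT x|M. indicator A x * h x / H)"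
      using h H A integrable_mult_indicator[OF A h(3)]
      by (intro nn_integral_eq_integral) (auto intro!: AE_I2)
    finally show ?thesis
      using h H by (simp add: measure_def set_lebesgue_integral_def integral_nonneg_AE)
  qed
  show ?thesis
    unfolding tv_dist_def nF
  proof (rule cSUP_least)
    show "sets (density M (\<lambda>x. ennreal (f x) / ennreal F)) \<noteq> {}" using sets.empty_sets by blast
    fix A assume "A \<in> sets (density M (\<lambda>x. ennreal (f x) / ennreal F))"
    then have A: "A \<in> sets M" by simp
    define a where "a = (LINT x:A|M. f x)"
    define b where "b = (LINT x:A|M. g x)"
    have a: "0 \<le> a" "a \<le> F"
    proof -
      show "0 \<le> a"
        unfolding a_def set_lebesgue_integral_def using f by (intro integral_nonneg_AE AE_I2) auto
      show "a \<le> F"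
        unfolding a_def F_def set_lebesgue_integral_def
        by (rule integral_mono[OF integrable_mult_indicator[OF A if'] if'])
          (use f in \<open>auto intro!: mult_left_le_one_le simp: indicator_le_1\<close>)
    qed
    have ab: "\<bar>a - b\<bar> \<le> e" using bd[OF A] by (simp add: a_def b_def)
    have "\<bar>a / F - b / G\<bar> \<le> \<bar>a / F - a / G\<bar> + \<bar>a / G - b / G\<bar>" by linarith
    also have "\<bar>a / F - a / G\<bar> = a / F * \<bar>F - G\<bar> / G"
    proof -
      have "a / F - a / G = a / F * (G - F) / G" using F G by (simp add: field_simps)
      then show ?thesis using F G a by (simp add: abs_mult abs_minus_commute)
    qed
    also have "\<dots> \<le> 1 * e / G"
      using a F G FG e0 by (intro divide_right_mono mult_mono) auto
    also have "\<bar>a / G - b / G\<bar> \<le> e / G"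
      using ab G by (simp add: divide_right_mono flip: diff_divide_distrib)
    finally have "\<bar>a / F - b / G\<bar> \<le> 2 * e / G" by simp
    then show "\<bar>measure (density M (\<lambda>x. ennreal (f x) / ennreal F)) A - measure (density M (\<lambda>x. ennreal (g x) / ennreal G)) A\<bar> \<le> 2 * e / G"
      using meas[OF f if' F A] meas[OF g ig G(2) A] by (simp add: a_def b_def)
  qed
qed

section \<open>Empirical counts and the prior-weighted likelihood\<close>

lemma Theta_less:
  assumes "\<theta> \<in> Theta k" "1 \<le> i" "i < j" "j \<le> k"
  shows "\<theta> i < \<theta> j"
proof -
  from \<open>i < j\<close> have "Suc i \<le> j" by simp
  then show ?thesis using \<open>j \<le> k\<close>
  proof (induction j rule: dec_induct)
    case base
    then show ?case using assms by (auto simp: Theta_def)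
  next
    case (step m)
    then have "\<theta> i < \<theta> m" by simp
    also have "\<theta> m < \<theta> (Suc m)" using assms step by (auto simp: Theta_def)
    finally show ?case .
  qed
qed

lemma Sset_cover: "\<exists>j\<in>{1..k+1}. x \<in> Sset k \<theta> j"
proof -
  define j where "j = (LEAST j. 1 \<le> j \<and> (j = k + 1 \<or> x \<le> \<theta> j))"
  have ex: "1 \<le> k + 1 \<and> (k + 1 = k + 1 \<or> x \<le> \<theta> (k + 1))" by simp
  have j: "1 \<le> j \<and> (j = k + 1 \<or> x \<le> \<theta> j)" unfolding j_def by (rule LeastI_ex) (use ex in blast)
  have jk: "j \<le> k + 1" unfolding j_def by (rule Least_le) (use ex in blast)
  have "\<theta> (j - 1) < x" if "j \<noteq> 1"
  proof -
    have "j - 1 < j" using j by simp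
    then have "\<not> (1 \<le> j - 1 \<and> (j - 1 = k + 1 \<or> x \<le> \<theta> (j - 1)))" unfolding j_def by (rule not_less_Least)
    then show ?thesis using that j by auto
  qed
  then show ?thesis using j jk by (intro bexI[of _ j]) (auto simp: Sset_def)
qed

lemma Sset_disjoint:
  assumes \<theta>: "\<theta> \<in> Theta k" and ij: "i \<in> {1..k+1}" "j \<in> {1..k+1}" "x \<in> Sset k \<theta> i" "x \<in> Sset k \<theta> j"
  shows "i = j"
proof -
  have False if "i < j" "i \<in> {1..k+1}" "j \<in> {1..k+1}" "x \<in> Sset k \<theta> i" "x \<in> Sset k \<theta> j" for i j
  proof -
    have "x \<le> \<theta> i" "\<theta> (j - 1) < x" using that by (auto simp: Sset_def)
    moreover have "\<theta> i \<le> \<theta> (j - 1)"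
      using Theta_less[OF \<theta>, of i "j - 1"] that by (cases "i = j - 1") (auto simp: less_eq_real_def)
    ultimately show False by simp
  qed
  from this[of i j] this[of j i] ij show ?thesis by (meson linorder_neqE_nat)
qed

lemma Sset_sets[measurable]: "Sset k \<theta> j \<in> sets borel"
proof -
  have "Sset k \<theta> j = (if j = 1 then UNIV else {\<theta> (j - 1)<..}) \<inter> (if j = k + 1 then UNIV else {..\<theta> j})"
    by (auto simp: Sset_def)
  then show ?thesis by auto
qed

text \<open>A distribution function read off at the end points, with 0 at minus infinity and the
  total mass t at infinity. Differences of \<open>ends\<close> represent measures and counts of
  cells at once, and they are measurable in \<theta> because each term depends on a single
  coordinate.\<close>

definition ends :: "nat \<Rightarrow> real \<Rightarrow> (real \<Rightarrow> real) \<Rightarrow> (nat \<Rightarrow> real) \<Rightarrow> nat \<Rightarrow> real" where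
  "ends k t F \<theta> j = (if j = 0 then 0 else if j = k + 1 then t else F (\<theta> j))"

lemma Sset_eq_diff:
  assumes \<theta>: "\<theta> \<in> Theta k" and j: "j \<in> {1..k+1}"
  defines "E \<equiv> \<lambda>j. if j = 0 then {} else if j = k + 1 then UNIV else {..\<theta> j}"
  shows "Sset k \<theta> j = E j - E (j - 1)" "E (j - 1) \<subseteq> E j"
proof -
  show "Sset k \<theta> j = E j - E (j - 1)" using j by (auto simp: Sset_def E_def)
  consider "j = 1" | "j = k + 1" | "1 \<le> j - 1" "j - 1 < j" "j \<le> k" using j by force
  then show "E (j - 1) \<subseteq> E j"
  proof cases
    case 3
    then show ?thesis using Theta_less[OF \<theta>, of "j - 1" j] by (simp add: E_def less_imp_le)
  qed (auto simp: E_def)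
qed

lemma measure_Sset:
  assumes "finite_measure \<mu>" "sets \<mu> = sets borel" and \<theta>: "\<theta> \<in> Theta k" and j: "j \<in> {1..k+1}"
  shows "measure \<mu> (Sset k \<theta> j)
    = ends k (measure \<mu> UNIV) (\<lambda>x. measure \<mu> {..x}) \<theta> j - ends k (measure \<mu> UNIV) (\<lambda>x. measure \<mu> {..x}) \<theta> (j - 1)"
proof -
  interpret finite_measure \<mu> by fact
  show ?thesis
    unfolding Sset_eq_diff(1)[OF \<theta> j]
    by (subst finite_measure_Diff[OF _ _ Sset_eq_diff(2)[OF \<theta> j]]) (auto simp: assms(2) ends_def)
qed

lemma cnt_Diff: "A \<subseteq> B \<Longrightarrow> real (cnt n y (B - A)) = real (cnt n y B) - real (cnt n y A)"
proof -
  assume "A \<subseteq> B"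
  then have "{i \<in> {1..n}. y i \<in> B - A} = {i \<in> {1..n}. y i \<in> B} - {i \<in> {1..n}. y i \<in> A}"
    "{i \<in> {1..n}. y i \<in> A} \<subseteq> {i \<in> {1..n}. y i \<in> B}" by auto
  then show ?thesis
    unfolding cnt_def by (simp add: card_Diff_subset of_nat_diff card_mono)
qed

lemma cnt_mono: "A \<subseteq> B \<Longrightarrow> cnt n y A \<le> cnt n y B"
  unfolding cnt_def by (intro card_mono) auto

lemma cnt_le: "cnt n y A \<le> n"
  using card_mono[of "{1..n}" "{i \<in> {1..n}. y i \<in> A}"] unfolding cnt_def
  by (metis (no_types, lifting) card_atLeastAtMost diff_Suc_1 finite_atLeastAtMost mem_Collect_eq subsetI)

lemma cnt_UNIV: "cnt n y UNIV = n" and cnt_empty: "cnt n y {} = 0"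
  by (simp_all add: cnt_def flip: atLeastAtMost_def atLeastAtMost_iff)

lemma cnt_Sset:
  assumes \<theta>: "\<theta> \<in> Theta k" and j: "j \<in> {1..k+1}"
  shows "real (cnt n y (Sset k \<theta> j))
    = ends k (real n) (\<lambda>x. real (cnt n y {..x})) \<theta> j - ends k (real n) (\<lambda>x. real (cnt n y {..x})) \<theta> (j - 1)"
  unfolding Sset_eq_diff(1)[OF \<theta> j]
  by (subst cnt_Diff[OF Sset_eq_diff(2)[OF \<theta> j]]) (auto simp: ends_def cnt_UNIV cnt_empty)

lemma real_cnt_eq_sum: "real (cnt n y S) = (\<Sum>i\<in>{1..n}. indicator S (y i))"
  by (simp add: cnt_def indicator_def sum.If_cases Int_def)

lemma sum_cnt_Sset:
  assumes \<theta>: "\<theta> \<in> Theta k"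
  shows "(\<Sum>j\<in>{1..k+1}. cnt n y (Sset k \<theta> j)) = n"
proof -
  have "(\<Sum>j\<in>{1..k+1}. cnt n y (Sset k \<theta> j)) = card (\<Union>j\<in>{1..k+1}. {i \<in> {1..n}. y i \<in> Sset k \<theta> j})"
    unfolding cnt_def by (rule card_UN_disjoint[symmetric]) (auto dest: Sset_disjoint[OF \<theta>, rotated 2])
  also have "(\<Union>j\<in>{1..k+1}. {i \<in> {1..n}. y i \<in> Sset k \<theta> j}) = {1..n}"
    using Sset_cover[of k _ \<theta>] by blast
  finally show ?thesis by simp
qed

lemma ends_measurable:
  assumes "F \<in> borel_measurable borel" "j \<le> k + 1"
  shows "(\<lambda>\<theta>. ends k t F \<theta> j) \<in> borel_measurable (lebk k)"
proof -
  consider "j = 0" | "j = k + 1" | "j \<in> {1..k}" using assms by force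
  then show ?thesis
  proof cases
    case 3
    then show ?thesis
      using measurable_compose[OF measurable_lebk_component[OF 3] assms(1)] by (simp add: ends_def)
  qed (simp_all add: ends_def)
qed

lemma Theta_sets: "Theta k \<in> sets (lebk k)"
proof -
  have "Theta k = {\<theta> \<in> space (lebk k). \<forall>j\<in>{1..<k}. \<theta> j < \<theta> (Suc j)}"
    by (auto simp: Theta_def space_lebk)
  moreover have "{\<theta> \<in> space (lebk k). \<theta> j < \<theta> (Suc j)} \<in> sets (lebk k)" if "j \<in> {1..<k}" for j
    using that by (intro borel_measurable_less measurable_lebk_component) auto
  ultimately show ?thesis
    by (simp only:) (intro sets.sets_Collect_finite_All, auto)
qed

lemma prior_measurable:
  "pri \<in> borel_measurable (lebk k) \<Longrightarrow> (\<lambda>\<theta>. ennreal (indicator (Theta k) \<theta> * pri \<theta>)) \<in> borel_measurable (lebk k)"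
  by (intro measurable_compose[OF _ measurable_ennreal] borel_measurable_times borel_measurable_indicator Theta_sets)

lemma sigma_finite_lebk: "sigma_finite_measure (lebk k)"
proof -
  interpret finite_product_sigma_finite "\<lambda>_. lborel :: real measure" "{1..k}" by standard auto
  show ?thesis unfolding lebk_def by (rule sigma_finite_measure_axioms)
qed

lemma exp_le_quadratic: "\<bar>x\<bar> \<le> 1 \<Longrightarrow> exp x \<le> 1 + x + x\<^sup>2" for x :: real
proof (cases "x \<ge> 0")
  case False
  define z where "z = - x"
  have z: "z > 0" using False by (simp add: z_def)
  have "exp x = 1 / exp z" by (simp add: z_def exp_minus field_simps)
  also have "\<dots> \<le> 1 / (1 + z)" using z by (intro divide_left_mono) auto
  also have "\<dots> \<le> 1 - z + z\<^sup>2"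
  proof -
    have "1 \<le> (1 - z + z\<^sup>2) * (1 + z)" using z by (simp add: algebra_simps power2_eq_square)
    then show ?thesis using z by (simp add: pos_divide_le_eq)
  qed
  finally show ?thesis by (simp add: z_def)
qed (simp add: exp_bound)

section \<open>Exponential tails of counts in an i.i.d. sample\<close>

context
  fixes P0 :: "real measure"
  assumes P0: "real_distribution P0"
begin

interpretation real_distribution P0 by (rule P0)
interpretation PP: product_prob_space "\<lambda>_. P0" "UNIV :: nat set" by standard

abbreviation "PI \<equiv> PiM (UNIV :: nat set) (\<lambda>_. P0)"

lemma PI_prob_space: "prob_space PI" by (rule PP.prob_space_axioms)

lemma PI_component[measurable]: "(\<lambda>y. y i) \<in> borel_measurable PI"
  using measurable_component_singleton[of i UNIV "\<lambda>_. P0"] by (simp cong: measurable_cong_sets)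

lemma cnt_measurable: "S \<in> sets borel \<Longrightarrow> (\<lambda>y. real (cnt n y S)) \<in> borel_measurable PI"
  unfolding real_cnt_eq_sum
  by (intro borel_measurable_sum measurable_compose[OF PI_component] borel_measurable_indicator)

text \<open>Restriction to the first n coordinates pushes the infinite product forward to a finite
  one, where the integral factorises.\<close>

lemma nn_integral_prod_iid:
  fixes w :: "real \<Rightarrow> ennreal"
  assumes w: "w \<in> borel_measurable borel"
  shows "(\<integral>\<^sup>+ y. (\<Prod>i\<in>{1..n}. w (y i)) \<partial>PI) = (\<integral>\<^sup>+ x. w x \<partial>P0) ^ n"
proof -
  let ?J = "{1..n}"
  have wP: "w \<in> borel_measurable P0" using w by simp
  have "(\<integral>\<^sup>+ y. (\<Prod>i\<in>?J. w (y i)) \<partial>PI) = (\<integral>\<^sup>+ y. (\<Prod>i\<in>?J. w (restrict y ?J i)) \<partial>PI)"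
    by simp
  also have "\<dots> = (\<integral>\<^sup>+ z. (\<Prod>i\<in>?J. w (z i)) \<partial>distr PI (PiM ?J (\<lambda>_. P0)) (\<lambda>y. restrict y ?J))"
    by (subst nn_integral_distr) (use wP in \<open>auto intro!: measurable_restrict_subset borel_measurable_prod_ennreal
        measurable_compose[OF measurable_component_singleton]\<close>)
  also have "distr PI (PiM ?J (\<lambda>_. P0)) (\<lambda>y. restrict y ?J) = PiM ?J (\<lambda>_. P0)"
    by (rule PP.distr_PiM_restrict_finite) auto
  also have "(\<integral>\<^sup>+ z. (\<Prod>i\<in>?J. w (z i)) \<partial>PiM ?J (\<lambda>_. P0)) = (\<Prod>i\<in>?J. integral\<^sup>N P0 w)"
    by (rule PP.product_nn_integral_prod) (use wP in auto)
  finally show ?thesis by simp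
qed

text \<open>A bound on the binomial moment generating function with the probability of S kept in
  front of l^2. A variance term free of that probability would be too large for increments over
  short intervals.\<close>

lemma cnt_exp_moment:
  assumes S: "S \<in> sets borel" and l: "\<bar>l\<bar> \<le> 1"
  shows "(\<integral>\<^sup>+ y. ennreal (exp (l * real (cnt n y S))) \<partial>PI) \<le> ennreal (exp (real n * measure P0 S * (l + l\<^sup>2)))"
proof -
  define s where "s = measure P0 S"
  have s: "0 \<le> s" by (simp add: s_def)
  have "(\<integral>\<^sup>+ y. ennreal (exp (l * real (cnt n y S))) \<partial>PI) = (\<integral>\<^sup>+ y. (\<Prod>i\<in>{1..n}. ennreal (exp (l * indicator S (y i)))) \<partial>PI)"
  proof (rule nn_integral_cong)
    fix y
    have "exp (l * real (cnt n y S)) = (\<Prod>i\<in>{1..n}. exp (l * indicator S (y i)))"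
      by (simp only: real_cnt_eq_sum sum_distrib_left exp_sum finite_atLeastAtMost)
    then show "ennreal (exp (l * real (cnt n y S))) = (\<Prod>i\<in>{1..n}. ennreal (exp (l * indicator S (y i))))"
      by (simp only: prod_ennreal exp_ge_zero)
  qed
  also have "\<dots> = (\<integral>\<^sup>+ x. ennreal (exp (l * indicator S x)) \<partial>P0) ^ n"
    by (rule nn_integral_prod_iid) (use S in measurable)
  also have "\<dots> \<le> (ennreal (exp (s * (l + l\<^sup>2)))) ^ n"
  proof (rule power_mono)
    have "(\<integral>\<^sup>+ x. ennreal (exp (l * indicator S x)) \<partial>P0) \<le> (\<integral>\<^sup>+ x. ennreal (1 + indicator S x * (exp l - 1)) \<partial>P0)"
      by (intro nn_integral_mono) (auto simp: indicator_def)
    also have "\<dots> = ennreal (LINT x|P0. 1 + indicator S x * (exp l - 1))"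
      using S by (intro nn_integral_eq_integral Bochner_Integration.integrable_add integrable_mult_left integrable_real_indicator)
        (auto intro!: AE_I2 simp: indicator_def less_top[symmetric])
    also have "(LINT x|P0. 1 + indicator S x * (exp l - 1)) = 1 + s * (exp l - 1)"
      using S by (subst Bochner_Integration.integral_add) (auto simp: s_def prob_space[simplified] less_top[symmetric])
    also have "\<dots> \<le> 1 + s * (l + l\<^sup>2)" using exp_le_quadratic[OF l] s by (intro add_left_mono mult_left_mono) auto
    also have "\<dots> \<le> exp (s * (l + l\<^sup>2))" by (rule exp_ge_add_one_self)
    finally show "(\<integral>\<^sup>+ x. ennreal (exp (l * indicator S x)) \<partial>P0) \<le> ennreal (exp (s * (l + l\<^sup>2)))"
      by (simp add: ennreal_leI)
  qed simp
  also have "\<dots> = ennreal (exp (real n * s * (l + l\<^sup>2)))"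
    by (simp add: ennreal_power exp_of_nat_mult[symmetric] mult.assoc)
  finally show ?thesis by (simp add: s_def)
qed

lemma cnt_tail:
  assumes S: "S \<in> sets borel" and l: "\<bar>l\<bar> \<le> 1"
  shows "measure PI {y \<in> space PI. l * (real (cnt n y S) - real n * measure P0 S) \<ge> t}
           \<le> exp (real n * measure P0 S * l\<^sup>2 - t)"
proof -
  define s where "s = measure P0 S"
  have m[measurable]: "(\<lambda>y. real (cnt n y S)) \<in> borel_measurable PI" by (rule cnt_measurable[OF S])
  have "emeasure PI {y \<in> space PI. l * (real (cnt n y S) - real n * s) \<ge> t}
      \<le> emeasure PI ({y \<in> space PI. ennreal (exp (- (t + l * (real n * s)))) * ennreal (exp (l * real (cnt n y S))) \<ge> 1} \<inter> space PI)"
  proof (rule emeasure_mono)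
    show "{y \<in> space PI. t \<le> l * (real (cnt n y S) - real n * s)}
      \<subseteq> {y \<in> space PI. 1 \<le> ennreal (exp (- (t + l * (real n * s)))) * ennreal (exp (l * real (cnt n y S)))} \<inter> space PI"
      by (auto simp: algebra_simps simp flip: ennreal_mult exp_add)
  qed simp
  also have "\<dots> \<le> ennreal (exp (- (t + l * (real n * s)))) * (\<integral>\<^sup>+ y. ennreal (exp (l * real (cnt n y S))) * indicator (space PI) y \<partial>PI)"
    using nn_integral_Markov_inequality[of "\<lambda>y. ennreal (exp (l * real (cnt n y S)))" "space PI" PI "ennreal (exp (- (t + l * (real n * s))))"]
    by (simp add: Int_def conj_commute)
  also have "(\<integral>\<^sup>+ y. ennreal (exp (l * real (cnt n y S))) * indicator (space PI) y \<partial>PI) = (\<integral>\<^sup>+ y. ennreal (exp (l * real (cnt n y S))) \<partial>PI)"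
    by (intro nn_integral_cong) auto
  also have "ennreal (exp (- (t + l * (real n * s)))) * \<dots> \<le> ennreal (exp (- (t + l * (real n * s)))) * ennreal (exp (real n * s * (l + l\<^sup>2)))"
    unfolding s_def by (intro mult_left_mono cnt_exp_moment S l) simp
  also have "\<dots> = ennreal (exp (real n * s * l\<^sup>2 - t))"
    by (simp add: algebra_simps flip: ennreal_mult exp_add)
  finally show ?thesis
    by (simp add: s_def PP.emeasure_eq_measure)
qed

text \<open>The parameter l stays free: 1 / sqrt n suits the deviation at a single quantile, a
  constant suits the increments of the empirical process.\<close>

lemma cnt_deviation:
  assumes S: "S \<in> sets borel" and l: "0 < l" "l \<le> 1"
  shows "measure PI {y \<in> space PI. \<bar>real (cnt n y S) - real n * measure P0 S\<bar> > t}
           \<le> 2 * exp (real n * measure P0 S * l\<^sup>2 - l * t)"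
proof -
  have m[measurable]: "(\<lambda>y. real (cnt n y S)) \<in> borel_measurable PI" by (rule cnt_measurable[OF S])
  have "measure PI {y \<in> space PI. \<bar>real (cnt n y S) - real n * measure P0 S\<bar> > t}
     \<le> measure PI ({y \<in> space PI. l * (real (cnt n y S) - real n * measure P0 S) \<ge> l * t}
         \<union> {y \<in> space PI. (- l) * (real (cnt n y S) - real n * measure P0 S) \<ge> l * t})"
  proof (rule PP.finite_measure_mono)
    show "{y \<in> space PI. t < \<bar>real (cnt n y S) - real n * measure P0 S\<bar>}
    \<subseteq> {y \<in> space PI. l * t \<le> l * (real (cnt n y S) - real n * measure P0 S)} \<union>
       {y \<in> space PI. l * t \<le> - l * (real (cnt n y S) - real n * measure P0 S)}"
    proof
      fix y assume y: "y \<in> {y \<in> space PI. t < \<bar>real (cnt n y S) - real n * measure P0 S\<bar>}"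
      define d where "d = real (cnt n y S) - real n * measure P0 S"
      have "t < d \<or> t < - d" using y by (auto simp: d_def)
      then have "l * t \<le> l * d \<or> l * t \<le> - l * d" using l mult_left_mono[of t d l] mult_left_mono[of t "- d" l] by auto
      then show "y \<in> {y \<in> space PI. l * t \<le> l * (real (cnt n y S) - real n * measure P0 S)} \<union>
       {y \<in> space PI. l * t \<le> - l * (real (cnt n y S) - real n * measure P0 S)}"
        using y unfolding d_def by blast
    qed
  qed measurable
  also have "\<dots> \<le> measure PI {y \<in> space PI. l * (real (cnt n y S) - real n * measure P0 S) \<ge> l * t}
         + measure PI {y \<in> space PI. (- l) * (real (cnt n y S) - real n * measure P0 S) \<ge> l * t}"
    by (rule measure_Un_le) measurable
  also have "\<dots> \<le> exp (real n * measure P0 S * l\<^sup>2 - l * t) + exp (real n * measure P0 S * l\<^sup>2 - l * t)"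
    using cnt_tail[OF S, of l "l * t" n] cnt_tail[OF S, of "- l" "l * t" n] l by (intro add_mono) auto
  finally show ?thesis by simp
qed


lemma quantile_deviation:
  assumes n: "n \<ge> 1" and p: "measure P0 {..x} = p"
  shows "measure PI {y \<in> space PI. \<bar>real (cnt n y {..x}) - real n * p\<bar> > K * sqrt (real n)} \<le> 2 * exp (1 - K)"
proof -
  have p1: "p \<le> 1" using p prob_le_1 by blast
  have "measure PI {y \<in> space PI. \<bar>real (cnt n y {..x}) - real n * measure P0 {..x}\<bar> > K * sqrt (real n)}
      \<le> 2 * exp (real n * measure P0 {..x} * (1 / sqrt (real n))\<^sup>2 - 1 / sqrt (real n) * (K * sqrt (real n)))"
    by (rule cnt_deviation) (use n in auto)
  also have "\<dots> = 2 * exp (p - K)" using n p by (simp add: power_divide)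
  finally show ?thesis using p1 p by (simp add: order_trans)
qed

section \<open>Increments of the empirical process near a quantile\<close>

definition incr_dev :: "nat \<Rightarrow> (nat \<Rightarrow> real) \<Rightarrow> real \<Rightarrow> real \<Rightarrow> real" where
  "incr_dev n y t x = (real (cnt n y {..x}) - real (cnt n y {..t})) - real n * (cdf P0 x - cdf P0 t)"

lemma incr_dev_measurable[measurable]: "(\<lambda>y. incr_dev n y t x) \<in> borel_measurable PI"
  unfolding incr_dev_def by (intro borel_measurable_diff borel_measurable_const cnt_measurable) auto

text \<open>\<open>incr_dev\<close> is sqrt n times an increment of the empirical process sqrt n
  (F_n - F_0). Up to sign it is the centred count of the interval between t and x, so the bound
  improves as the interval shrinks.\<close>

lemma incr_dev_tail:
  assumes lip: "\<bar>cdf P0 x - cdf P0 t\<bar> \<le> s" and l: "0 < l" "l \<le> 1"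
  shows "measure PI {y \<in> space PI. \<bar>incr_dev n y t x\<bar> > u} \<le> 2 * exp (real n * s * l\<^sup>2 - l * u)"
proof -
  define S where "S = {min x t<..max x t}"
  have S: "S \<in> sets borel" by (simp add: S_def)
  have S_eq: "S = {..max x t} - {..min x t}" by (auto simp: S_def)
  have mS: "measure P0 S = cdf P0 (max x t) - cdf P0 (min x t)"
    unfolding S_eq cdf_def by (rule finite_measure_Diff) auto
  have cS: "real (cnt n y S) = real (cnt n y {..max x t}) - real (cnt n y {..min x t})" for y
    unfolding S_eq by (rule cnt_Diff) auto
  have eq: "\<bar>incr_dev n y t x\<bar> = \<bar>real (cnt n y S) - real n * measure P0 S\<bar>" for y
    unfolding mS cS incr_dev_def by (cases "x \<le> t") (auto simp: max_def min_def algebra_simps)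
  have "cdf P0 (min x t) \<le> cdf P0 (max x t)" by (rule cdf_nondecreasing) simp
  then have "measure P0 S \<le> s" using lip unfolding mS by (cases "x \<le> t") (auto simp: max_def min_def)
  then have "2 * exp (real n * measure P0 S * l\<^sup>2 - l * u) \<le> 2 * exp (real n * s * l\<^sup>2 - l * u)"
    by (simp add: mult_left_mono mult_right_mono)
  with cnt_deviation[OF S l, where n = n and t = u] show ?thesis unfolding eq by linarith
qed

text \<open>Counts and cdf are both monotone, so replacing x by a neighbouring grid point costs at
  most n times the probability of the grid cell.\<close>

lemma incr_dev_between:
  assumes "a \<le> x" "x \<le> b"
  shows "incr_dev n y t a - real n * (cdf P0 b - cdf P0 a) \<le> incr_dev n y t x"
    "incr_dev n y t x \<le> incr_dev n y t b + real n * (cdf P0 b - cdf P0 a)"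
proof -
  have c: "real (cnt n y {..a}) \<le> real (cnt n y {..x})" "real (cnt n y {..x}) \<le> real (cnt n y {..b})"
    using assms by (auto intro!: cnt_mono)
  have F: "real n * cdf P0 a \<le> real n * cdf P0 x" "real n * cdf P0 x \<le> real n * cdf P0 b"
    using assms by (auto intro!: mult_left_mono cdf_nondecreasing)
  show "incr_dev n y t a - real n * (cdf P0 b - cdf P0 a) \<le> incr_dev n y t x"
    "incr_dev n y t x \<le> incr_dev n y t b + real n * (cdf P0 b - cdf P0 a)"
    using c F unfolding incr_dev_def by (simp_all add: right_diff_distrib)
qed

text \<open>
  Controlling the increments on a grid of mesh \<open>e / sqrt n\<close> suffices by monotonicity; since the bound
  required grows with the distance from \<open>t\<close>, the union bound over order \<open>sqrt n\<close> grid points is affordable.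
\<close>
definition grid_bad :: "real \<Rightarrow> real \<Rightarrow> real \<Rightarrow> nat \<Rightarrow> (nat \<Rightarrow> real) set" where
  "grid_bad t e \<eta> n = (\<Union>m\<in>{- \<lceil>sqrt (real n) / e\<rceil> - 1..\<lceil>sqrt (real n) / e\<rceil> + 1}.
      {y \<in> space PI. \<bar>incr_dev n y t (t + real_of_int m * e / sqrt (real n))\<bar> > sqrt (real n) * \<eta> * (1 + \<bar>real_of_int m\<bar> * e)})"

lemma grid_bad_sets: "grid_bad t e \<eta> n \<in> sets PI"
  unfolding grid_bad_def by measurable

text \<open>At the m-th grid point the variance term and the threshold are both linear in |m| e. The
  choice of \<open>l\<close> gives C l \<le> \<eta>, so the part growing with |m| is not positive,
  and exp (- l \<eta> sqrt n) remains at every grid point.\<close>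

lemma measure_grid_bad_le:
  assumes lip: "\<And>x. \<bar>x - t\<bar> \<le> 2 \<Longrightarrow> \<bar>cdf P0 x - cdf P0 t\<bar> \<le> C * \<bar>x - t\<bar>" and C: "C > 0"
    and e: "0 < e" "e \<le> 1 / 2" and \<eta>: "0 < \<eta>" and n: "n \<ge> 1"
  defines "l \<equiv> min 1 (\<eta> / C)"
  shows "measure PI (grid_bad t e \<eta> n) \<le> (2 * sqrt (real n) / e + 5) * (2 * exp (- (l * \<eta>) * sqrt (real n)))"
proof -
  define s where "s = sqrt (real n)"
  have s: "s \<ge> 1" "s * s = real n" using n by (auto simp: s_def)
  define M where "M = \<lceil>s / e\<rceil> + 1"
  have M: "real_of_int M \<le> s / e + 2" "M \<ge> 0" 
  proof -
    show "real_of_int M \<le> s / e + 2" unfolding M_def by linarith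
    have "s / e \<ge> 0" using s e by simp
    then show "M \<ge> 0" unfolding M_def by linarith
  qed
  have l: "0 < l" "l \<le> 1" "C * l \<le> \<eta>"
    using C \<eta> by (auto simp: l_def min_def field_simps)
  have pt: "measure PI {y \<in> space PI. \<bar>incr_dev n y t (t + real_of_int m * e / s)\<bar> > s * \<eta> * (1 + \<bar>real_of_int m\<bar> * e)}
      \<le> 2 * exp (- (l * \<eta>) * s)" if m: "m \<in> {- M..M}" for m
  proof -
    have am: "\<bar>real_of_int m\<bar> \<le> s / e + 2" using m M by auto
    have "\<bar>real_of_int m\<bar> * e \<le> (s / e + 2) * e" using am e by (intro mult_right_mono) auto
    also have "\<dots> \<le> 2 * s" using e s by (simp add: field_simps)
    finally have "\<bar>real_of_int m\<bar> * e / s \<le> 2" using s by (simp add: pos_divide_le_eq)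
    then have d: "\<bar>(t + real_of_int m * e / s) - t\<bar> \<le> 2" using e s by (simp add: abs_mult)
    have "measure PI {y \<in> space PI. \<bar>incr_dev n y t (t + real_of_int m * e / s)\<bar> > s * \<eta> * (1 + \<bar>real_of_int m\<bar> * e)}
       \<le> 2 * exp (real n * (C * (\<bar>real_of_int m\<bar> * e / s)) * l\<^sup>2 - l * (s * \<eta> * (1 + \<bar>real_of_int m\<bar> * e)))"
      by (rule incr_dev_tail) (use lip[OF d] e s l in \<open>auto simp: abs_mult\<close>)
    also have "real n * (C * (\<bar>real_of_int m\<bar> * e / s)) * l\<^sup>2 - l * (s * \<eta> * (1 + \<bar>real_of_int m\<bar> * e))
        = s * l * (\<bar>real_of_int m\<bar> * e) * (C * l - \<eta>) - l * \<eta> * s"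
      using s by (simp add: s(2)[symmetric] field_simps power2_eq_square)
    also have "\<dots> \<le> - (l * \<eta>) * s"
      using s l e by (simp add: mult_nonneg_nonpos)
    finally show ?thesis by simp
  qed
  have "measure PI (grid_bad t e \<eta> n) = measure PI (\<Union>m\<in>{- M..M}.
      {y \<in> space PI. \<bar>incr_dev n y t (t + real_of_int m * e / s)\<bar> > s * \<eta> * (1 + \<bar>real_of_int m\<bar> * e)})"
    by (simp add: grid_bad_def M_def s_def)
  also have "\<dots> \<le> (\<Sum>m\<in>{- M..M}. measure PI
      {y \<in> space PI. \<bar>incr_dev n y t (t + real_of_int m * e / s)\<bar> > s * \<eta> * (1 + \<bar>real_of_int m\<bar> * e)})"
    by (rule measure_UNION_le) auto
  also have "\<dots> \<le> (\<Sum>m\<in>{- M..M}. 2 * exp (- (l * \<eta>) * s))" by (intro sum_mono pt)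
  also have "\<dots> = (2 * real_of_int M + 1) * (2 * exp (- (l * \<eta>) * s))" using M by simp
  also have "\<dots> \<le> (2 * s / e + 5) * (2 * exp (- (l * \<eta>) * s))"
    using M by (intro mult_right_mono) auto
  finally show ?thesis by (simp add: s_def)
qed

lemma grid_bad_tendsto:
  assumes lip: "\<And>x. \<bar>x - t\<bar> \<le> 2 \<Longrightarrow> \<bar>cdf P0 x - cdf P0 t\<bar> \<le> C * \<bar>x - t\<bar>" and C: "C > 0"
    and e: "0 < e" "e \<le> 1 / 2" and \<eta>: "0 < \<eta>"
  shows "(\<lambda>n. measure PI (grid_bad t e \<eta> n)) \<longlonglongrightarrow> 0"
proof (rule Lim_null_comparison)
  define l where "l = min 1 (\<eta> / C)"
  have a: "l * \<eta> > 0" using C \<eta> by (simp add: l_def)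
  have "\<And>c d. c > 0 \<Longrightarrow> d > 0 \<Longrightarrow> ((\<lambda>n::nat. (2 * sqrt (real n) / d + 5) * (2 * exp (- c * sqrt (real n)))) \<longlongrightarrow> 0) sequentially"
    by real_asymp
  from this[OF a e(1)]
  show "(\<lambda>n. (2 * sqrt (real n) / e + 5) * (2 * exp (- (l * \<eta>) * sqrt (real n)))) \<longlonglongrightarrow> 0" .
  show "eventually (\<lambda>n. norm (measure PI (grid_bad t e \<eta> n)) \<le> (2 * sqrt (real n) / e + 5) * (2 * exp (- (l * \<eta>) * sqrt (real n)))) sequentially"
    using eventually_ge_at_top[of 1]
    by eventually_elim (use measure_grid_bad_le[OF lip C e \<eta>] in \<open>auto simp: l_def\<close>)
qed

text \<open>A neighbouring grid point contributes \<eta> / 4 times 2 + |h|, the probability of the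
  grid cell another \<eta> / 4, and (3 + |h|) / 4 \<le> 1 + |h|.\<close>

lemma not_grid_bad:
  assumes lip: "\<And>x x'. \<bar>x - t\<bar> \<le> 2 \<Longrightarrow> \<bar>x' - t\<bar> \<le> 2 \<Longrightarrow> \<bar>cdf P0 x - cdf P0 x'\<bar> \<le> C * \<bar>x - x'\<bar>" and C: "C > 0"
    and e: "0 < e" "e \<le> 1 / 2" "C * e \<le> \<eta> / 4" and \<eta>: "0 < \<eta>" and n: "n \<ge> 1"
    and y: "y \<in> space PI" "y \<notin> grid_bad t e (\<eta> / 4) n" and h: "\<bar>h\<bar> \<le> sqrt (real n)"
  shows "\<bar>incr_dev n y t (t + h / sqrt (real n))\<bar> \<le> sqrt (real n) * \<eta> * (1 + \<bar>h\<bar>)"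
proof -
  define s where "s = sqrt (real n)"
  have s: "s \<ge> 1" "s * s = real n" using n by (auto simp: s_def)
  define m where "m = \<lfloor>h / e\<rfloor>"
  have m: "real_of_int m \<le> h / e" "h / e < real_of_int m + 1" by (auto simp: m_def)
  have me: "real_of_int m * e \<le> h" "h < (real_of_int m + 1) * e"
    using m e by (auto simp: field_simps)
  have hs: "\<bar>h / e\<bar> \<le> s / e" using h e by (simp add: s_def divide_right_mono)
  have rng: "m \<in> {- \<lceil>s / e\<rceil> - 1..\<lceil>s / e\<rceil> + 1}" "m + 1 \<in> {- \<lceil>s / e\<rceil> - 1..\<lceil>s / e\<rceil> + 1}"
  proof -
    have c: "s / e \<le> real_of_int \<lceil>s / e\<rceil>" by simp
    have "- (s / e) \<le> h / e" "h / e \<le> s / e" using hs by linarith+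
    then show "m \<in> {- \<lceil>s / e\<rceil> - 1..\<lceil>s / e\<rceil> + 1}" "m + 1 \<in> {- \<lceil>s / e\<rceil> - 1..\<lceil>s / e\<rceil> + 1}"
      using m c unfolding atLeastAtMost_iff by linarith+
  qed
  have good: "\<bar>incr_dev n y t (t + real_of_int i * e / s)\<bar> \<le> s * (\<eta> / 4) * (1 + \<bar>real_of_int i\<bar> * e)"
    if "i \<in> {- \<lceil>s / e\<rceil> - 1..\<lceil>s / e\<rceil> + 1}" for i
    using y that unfolding grid_bad_def s_def[symmetric] by (auto simp: not_less)
  define a where "a = t + real_of_int m * e / s"
  define b where "b = t + real_of_int (m + 1) * e / s"
  have ab: "a \<le> t + h / s" "t + h / s \<le> b"
    using me s by (auto simp: a_def b_def intro!: divide_right_mono)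
  have me': "\<bar>real_of_int m * e\<bar> \<le> \<bar>h\<bar> + e" "\<bar>real_of_int (m + 1) * e\<bar> \<le> \<bar>h\<bar> + e"
    using me e by (auto simp: algebra_simps abs_if split: if_splits)
  have near: "\<bar>z / s\<bar> \<le> 2" if "\<bar>z\<bar> \<le> \<bar>h\<bar> + e" for z
  proof -
    have "\<bar>z\<bar> \<le> 2 * s" using that h e s(1) unfolding s_def[symmetric] by linarith
    then show ?thesis using s by (simp add: pos_divide_le_eq)
  qed
  have "\<bar>cdf P0 b - cdf P0 a\<bar> \<le> C * \<bar>b - a\<bar>"
    using near[OF me'(1)] near[OF me'(2)] by (intro lip) (auto simp: a_def b_def)
  also have "b - a = e / s" by (simp add: a_def b_def add_divide_distrib distrib_right)
  finally have "cdf P0 b - cdf P0 a \<le> C * e / s" using e s by simp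
  then have "real n * (cdf P0 b - cdf P0 a) \<le> real n * (C * e / s)" by (intro mult_left_mono) auto
  also have "\<dots> = s * (C * e)" using s by (simp add: s(2)[symmetric])
  also have "\<dots> \<le> s * (\<eta> / 4)" using e s by (intro mult_left_mono) auto
  finally have osc: "real n * (cdf P0 b - cdf P0 a) \<le> s * (\<eta> / 4)" .
  have g: "s * (\<eta> / 4) * (1 + \<bar>real_of_int i\<bar> * e) \<le> s * (\<eta> / 4) * (2 + \<bar>h\<bar>)"
    if "\<bar>real_of_int i * e\<bar> \<le> \<bar>h\<bar> + e" for i
    using that e s \<eta> by (intro mult_left_mono) (auto simp: abs_mult)
  have "\<bar>incr_dev n y t a\<bar> \<le> s * (\<eta> / 4) * (2 + \<bar>h\<bar>)" "\<bar>incr_dev n y t b\<bar> \<le> s * (\<eta> / 4) * (2 + \<bar>h\<bar>)"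
    using order_trans[OF good[OF rng(1)] g[OF me'(1)]] order_trans[OF good[OF rng(2)] g[OF me'(2)]]
    by (auto simp: a_def b_def)
  then have "\<bar>incr_dev n y t (t + h / s)\<bar> \<le> s * (\<eta> / 4) * (2 + \<bar>h\<bar>) + s * (\<eta> / 4)"
    using incr_dev_between[OF ab, of n y t] osc by linarith
  also have "\<dots> = s * \<eta> * ((3 + \<bar>h\<bar>) / 4)" by (simp add: algebra_simps)
  also have "\<dots> \<le> s * \<eta> * (1 + \<bar>h\<bar>)" using s \<eta> by (intro mult_left_mono) auto
  finally show ?thesis by (simp add: s_def)
qed


section \<open>Weights that dominate the inverse masses\<close>

definition mass :: "nat \<Rightarrow> (nat \<Rightarrow> real) \<Rightarrow> nat \<Rightarrow> ennreal" where
  "mass k \<theta> j = ennreal (ends k 1 (cdf P0) \<theta> j - ends k 1 (cdf P0) \<theta> (j - 1))"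

text \<open>Differences of the cdf make \<open>mass\<close> measurable in \<theta>. Outside
  \<open>Theta k\<close> they can be negative and \<open>ennreal\<close> cuts them off at 0, so the
  identity is confined to ordered \<theta>.\<close>

lemma mass_eq:
  assumes "\<theta> \<in> Theta k" "j \<in> {1..k+1}"
  shows "mass k \<theta> j = emeasure P0 (Sset k \<theta> j)"
proof -
  have "measure P0 UNIV = 1" using prob_space by simp
  then have "measure P0 (Sset k \<theta> j) = ends k 1 (cdf P0) \<theta> j - ends k 1 (cdf P0) \<theta> (j - 1)"
    using measure_Sset[OF finite_measure_axioms _ assms] by (simp add: ends_def cdf_def)
  then show ?thesis by (simp add: mass_def emeasure_eq_measure)
qed

text \<open>
  The tilting weights \<open>1 + 1 / (n F\<^sub>0(S\<^sub>j))\<close> have mean at most \<open>1 + (k + 1) / n\<close>. On cells of mass zero they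
  are \<open>\<infinity>\<close>, which is harmless since \<open>\<infinity> * 0 = 0\<close>.
\<close>
definition weight :: "nat \<Rightarrow> nat \<Rightarrow> (nat \<Rightarrow> real) \<Rightarrow> nat \<Rightarrow> ennreal" where
  "weight n k \<theta> j = 1 + 1 / (of_nat n * mass k \<theta> j)"

definition weight_at :: "nat \<Rightarrow> nat \<Rightarrow> (nat \<Rightarrow> real) \<Rightarrow> real \<Rightarrow> ennreal" where
  "weight_at n k \<theta> x = (\<Sum>j\<in>{1..k+1}. indicator (Sset k \<theta> j) x * weight n k \<theta> j)"

text \<open>A product over independent observations, so its mean is the n-th power of a single
  integral. The factors of the product over cells that it dominates are dependent.\<close>

definition sample_weight :: "nat \<Rightarrow> nat \<Rightarrow> (nat \<Rightarrow> real) \<Rightarrow> (nat \<Rightarrow> real) \<Rightarrow> ennreal" where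
  "sample_weight n k y \<theta> = (\<Prod>i\<in>{1..n}. weight_at n k \<theta> (y i))"

lemma nn_integral_sample_weight:
  assumes \<theta>: "\<theta> \<in> Theta k" and n: "n \<ge> 1"
  shows "(\<integral>\<^sup>+ y. sample_weight n k y \<theta> \<partial>PI) \<le> ennreal (exp (real k + 1))"
proof -
  have "(\<integral>\<^sup>+ y. sample_weight n k y \<theta> \<partial>PI) = (\<integral>\<^sup>+ x. weight_at n k \<theta> x \<partial>P0) ^ n"
    unfolding sample_weight_def weight_at_def by (rule nn_integral_prod_iid) measurable
  also have "\<dots> \<le> (ennreal (1 + (real k + 1) / real n)) ^ n"
  proof (rule power_mono)
    have "(\<integral>\<^sup>+ x. weight_at n k \<theta> x \<partial>P0) = (\<Sum>j\<in>{1..k+1}. emeasure P0 (Sset k \<theta> j) * weight n k \<theta> j)"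
      unfolding weight_at_def by (subst nn_integral_sum) (auto simp: nn_integral_multc)
    also have "\<dots> \<le> (\<Sum>j\<in>{1..k+1}. emeasure P0 (Sset k \<theta> j) + ennreal (1 / real n))"
    proof (rule sum_mono)
      fix j assume j: "j \<in> {1..k+1}"
      have "emeasure P0 (Sset k \<theta> j) * (1 / (of_nat n * emeasure P0 (Sset k \<theta> j))) \<le> ennreal (1 / real n)"
      proof (cases "measure P0 (Sset k \<theta> j) = 0")
        case False
        then have pos: "measure P0 (Sset k \<theta> j) > 0" by (simp add: zero_less_measure_iff)
        have "1 / (of_nat n * emeasure P0 (Sset k \<theta> j)) = ennreal (1 / (real n * measure P0 (Sset k \<theta> j)))"
          using pos n by (simp add: emeasure_eq_measure ennreal_of_nat_eq_real_of_nat flip: ennreal_mult divide_ennreal ennreal_1)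
        then show ?thesis using pos n by (simp add: emeasure_eq_measure flip: ennreal_mult)
      qed (simp add: emeasure_eq_measure)
      then show "emeasure P0 (Sset k \<theta> j) * weight n k \<theta> j \<le> emeasure P0 (Sset k \<theta> j) + ennreal (1 / real n)"
        using j by (simp add: weight_def mass_eq[OF \<theta>] distrib_left add_left_mono)
    qed
    also have "\<dots> = emeasure P0 (\<Union>j\<in>{1..k+1}. Sset k \<theta> j) + ennreal ((real k + 1) / real n)"
    proof -
      have "(\<Sum>j\<in>{1..k+1}. emeasure P0 (Sset k \<theta> j)) = emeasure P0 (\<Union>j\<in>{1..k+1}. Sset k \<theta> j)"
      proof (rule sum_emeasure)
        show "disjoint_family_on (Sset k \<theta>) {1..k+1}"
          unfolding disjoint_family_on_def using Sset_disjoint[OF \<theta>] by blast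
      qed auto
      moreover have "(\<Sum>j\<in>{1..k+1}. ennreal (1 / real n)) = ennreal (\<Sum>j\<in>{1..k+1}. 1 / real n)"
        by (rule sum_ennreal) simp
      ultimately show ?thesis by (simp only: sum.distrib) (simp add: add.commute)
    qed
    also have "\<dots> \<le> 1 + ennreal ((real k + 1) / real n)"
      by (intro add_right_mono emeasure_le_1)
    also have "\<dots> = ennreal (1 + (real k + 1) / real n)"
      by (subst ennreal_plus) auto
    finally show "(\<integral>\<^sup>+ x. weight_at n k \<theta> x \<partial>P0) \<le> ennreal (1 + (real k + 1) / real n)" .
  qed simp
  also have "\<dots> \<le> (ennreal (exp ((real k + 1) / real n))) ^ n"
    by (intro power_mono ennreal_leI exp_ge_add_one_self) auto
  also have "\<dots> = ennreal (exp (real k + 1))"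
    using n by (simp add: ennreal_power exp_of_nat_mult[symmetric])
  finally show ?thesis .
qed

lemma ennreal_bernoulli: "(1 + x) ^ N \<ge> 1 + of_nat N * (x :: ennreal)"
proof (induction N)
  case (Suc N)
  have "1 + of_nat (Suc N) * x \<le> (1 + of_nat N * x) + (1 + of_nat N * x) * x"
    by (simp add: algebra_simps)
  also have "\<dots> = (1 + x) * (1 + of_nat N * x)" by (simp add: algebra_simps)
  also have "\<dots> \<le> (1 + x) * (1 + x) ^ N" by (intro mult_left_mono Suc) auto
  finally show ?case by simp
qed simp

text \<open>Grouping the observations by cell turns a product of weights over observations into
  powers \<open>weight ^ N\<close>, and (1 + x)^N \<ge> 1 + N x bounds these below by the product
  over cells.\<close>

lemma sample_weight_ge:
  assumes \<theta>: "\<theta> \<in> Theta k"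
  shows "(\<Prod>j\<in>{1..k+1}. 1 + of_nat (cnt n y (Sset k \<theta> j)) / (of_nat n * mass k \<theta> j)) \<le> sample_weight n k y \<theta>"
proof -
  have "\<exists>g. \<forall>i. g i \<in> {1..k+1} \<and> y i \<in> Sset k \<theta> (g i)"
    by (intro choice allI) (use Sset_cover[of k _ \<theta>] in blast)
  then obtain g where g: "\<And>i. g i \<in> {1..k+1}" "\<And>i. y i \<in> Sset k \<theta> (g i)" by auto
  have cg: "cnt n y (Sset k \<theta> j) = card {i \<in> {1..n}. g i = j}" if "j \<in> {1..k+1}" for j
    unfolding cnt_def using g that Sset_disjoint[OF \<theta>] by (intro arg_cong[where f = card]) blast
  have "(\<Prod>j\<in>{1..k+1}. 1 + of_nat (cnt n y (Sset k \<theta> j)) / (of_nat n * mass k \<theta> j))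
      \<le> (\<Prod>j\<in>{1..k+1}. weight n k \<theta> j ^ cnt n y (Sset k \<theta> j))"
  proof (rule prod_mono_ennreal)
    fix j assume "j \<in> {1..k+1}"
    show "1 + of_nat (cnt n y (Sset k \<theta> j)) / (of_nat n * mass k \<theta> j) \<le> weight n k \<theta> j ^ cnt n y (Sset k \<theta> j)"
      using ennreal_bernoulli[of "cnt n y (Sset k \<theta> j)" "1 / (of_nat n * mass k \<theta> j)"]
      by (simp add: weight_def ennreal_times_divide)
  qed
  also have "\<dots> = (\<Prod>j\<in>{1..k+1}. \<Prod>i\<in>{i \<in> {1..n}. g i = j}. weight n k \<theta> (g i))"
    by (intro prod.cong refl) (simp add: cg)
  also have "\<dots> = (\<Prod>i\<in>{1..n}. weight n k \<theta> (g i))"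
    by (rule prod.group) (use g in auto)
  also have "\<dots> \<le> sample_weight n k y \<theta>"
    unfolding sample_weight_def
  proof (rule prod_mono_ennreal)
    fix i assume "i \<in> {1..n}"
    have "weight n k \<theta> (g i) = indicator (Sset k \<theta> (g i)) (y i) * weight n k \<theta> (g i)" using g by simp
    also have "\<dots> \<le> weight_at n k \<theta> (y i)"
      unfolding weight_at_def by (rule member_le_sum) (use g in auto)
    finally show "weight n k \<theta> (g i) \<le> weight_at n k \<theta> (y i)" .
  qed
  finally show ?thesis .
qed

lemma cdf_measurable: "cdf P0 \<in> borel_measurable borel"
  by (intro borel_measurable_mono monoI cdf_nondecreasing)

lemma weight_measurable: "j \<in> {1..k+1} \<Longrightarrow> (\<lambda>\<theta>. weight n k \<theta> j) \<in> borel_measurable (lebk k)"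
  unfolding weight_def mass_def
  by (intro borel_measurable_add borel_measurable_const borel_measurable_divide_ennreal borel_measurable_times_ennreal
      measurable_compose[OF _ measurable_ennreal] borel_measurable_diff ends_measurable cdf_measurable) auto

lemma sample_weight_measurable:
  "(\<lambda>(y, \<theta>). sample_weight n k y \<theta>) \<in> borel_measurable (PI \<Otimes>\<^sub>M lebk k)"
proof -
  have 1: "(\<lambda>z. fst z i) \<in> borel_measurable (PI \<Otimes>\<^sub>M lebk k)" for i
    by (rule measurable_compose[OF measurable_fst PI_component])
  have 2: "(\<lambda>z. snd z j) \<in> borel_measurable (PI \<Otimes>\<^sub>M lebk k)" if "j \<in> {1..k}" for j
    by (rule measurable_compose[OF measurable_snd measurable_lebk_component[OF that]])
  have 3: "(\<lambda>z. weight n k (snd z) j) \<in> borel_measurable (PI \<Otimes>\<^sub>M lebk k)" if "j \<in> {1..k+1}" for j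
    by (rule measurable_compose[OF measurable_snd weight_measurable[OF that]])
  \<comment> \<open>Coordinates exist only for indices in {1..k}, so the conditions at the two
    infinite end points are treated separately.\<close>
  have 4: "(\<lambda>z. indicator (Sset k (snd z) j) (fst z i) :: ennreal) \<in> borel_measurable (PI \<Otimes>\<^sub>M lebk k)"
    if j: "j \<in> {1..k+1}" for i j
  proof -
    have a: "(\<lambda>z. j = 1 \<or> snd z (j - 1) < fst z i) \<in> measurable (PI \<Otimes>\<^sub>M lebk k) (count_space UNIV)"
    proof (cases "j = 1")
      case False
      then have j1: "j - 1 \<in> {1..k}" using j by auto
      show ?thesis using False borel_measurable_less[OF 2[OF j1] 1[of i]] by simp
    qed simp
    have b: "(\<lambda>z. j = k + 1 \<or> fst z i \<le> snd z j) \<in> measurable (PI \<Otimes>\<^sub>M lebk k) (count_space UNIV)"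
    proof (cases "j = k + 1")
      case False
      then have jk: "j \<in> {1..k}" using j by auto
      show ?thesis using False borel_measurable_le[OF 1[of i] 2[OF jk]] by simp
    qed simp
    define X where "X = {z \<in> space (PI \<Otimes>\<^sub>M lebk k). (j = 1 \<or> snd z (j - 1) < fst z i) \<and> (j = k + 1 \<or> fst z i \<le> snd z j)}"
    have X: "X \<in> sets (PI \<Otimes>\<^sub>M lebk k)"
      unfolding X_def by (rule sets.sets_Collect_conj[OF predE[OF b] predE[OF a]])
    have "(\<lambda>z. indicator (Sset k (snd z) j) (fst z i) :: ennreal) \<in> borel_measurable (PI \<Otimes>\<^sub>M lebk k)
        \<longleftrightarrow> (\<lambda>z. indicator X z :: ennreal) \<in> borel_measurable (PI \<Otimes>\<^sub>M lebk k)"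
      by (rule measurable_cong) (auto simp: X_def indicator_def Sset_def)
    then show ?thesis using borel_measurable_indicator[OF X] by blast
  qed
  have "(\<lambda>z. sample_weight n k (fst z) (snd z)) \<in> borel_measurable (PI \<Otimes>\<^sub>M lebk k)"
    unfolding sample_weight_def weight_at_def
    by (intro borel_measurable_prod_ennreal borel_measurable_sum borel_measurable_times_ennreal 3 4)
  then show ?thesis by (simp add: case_prod_unfold)
qed

text \<open>A single statistic of the sample that controls the whole region away from \<theta>0: the
  average over \<theta> is taken before any bound in probability.\<close>

definition prior_weight :: "nat \<Rightarrow> ((nat \<Rightarrow> real) \<Rightarrow> real) \<Rightarrow> nat \<Rightarrow> (nat \<Rightarrow> real) \<Rightarrow> ennreal" where
  "prior_weight k pri n y = (\<integral>\<^sup>+ \<theta>. ennreal (indicator (Theta k) \<theta> * pri \<theta>) * sample_weight n k y \<theta> \<partial>lebk k)"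

lemma prior_weight_integrand_measurable:
  assumes "pri \<in> borel_measurable (lebk k)"
  shows "(\<lambda>(y, \<theta>). ennreal (indicator (Theta k) \<theta> * pri \<theta>) * sample_weight n k y \<theta>) \<in> borel_measurable (PI \<Otimes>\<^sub>M lebk k)"
  unfolding case_prod_unfold
  by (intro borel_measurable_times_ennreal measurable_compose[OF measurable_snd prior_measurable[OF assms]]
      sample_weight_measurable[unfolded case_prod_unfold])

lemma prior_weight_measurable:
  assumes "pri \<in> borel_measurable (lebk k)"
  shows "prior_weight k pri n \<in> borel_measurable PI"
  unfolding prior_weight_def[abs_def]
  by (rule sigma_finite_measure.borel_measurable_nn_integral[OF sigma_finite_lebk prior_weight_integrand_measurable[OF assms]])

lemma nn_integral_prior_weight:
  assumes pri: "pri \<in> borel_measurable (lebk k)" and n: "n \<ge> 1"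
    and dens: "(\<integral>\<^sup>+ \<theta>. ennreal (indicator (Theta k) \<theta> * pri \<theta>) \<partial>lebk k) = 1"
  shows "(\<integral>\<^sup>+ y. prior_weight k pri n y \<partial>PI) \<le> ennreal (exp (real k + 1))"
proof -
  interpret L: sigma_finite_measure "lebk k" by (rule sigma_finite_lebk)
  interpret pair_sigma_finite PI "lebk k" by standard
  have m: "(\<lambda>y. sample_weight n k y \<theta>) \<in> borel_measurable PI" if "\<theta> \<in> space (lebk k)" for \<theta>
    using measurable_compose[OF measurable_Pair2'[OF that] sample_weight_measurable] by simp
  have "(\<integral>\<^sup>+ y. prior_weight k pri n y \<partial>PI) = (\<integral>\<^sup>+ \<theta>. \<integral>\<^sup>+ y. ennreal (indicator (Theta k) \<theta> * pri \<theta>) * sample_weight n k y \<theta> \<partial>PI \<partial>lebk k)"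
    unfolding prior_weight_def
    using Fubini[OF prior_weight_integrand_measurable[OF pri, of n]] by simp
  also have "\<dots> = (\<integral>\<^sup>+ \<theta>. ennreal (indicator (Theta k) \<theta> * pri \<theta>) * (\<integral>\<^sup>+ y. sample_weight n k y \<theta> \<partial>PI) \<partial>lebk k)"
    by (intro nn_integral_cong nn_integral_cmult m)
  also have "\<dots> \<le> (\<integral>\<^sup>+ \<theta>. ennreal (indicator (Theta k) \<theta> * pri \<theta>) * ennreal (exp (real k + 1)) \<partial>lebk k)"
  proof (rule nn_integral_mono)
    fix \<theta>
    show "ennreal (indicator (Theta k) \<theta> * pri \<theta>) * (\<integral>\<^sup>+ y. sample_weight n k y \<theta> \<partial>PI)
        \<le> ennreal (indicator (Theta k) \<theta> * pri \<theta>) * ennreal (exp (real k + 1))"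
      using nn_integral_sample_weight[OF _ n, of \<theta> k] by (cases "\<theta> \<in> Theta k") (auto intro: mult_left_mono)
  qed
  also have "\<dots> = ennreal (exp (real k + 1))"
    using prior_measurable[OF pri] by (simp add: nn_integral_multc dens)
  finally show ?thesis .
qed

lemma prior_weight_tail:
  assumes pri: "pri \<in> borel_measurable (lebk k)" and n: "n \<ge> 1" and K: "K > 0"
    and dens: "(\<integral>\<^sup>+ \<theta>. ennreal (indicator (Theta k) \<theta> * pri \<theta>) \<partial>lebk k) = 1"
  shows "measure PI {y \<in> space PI. prior_weight k pri n y > ennreal K} \<le> exp (real k + 1) / K"
proof -
  have [measurable]: "prior_weight k pri n \<in> borel_measurable PI" by (rule prior_weight_measurable[OF pri])
  have "emeasure PI {y \<in> space PI. prior_weight k pri n y > ennreal K}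
      \<le> emeasure PI {y \<in> space PI. 1 \<le> ennreal (1 / K) * prior_weight k pri n y}"
  proof (rule emeasure_mono)
    have "1 \<le> ennreal (1 / K) * w" if "w > ennreal K" for w
    proof -
      have "1 = ennreal (1 / K) * ennreal K" using K by (simp flip: ennreal_mult)
      also have "\<dots> \<le> ennreal (1 / K) * w" using that by (intro mult_left_mono) auto
      finally show ?thesis .
    qed
    then show "{y \<in> space PI. ennreal K < prior_weight k pri n y} \<subseteq> {y \<in> space PI. 1 \<le> ennreal (1 / K) * prior_weight k pri n y}"
      by auto
  qed measurable
  also have "\<dots> \<le> ennreal (1 / K) * (\<integral>\<^sup>+ y. prior_weight k pri n y * indicator (space PI) y \<partial>PI)"
    by (rule nn_integral_Markov_inequality) auto
  also have "(\<integral>\<^sup>+ y. prior_weight k pri n y * indicator (space PI) y \<partial>PI) = (\<integral>\<^sup>+ y. prior_weight k pri n y \<partial>PI)"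
    by (intro nn_integral_cong) auto
  also have "ennreal (1 / K) * \<dots> \<le> ennreal (1 / K) * ennreal (exp (real k + 1))"
    by (intro mult_left_mono nn_integral_prior_weight pri n dens) auto
  also have "\<dots> = ennreal (exp (real k + 1) / K)" using K by (simp flip: ennreal_mult)
  finally show ?thesis using K by (simp add: PP.emeasure_eq_measure)
qed

end

section \<open>The quantile model\<close>

lemma ennreal_prod_le:
  fixes f :: "'a \<Rightarrow> real" and g :: "'a \<Rightarrow> ennreal"
  assumes "\<And>i. i \<in> I \<Longrightarrow> f i \<ge> 0" "\<And>i. i \<in> I \<Longrightarrow> ennreal (f i) \<le> g i"
  shows "ennreal (prod f I) \<le> prod g I"
proof -
  have "ennreal (prod f I) = (\<Prod>i\<in>I. ennreal (f i))" using assms(1) by (simp add: prod_ennreal)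
  also have "\<dots> \<le> prod g I" using assms(2) by (rule prod_mono_ennreal)
  finally show ?thesis .
qed

text \<open>Downward closure of \<open>P j\<close> lets the smallest radius serve all j. Besides
  radii this also produces a common positive lower bound for finitely many positive numbers.\<close>

lemma finite_min_radius:
  fixes P :: "'a \<Rightarrow> real \<Rightarrow> bool"
  assumes "finite I" "\<And>j. j \<in> I \<Longrightarrow> \<exists>\<delta>>0. P j \<delta>"
    and "\<And>j \<delta> \<delta>'. P j \<delta> \<Longrightarrow> 0 < \<delta>' \<Longrightarrow> \<delta>' \<le> \<delta> \<Longrightarrow> P j \<delta>'"
  shows "\<exists>\<delta>>0. \<forall>j\<in>I. P j \<delta>"
  using assms(1,2)
proof (induction I rule: finite_induct)
  case (insert j I)
  then obtain d1 where d1: "d1 > 0" "\<forall>i\<in>I. P i d1" by auto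
  obtain d2 where d2: "d2 > 0" "P j d2" using insert by auto
  note d = d1 d2
  have "P i (min d1 d2)" if "i \<in> insert j I" for i
    using that d assms(3)[of i d1 "min d1 d2"] assms(3)[of j d2 "min d1 d2"] by auto
  then show ?case using d by (intro exI[of _ "min d1 d2"]) auto
qed (auto intro: exI[of _ 1])

section \<open>The setting and the rescaled posterior density\<close>

locale quantile_model =
  fixes k :: nat and p :: "nat \<Rightarrow> real"
    and P0 :: "real measure" and f0 :: "real \<Rightarrow> real"
    and \<theta>0 :: "nat \<Rightarrow> real" and pri :: "(nat \<Rightarrow> real) \<Rightarrow> real"
    and \<alpha> :: "real measure"
  assumes k: "k \<ge> 1"
    and p_range: "\<forall>j\<in>{1..k}. 0 < p j \<and> p j < 1"
    and p_mono: "\<forall>j. 1 \<le> j \<longrightarrow> j < k \<longrightarrow> p j < p (Suc j)"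
    and P0: "real_distribution P0"
    and F0_deriv: "\<forall>x. (cdf P0 has_real_derivative f0 x) (at x)"
    and f0_lip: "\<exists>L. \<forall>x x'. \<bar>f0 x - f0 x'\<bar> \<le> L * \<bar>x - x'\<bar>"
    and \<theta>0_ext: "\<theta>0 \<in> extensional {1..k}"
    and \<theta>0_quant: "\<forall>j\<in>{1..k}. cdf P0 (\<theta>0 j) = p j"
    and f0_pos: "\<forall>j\<in>{1..k}. f0 (\<theta>0 j) > 0"
    and pri_meas: "pri \<in> borel_measurable (lebk k)"
    and pri_nonneg: "\<forall>\<theta>\<in>Theta k. pri \<theta> \<ge> 0"
    and pri_dens: "(\<integral>\<^sup>+ \<theta>. ennreal (indicator (Theta k) \<theta> * pri \<theta>) \<partial>lebk k) = 1"
    and pri_cont: "\<forall>\<epsilon>>0. \<exists>\<delta>>0. \<forall>\<theta>\<in>Theta k.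
                     (\<forall>j\<in>{1..k}. \<bar>\<theta> j - \<theta>0 j\<bar> < \<delta>) \<longrightarrow> \<bar>pri \<theta> - pri \<theta>0\<bar> < \<epsilon>"
    and pri_pos: "pri \<theta>0 > 0"
    and \<alpha>_fin: "finite_measure \<alpha>"
    and \<alpha>_sets: "sets \<alpha> = sets borel"
    and A_pos: "measure \<alpha> UNIV > 0"
    and Qn1: "\<exists>L>0. \<forall>j\<in>{1..k}. \<exists>\<delta>>0. \<forall>x x'. x < x' \<and> \<bar>x - \<theta>0 j\<bar> < \<delta> \<and> \<bar>x' - \<theta>0 j\<bar> < \<delta>
                  \<longrightarrow> measure \<alpha> {x<..x'} \<le> L * \<bar>x - x'\<bar>"
    and Qn2: "\<forall>j\<in>{1..k+1}. measure \<alpha> (Sset k \<theta>0 j) > 0"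
    and Qn3: "\<exists>M'>0. \<forall>a b. a < b \<longrightarrow> measure \<alpha> {a<..b} \<ge> M' * measure P0 {a<..b}"
begin

interpretation P0: real_distribution P0 by (rule P0)
interpretation \<alpha>: finite_measure \<alpha> by (rule \<alpha>_fin)

abbreviation "A \<equiv> measure \<alpha> UNIV"
abbreviation "al \<theta> j \<equiv> measure \<alpha> (Sset k \<theta> j)"
abbreviation "D j \<equiv> dp k p j"
abbreviation "N n y \<theta> j \<equiv> cnt n y (Sset k \<theta> j)"

lemma \<theta>0_Theta: "\<theta>0 \<in> Theta k"
proof -
  have "\<theta>0 j < \<theta>0 (Suc j)" if "1 \<le> j" "j < k" for j
  proof (rule ccontr)
    assume "\<not> \<theta>0 j < \<theta>0 (Suc j)"
    then have "cdf P0 (\<theta>0 (Suc j)) \<le> cdf P0 (\<theta>0 j)" by (intro P0.cdf_nondecreasing) simp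
    then show False using \<theta>0_quant p_mono that by force
  qed
  then show ?thesis using \<theta>0_ext by (simp add: Theta_def)
qed

lemma pext_pos_less: "j \<in> {1..k+1} \<Longrightarrow> pext k p (j - 1) < pext k p j"
proof -
  assume j: "j \<in> {1..k+1}"
  consider "j = 1" | "j = k + 1" "k \<ge> 1" | "1 \<le> j - 1" "j - 1 < k" "Suc (j - 1) = j" using j by force
  then show ?thesis
  proof cases
    case 1
    then show ?thesis using p_range k by (auto simp: pext_def)
  next
    case 2
    then show ?thesis using p_range by (auto simp: pext_def)
  next
    case 3
    then show ?thesis using p_mono[rule_format, of "j - 1"] by (auto simp: pext_def)
  qed
qed

lemma D_pos: "j \<in> {1..k+1} \<Longrightarrow> D j > 0"
  using pext_pos_less[of j] by (simp add: dp_def)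

lemma pext_range: "j \<le> k + 1 \<Longrightarrow> 0 \<le> pext k p j \<and> pext k p j \<le> 1"
  using p_range by (auto simp: pext_def less_imp_le)

lemma D_le_1: "j \<in> {1..k+1} \<Longrightarrow> D j \<le> 1"
  using pext_range[of j] pext_range[of "j - 1"] by (fastforce simp: dp_def)

lemma al_le: "al \<theta> j \<le> A"
  using \<alpha>.finite_measure_mono[of "Sset k \<theta> j" UNIV] \<alpha>_sets by simp

lemma al0_pos: "j \<in> {1..k+1} \<Longrightarrow> al \<theta>0 j > 0" using Qn2 by blast

lemma al_eq_ends:
  "\<theta> \<in> Theta k \<Longrightarrow> j \<in> {1..k+1} \<Longrightarrow> al \<theta> j
    = ends k A (\<lambda>x. measure \<alpha> {..x}) \<theta> j - ends k A (\<lambda>x. measure \<alpha> {..x}) \<theta> (j - 1)"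
  by (rule measure_Sset[OF \<alpha>_fin \<alpha>_sets])

text \<open>The factors of \<open>lik\<close> free of \<theta>, completed by the inverse reference
  values of \<open>Efac\<close>. The power n^n arises because the counts of the cells add up to n,
  so that (n D)^N can stand for D^N in \<open>Efac\<close>.\<close>

definition lik_const :: "nat \<Rightarrow> real" where
  "lik_const n = Gamma (A + real n) / Gamma A / real n ^ n *
     (\<Prod>j\<in>{1..k+1}. (real n * D j) ^ nat \<lfloor>real n * D j\<rfloor> / pochhammer (al \<theta>0 j) (nat \<lfloor>real n * D j\<rfloor>))"

definition rel_lik :: "nat \<Rightarrow> (nat \<Rightarrow> real) \<Rightarrow> (nat \<Rightarrow> real) \<Rightarrow> real" where
  "rel_lik n y \<theta> = (\<Prod>j\<in>{1..k+1}. Efac (D j) (al \<theta>0 j) n (al \<theta> j) (N n y \<theta> j))"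

lemma lik_const_pos: "n \<ge> 1 \<Longrightarrow> lik_const n > 0"
  unfolding lik_const_def using A_pos D_pos al0_pos
  by (intro mult_pos_pos divide_pos_pos prod_pos Gamma_real_pos pochhammer_pos) auto

lemma lik_eq:
  assumes \<theta>: "\<theta> \<in> Theta k" and n: "n \<ge> 1"
  shows "lik k p \<alpha> n y \<theta> = lik_const n * rel_lik n y \<theta>"
proof -
  have "(\<Prod>j\<in>{1..k+1}. (1 / pochhammer (al \<theta> j) (N n y \<theta> j)) * D j ^ N n y \<theta> j)
     = (\<Prod>j\<in>{1..k+1}. Efac (D j) (al \<theta>0 j) n (al \<theta> j) (N n y \<theta> j) *
         ((real n * D j) ^ nat \<lfloor>real n * D j\<rfloor> / pochhammer (al \<theta>0 j) (nat \<lfloor>real n * D j\<rfloor>)) * (1 / real n ^ N n y \<theta> j))"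
  proof (intro prod.cong refl)
    fix j assume j: "j \<in> {1..k+1}"
    have nz: "pochhammer (al \<theta>0 j) (nat \<lfloor>real n * D j\<rfloor>) \<noteq> 0" "(real n * D j) ^ nat \<lfloor>real n * D j\<rfloor> \<noteq> 0"
      using pochhammer_pos[OF al0_pos[OF j]] n D_pos[OF j] by (auto simp: less_imp_neq[symmetric])
    \<comment> \<open>P may be 0, namely for a nonempty cell without mass; division by zero then
      makes both sides 0.\<close>
    have *: "1 / P * d ^ N = (Q / P * ((r * d) ^ N / R)) * (R / Q) * (1 / r ^ N)"
      if "Q \<noteq> 0" "R \<noteq> 0" "r \<noteq> 0" for P Q R d r :: real and N :: nat
      using that by (simp add: power_mult_distrib)
    show "1 / pochhammer (al \<theta> j) (N n y \<theta> j) * D j ^ N n y \<theta> j = Efac (D j) (al \<theta>0 j) n (al \<theta> j) (N n y \<theta> j) *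
         ((real n * D j) ^ nat \<lfloor>real n * D j\<rfloor> / pochhammer (al \<theta>0 j) (nat \<lfloor>real n * D j\<rfloor>)) * (1 / real n ^ N n y \<theta> j)"
      unfolding Efac_def by (rule *) (use nz n in auto)
  qed
  also have "\<dots> = rel_lik n y \<theta> *
     (\<Prod>j\<in>{1..k+1}. (real n * D j) ^ nat \<lfloor>real n * D j\<rfloor> / pochhammer (al \<theta>0 j) (nat \<lfloor>real n * D j\<rfloor>)) *
     (\<Prod>j\<in>{1..k+1}. 1 / real n ^ N n y \<theta> j)"
    by (simp only: prod.distrib rel_lik_def)
  also have "(\<Prod>j\<in>{1..k+1}. 1 / real n ^ N n y \<theta> j) = 1 / real n ^ n"
    by (simp only: prod_dividef power_sum[symmetric] sum_cnt_Sset[OF \<theta>] prod.neutral_const)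
  finally show ?thesis unfolding lik_def lik_const_def by (simp add: mult_ac)
qed

lemma Efac_borel: "(\<lambda>a. Efac d b n a M) \<in> borel_measurable borel"
  unfolding Efac_def pochhammer_prod by measurable

lemma cnt_atMost_borel: "(\<lambda>x. real (cnt n y {..x})) \<in> borel_measurable borel"
  by (intro borel_measurable_mono monoI of_nat_mono cnt_mono) auto

lemma alpha_atMost_borel: "(\<lambda>x. measure \<alpha> {..x}) \<in> borel_measurable borel"
  by (intro borel_measurable_mono monoI \<alpha>.finite_measure_mono) (auto simp: \<alpha>_sets)

definition rel_post :: "nat \<Rightarrow> (nat \<Rightarrow> real) \<Rightarrow> (nat \<Rightarrow> real) \<Rightarrow> real" where
  "rel_post n y \<theta> = indicator (Theta k) \<theta> * rel_lik n y \<theta> * pri \<theta>"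

lemma rel_lik_nonneg: "rel_lik n y \<theta> \<ge> 0"
  unfolding rel_lik_def using al0_pos D_pos by (intro prod_nonneg ballI Efac_nonneg) (auto intro: less_imp_le)

lemma rel_post_nonneg: "rel_post n y \<theta> \<ge> 0"
  unfolding rel_post_def using rel_lik_nonneg pri_nonneg by (cases "\<theta> \<in> Theta k") auto

lemma rel_post_measurable: "rel_post n y \<in> borel_measurable (lebk k)"
proof -
  \<comment> \<open>These substitutes are measurable on the whole space. They agree with masses and
    counts on \<open>Theta k\<close>, and elsewhere the indicator removes them. As \<open>N'\<close>
    takes countably many values, measurability can be checked for each fixed count.\<close>
  define a' where "a' \<theta> j = ends k A (\<lambda>x. measure \<alpha> {..x}) \<theta> j - ends k A (\<lambda>x. measure \<alpha> {..x}) \<theta> (j - 1)" for \<theta> j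
  define N' where "N' \<theta> j = nat \<lfloor>ends k (real n) (\<lambda>x. real (cnt n y {..x})) \<theta> j - ends k (real n) (\<lambda>x. real (cnt n y {..x})) \<theta> (j - 1)\<rfloor>" for \<theta> j
  have a': "(\<lambda>\<theta>. a' \<theta> j) \<in> borel_measurable (lebk k)" if "j \<in> {1..k+1}" for j
    unfolding a'_def using that by (intro borel_measurable_diff ends_measurable alpha_atMost_borel) auto
  have N': "(\<lambda>\<theta>. N' \<theta> j) \<in> measurable (lebk k) (count_space UNIV)" if "j \<in> {1..k+1}" for j
  proof -
    have X: "(\<lambda>\<theta>. ends k (real n) (\<lambda>x. real (cnt n y {..x})) \<theta> j - ends k (real n) (\<lambda>x. real (cnt n y {..x})) \<theta> (j - 1)) \<in> borel_measurable (lebk k)"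
      using that by (intro borel_measurable_diff ends_measurable cnt_atMost_borel) auto
    have "(\<lambda>x::real. nat \<lfloor>x\<rfloor>) \<in> measurable borel (count_space UNIV)" by measurable
    from measurable_compose[OF X this] show ?thesis unfolding N'_def .
  qed
  have E: "(\<lambda>\<theta>. Efac (D j) (al \<theta>0 j) n (a' \<theta> j) (N' \<theta> j)) \<in> borel_measurable (lebk k)" if j: "j \<in> {1..k+1}" for j
  proof (rule measurable_compose_countable[where f = "\<lambda>M \<theta>. Efac (D j) (al \<theta>0 j) n (a' \<theta> j) M" and g = "\<lambda>\<theta>. N' \<theta> j"])
    show "(\<lambda>\<theta>. Efac (D j) (al \<theta>0 j) n (a' \<theta> j) M) \<in> borel_measurable (lebk k)" for M
      by (rule measurable_compose[OF a'[OF j] Efac_borel])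
  qed (rule N'[OF j])
  have eq: "rel_post n y = (\<lambda>\<theta>. indicator (Theta k) \<theta> * (\<Prod>j\<in>{1..k+1}. Efac (D j) (al \<theta>0 j) n (a' \<theta> j) (N' \<theta> j)) * pri \<theta>)"
  proof (rule ext)
    fix \<theta>
    show "rel_post n y \<theta> = indicator (Theta k) \<theta> * (\<Prod>j\<in>{1..k+1}. Efac (D j) (al \<theta>0 j) n (a' \<theta> j) (N' \<theta> j)) * pri \<theta>"
    proof (cases "\<theta> \<in> Theta k")
      case True
      have "N' \<theta> j = N n y \<theta> j" if "j \<in> {1..k+1}" for j
        unfolding N'_def by (subst cnt_Sset[OF True that, symmetric]) simp
      moreover have "a' \<theta> j = al \<theta> j" if "j \<in> {1..k+1}" for j
        unfolding a'_def by (rule al_eq_ends[OF True that, symmetric])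
      ultimately have "rel_lik n y \<theta> = (\<Prod>j\<in>{1..k+1}. Efac (D j) (al \<theta>0 j) n (a' \<theta> j) (N' \<theta> j))"
        unfolding rel_lik_def by (intro prod.cong refl) simp
      then show ?thesis by (simp only: rel_post_def)
    next
      case False
      then have "indicator (Theta k) \<theta> = (0::real)" by simp
      then show ?thesis unfolding rel_post_def by (simp only: mult_zero_left)
    qed
  qed
  have "(\<lambda>\<theta>. indicator (Theta k) \<theta> * (\<Prod>j\<in>{1..k+1}. Efac (D j) (al \<theta>0 j) n (a' \<theta> j) (N' \<theta> j)) * pri \<theta>) \<in> borel_measurable (lebk k)"
    by (intro borel_measurable_times borel_measurable_prod borel_measurable_indicator Theta_sets pri_meas E)
  then show ?thesis by (simp only: eq)
qed

abbreviation "loc n y h \<equiv> (\<lambda>j\<in>{1..k}. qemp n y p j + h j / sqrt (real n))"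

lemma posterior_loc_eq:
  assumes n: "n \<ge> 1"
  shows "posterior_loc k p \<alpha> pri n y = density (lebk k)
     (\<lambda>h. ennreal (rel_post n y (loc n y h)) / (\<integral>\<^sup>+ h. ennreal (rel_post n y (loc n y h)) \<partial>lebk k))"
proof -
  have u: "ennreal (indicator (Theta k) \<theta> * lik k p \<alpha> n y \<theta> * pri \<theta>) = ennreal (lik_const n) * ennreal (rel_post n y \<theta>)" for \<theta>
    using lik_eq[OF _ n, of \<theta> y] lik_const_pos[OF n]
    by (cases "\<theta> \<in> Theta k") (simp_all add: rel_post_def mult_ac flip: ennreal_mult')
  show ?thesis
    unfolding posterior_loc_def posterior_def Let_def u
    by (rule distr_normalized_density_affine) (use n lik_const_pos[OF n] rel_post_measurable in auto)
qed

definition log_dens :: "(nat \<Rightarrow> real) \<Rightarrow> real" where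
  "log_dens h = (\<Sum>j\<in>{1..k+1}. - (slope k f0 \<theta>0 j * h j - slope k f0 \<theta>0 (j - 1) * h (j - 1))\<^sup>2 / (2 * D j))"

definition norm_const :: real where
  "norm_const = (2 * pi) powr (- real k / 2) * sqrt (detk k (SigmaInv k p f0 \<theta>0))"

lemma quadratic_eq_log_dens:
  "- (\<Sum>i\<in>{1..k}. \<Sum>j\<in>{1..k}. h i * SigmaInv k p f0 \<theta>0 i j * h j) / 2 = log_dens h"
  unfolding SigmaInv_quadratic[of k p f0 \<theta>0, OF k p_range p_mono f0_pos] log_dens_def
  by (simp only: sum_divide_distrib sum_negf[symmetric]) (simp add: sum_negf field_simps sum_divide_distrib)

lemma log_dens_measurable: "log_dens \<in> borel_measurable (lebk k)"
proof -
  have "log_dens = (\<lambda>h. - (\<Sum>i\<in>{1..k}. \<Sum>j\<in>{1..k}. h i * SigmaInv k p f0 \<theta>0 i j * h j) / 2)"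
    using quadratic_eq_log_dens by force
  also have "\<dots> \<in> borel_measurable (lebk k)"
    by (intro borel_measurable_divide borel_measurable_uminus borel_measurable_sum borel_measurable_times
      borel_measurable_const measurable_lebk_component)
  finally show ?thesis .
qed

lemma nn_integral_log_dens: "norm_const > 0" "(\<integral>\<^sup>+ h. ennreal (exp (log_dens h)) \<partial>lebk k) = ennreal (1 / norm_const)"
proof -
  have 1: "(\<integral>\<^sup>+ h. ennreal (norm_const * exp (log_dens h)) \<partial>lebk k) = 1"
    using nn_integral_SigmaInv_density[of k p f0 \<theta>0, OF k p_range p_mono f0_pos]
    unfolding quadratic_eq_log_dens norm_const_def .
  show pos: "norm_const > 0"
  \<comment> \<open>A constant that is not positive would make the integrand 0 under
    \<open>ennreal\<close>, against total mass 1.\<close>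
  proof (rule ccontr)
    assume "\<not> norm_const > 0"
    then have "ennreal (norm_const * exp (log_dens h)) = 0" for h
      by (simp add: ennreal_neg mult_nonpos_nonneg)
    with 1 show False by simp
  qed
  have "ennreal (exp (log_dens h)) = ennreal (1 / norm_const) * ennreal (norm_const * exp (log_dens h))" for h
    using pos by (simp flip: ennreal_mult)
  moreover have "(\<lambda>h. ennreal (norm_const * exp (log_dens h))) \<in> borel_measurable (lebk k)"
    using log_dens_measurable by measurable
  ultimately show "(\<integral>\<^sup>+ h. ennreal (exp (log_dens h)) \<partial>lebk k) = ennreal (1 / norm_const)"
    using 1 by (simp only: nn_integral_cmult mult_1_right)
qed

text \<open>The normal law in the normalised form used for the posterior. The factor
  \<open>pri \<theta>0\<close> is kept because the unnormalised densities converge with it.\<close>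

lemma normal_prec_eq:
  "normal_prec k (SigmaInv k p f0 \<theta>0) = density (lebk k)
     (\<lambda>h. ennreal (pri \<theta>0 * exp (log_dens h)) / ennreal (pri \<theta>0 / norm_const))"
  unfolding normal_prec_def quadratic_eq_log_dens norm_const_def[symmetric]
  using nn_integral_log_dens(1) pri_pos by (intro arg_cong2[where f = density] refl ext) (simp add: divide_ennreal mult.commute)


subsection \<open>Local behaviour of the true distribution and of the base measure\<close>

lemma F0_linear:
  assumes "e > 0"
  shows "\<exists>\<delta>>0. \<forall>j\<in>{1..k}. \<forall>x. \<bar>x - \<theta>0 j\<bar> \<le> \<delta> \<longrightarrow>
      \<bar>cdf P0 x - p j - f0 (\<theta>0 j) * (x - \<theta>0 j)\<bar> \<le> e * \<bar>x - \<theta>0 j\<bar>"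
proof (rule finite_min_radius)
  fix j assume j: "j \<in> {1..k}"
  have "(cdf P0 has_derivative (\<lambda>u. u * f0 (\<theta>0 j))) (at (\<theta>0 j))"
  proof -
    have "(\<lambda>u. u * f0 (\<theta>0 j)) = (*) (f0 (\<theta>0 j))" by (simp add: fun_eq_iff)
    then show ?thesis using F0_deriv by (simp add: has_field_derivative_def)
  qed
  then obtain d where "d > 0" and d: "\<And>x. norm (x - \<theta>0 j) < d \<Longrightarrow>
      norm (cdf P0 x - cdf P0 (\<theta>0 j) - (x - \<theta>0 j) * f0 (\<theta>0 j)) \<le> e * norm (x - \<theta>0 j)"
    using \<open>e > 0\<close> unfolding has_derivative_at_alt by meson
  then show "\<exists>\<delta>>0. \<forall>x. \<bar>x - \<theta>0 j\<bar> \<le> \<delta> \<longrightarrow>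
      \<bar>cdf P0 x - p j - f0 (\<theta>0 j) * (x - \<theta>0 j)\<bar> \<le> e * \<bar>x - \<theta>0 j\<bar>"
    using \<theta>0_quant j by (intro exI[of _ "d / 2"]) (auto simp: mult.commute)
next
  fix j \<delta> \<delta>' assume *: "\<forall>x. \<bar>x - \<theta>0 j\<bar> \<le> \<delta> \<longrightarrow>
      \<bar>cdf P0 x - p j - f0 (\<theta>0 j) * (x - \<theta>0 j)\<bar> \<le> e * \<bar>x - \<theta>0 j\<bar>" "\<delta>' \<le> \<delta>"
  show "\<forall>x. \<bar>x - \<theta>0 j\<bar> \<le> \<delta>' \<longrightarrow>
      \<bar>cdf P0 x - p j - f0 (\<theta>0 j) * (x - \<theta>0 j)\<bar> \<le> e * \<bar>x - \<theta>0 j\<bar>"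
    using order_trans[OF _ *(2)] *(1) by blast
qed simp

lemma F0_growth:
  "\<exists>c>0. \<exists>\<delta>>0. \<forall>j\<in>{1..k}. \<forall>x. \<bar>x - \<theta>0 j\<bar> \<le> \<delta> \<longrightarrow>
      (\<theta>0 j \<le> x \<longrightarrow> c * (x - \<theta>0 j) \<le> cdf P0 x - p j) \<and> (x \<le> \<theta>0 j \<longrightarrow> cdf P0 x - p j \<le> c * (x - \<theta>0 j))"
proof -
  \<comment> \<open>The tangent slopes are at least 2 c; a linearisation error of slope c leaves
    c.\<close>
  have "\<exists>c>0. \<forall>j\<in>{1..k}. 2 * c \<le> f0 (\<theta>0 j)"
  proof (rule finite_min_radius)
    show "\<exists>\<delta>>0. 2 * \<delta> \<le> f0 (\<theta>0 j)" if "j \<in> {1..k}" for j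
      using f0_pos that by (intro exI[of _ "f0 (\<theta>0 j) / 2"]) auto
  qed auto
  then obtain c where c: "c > 0" "\<And>j. j \<in> {1..k} \<Longrightarrow> 2 * c \<le> f0 (\<theta>0 j)" by auto
  obtain \<delta> where \<delta>: "\<delta> > 0" "\<And>j x. j \<in> {1..k} \<Longrightarrow> \<bar>x - \<theta>0 j\<bar> \<le> \<delta> \<Longrightarrow>
      \<bar>cdf P0 x - p j - f0 (\<theta>0 j) * (x - \<theta>0 j)\<bar> \<le> c * \<bar>x - \<theta>0 j\<bar>"
    using F0_linear[OF c(1)] by auto
  have "(\<theta>0 j \<le> x \<longrightarrow> c * (x - \<theta>0 j) \<le> cdf P0 x - p j) \<and> (x \<le> \<theta>0 j \<longrightarrow> cdf P0 x - p j \<le> c * (x - \<theta>0 j))"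
    if j: "j \<in> {1..k}" and x: "\<bar>x - \<theta>0 j\<bar> \<le> \<delta>" for j x
  proof (intro conjI impI)
    assume "\<theta>0 j \<le> x"
    then have "2 * c * (x - \<theta>0 j) \<le> f0 (\<theta>0 j) * (x - \<theta>0 j)" using c(2)[OF j] by (intro mult_right_mono) auto
    then show "c * (x - \<theta>0 j) \<le> cdf P0 x - p j" using \<delta>(2)[OF j x] \<open>\<theta>0 j \<le> x\<close> by (simp add: abs_le_iff)
  next
    assume "x \<le> \<theta>0 j"
    then have "f0 (\<theta>0 j) * (x - \<theta>0 j) \<le> 2 * c * (x - \<theta>0 j)" using c(2)[OF j] by (intro mult_right_mono_neg) auto
    then show "cdf P0 x - p j \<le> c * (x - \<theta>0 j)" using \<delta>(2)[OF j x] \<open>x \<le> \<theta>0 j\<close> by (simp add: abs_le_iff algebra_simps)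
  qed
  with c(1) \<delta>(1) show ?thesis by blast
qed

text \<open>Zero at the infinite end points, which do not move.\<close>

definition gap :: "(nat \<Rightarrow> real) \<Rightarrow> nat \<Rightarrow> real" where
  "gap \<theta> j = (if j \<in> {1..k} then \<bar>\<theta> j - \<theta>0 j\<bar> else 0)"

lemma al_lipschitz:
  "\<exists>L>0. \<exists>\<delta>>0. \<forall>\<theta>\<in>Theta k. (\<forall>j\<in>{1..k}. \<bar>\<theta> j - \<theta>0 j\<bar> \<le> \<delta>) \<longrightarrow>
     (\<forall>j\<in>{1..k+1}. \<bar>al \<theta> j - al \<theta>0 j\<bar> \<le> L * (gap \<theta> j + gap \<theta> (j - 1)))"
proof -
  let ?G = "\<lambda>x. measure \<alpha> {..x}"
  obtain L where L: "L > 0" "\<forall>j\<in>{1..k}. \<exists>\<delta>>0. \<forall>x x'. x < x' \<and> \<bar>x - \<theta>0 j\<bar> < \<delta> \<and> \<bar>x' - \<theta>0 j\<bar> < \<delta>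
                  \<longrightarrow> measure \<alpha> {x<..x'} \<le> L * \<bar>x - x'\<bar>" using Qn1 by auto
  have "\<exists>\<delta>>0. \<forall>j\<in>{1..k}. \<forall>x x'. x < x' \<and> \<bar>x - \<theta>0 j\<bar> < \<delta> \<and> \<bar>x' - \<theta>0 j\<bar> < \<delta>
                  \<longrightarrow> measure \<alpha> {x<..x'} \<le> L * \<bar>x - x'\<bar>"
  proof (rule finite_min_radius)
    fix j \<delta> \<delta>' assume *: "\<forall>x x'. x < x' \<and> \<bar>x - \<theta>0 j\<bar> < \<delta> \<and> \<bar>x' - \<theta>0 j\<bar> < \<delta>
        \<longrightarrow> measure \<alpha> {x<..x'} \<le> L * \<bar>x - x'\<bar>" "\<delta>' \<le> \<delta>"
    show "\<forall>x x'. x < x' \<and> \<bar>x - \<theta>0 j\<bar> < \<delta>' \<and> \<bar>x' - \<theta>0 j\<bar> < \<delta>'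
        \<longrightarrow> measure \<alpha> {x<..x'} \<le> L * \<bar>x - x'\<bar>"
      using order.strict_trans2[OF _ *(2)] *(1) by blast
  qed (use L(2) in blast)+
  then obtain \<delta> where \<delta>: "\<delta> > 0" "\<And>j x x'. j \<in> {1..k} \<Longrightarrow> x < x' \<Longrightarrow> \<bar>x - \<theta>0 j\<bar> < \<delta> \<Longrightarrow> \<bar>x' - \<theta>0 j\<bar> < \<delta>
                  \<Longrightarrow> measure \<alpha> {x<..x'} \<le> L * \<bar>x - x'\<bar>" by auto
  have G: "?G b - ?G a = measure \<alpha> {a<..b}" if "a \<le> b" for a b
  proof -
    have "{a<..b} = {..b} - {..a}" by auto
    then show ?thesis using that by (simp add: \<alpha>.finite_measure_Diff \<alpha>_sets)
  qed
  have step: "\<bar>?G x - ?G (\<theta>0 j)\<bar> \<le> L * \<bar>x - \<theta>0 j\<bar>" if j: "j \<in> {1..k}" and x: "\<bar>x - \<theta>0 j\<bar> < \<delta>" for j x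
  proof -
    consider "x = \<theta>0 j" | "x < \<theta>0 j" | "\<theta>0 j < x" by linarith
    then show ?thesis
    proof cases
      case 2
      then show ?thesis using \<delta>(2)[OF j 2] x \<delta>(1) G[of x "\<theta>0 j"] measure_nonneg[of \<alpha> "{x<..\<theta>0 j}"] by linarith
    next
      case 3
      then have "measure \<alpha> {\<theta>0 j<..x} \<le> L * \<bar>\<theta>0 j - x\<bar>" using x \<delta>(1) by (intro \<delta>(2)[OF j]) auto
      then show ?thesis using G[of "\<theta>0 j" x] 3 measure_nonneg[of \<alpha> "{\<theta>0 j<..x}"] by (simp add: abs_minus_commute)
    qed simp
  qed
  have "\<bar>al \<theta> j - al \<theta>0 j\<bar> \<le> L * (gap \<theta> j + gap \<theta> (j - 1))"
    if \<theta>: "\<theta> \<in> Theta k" "\<forall>j\<in>{1..k}. \<bar>\<theta> j - \<theta>0 j\<bar> \<le> \<delta> / 2" and j: "j \<in> {1..k+1}" for \<theta> j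
  proof -
    have e: "\<bar>ends k A ?G \<theta> i - ends k A ?G \<theta>0 i\<bar> \<le> L * gap \<theta> i" if i: "i \<le> k + 1" for i
    proof (cases "i \<in> {1..k}")
      case True
      have "\<bar>\<theta> i - \<theta>0 i\<bar> \<le> \<delta> / 2" using \<theta>(2) True by blast
      then have "\<bar>\<theta> i - \<theta>0 i\<bar> < \<delta>" using \<delta>(1) by linarith
      from step[OF True this] show ?thesis using True by (simp add: ends_def gap_def)
    next
      case False
      then show ?thesis using i by (auto simp: ends_def gap_def)
    qed
    have "j \<le> k + 1" "j - 1 \<le> k + 1" using j by auto
    from e[OF this(1)] e[OF this(2)] show ?thesis
      unfolding al_eq_ends[OF \<theta>(1) j] al_eq_ends[OF \<theta>0_Theta j] distrib_left by linarith
  qed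
  with L(1) \<delta>(1) show ?thesis by (intro exI[of _ L] conjI exI[of _ "\<delta> / 2"]) auto
qed

text \<open>(Qn3) speaks of bounded intervals. The two outer cells are increasing unions of such
  intervals and are reached by continuity from below.\<close>

lemma al_lower:
  "\<exists>M'>0. \<forall>\<theta>\<in>Theta k. \<forall>j\<in>{1..k+1}. M' * measure P0 (Sset k \<theta> j) \<le> al \<theta> j"
proof -
  obtain M' where M': "M' > 0" "\<And>a b. a < b \<Longrightarrow> measure \<alpha> {a<..b} \<ge> M' * measure P0 {a<..b}" using Qn3 by auto
  have lim: "M' * measure P0 (\<Union>i. S i) \<le> measure \<alpha> (\<Union>i. S i)"
    if S: "range S \<subseteq> sets borel" "incseq S" and ev: "eventually (\<lambda>i. M' * measure P0 (S i) \<le> measure \<alpha> (S i)) sequentially"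
    for S :: "nat \<Rightarrow> real set"
  proof (rule tendsto_le[OF sequentially_bot _ _ ev])
    show "(\<lambda>i. measure \<alpha> (S i)) \<longlonglongrightarrow> measure \<alpha> (\<Union>i. S i)"
      by (rule \<alpha>.finite_Lim_measure_incseq) (use S \<alpha>_sets in auto)
    show "(\<lambda>i. M' * measure P0 (S i)) \<longlonglongrightarrow> M' * measure P0 (\<Union>i. S i)"
      by (intro tendsto_mult_left P0.finite_Lim_measure_incseq) (use S in auto)
  qed
  have low: "M' * measure P0 {..b} \<le> measure \<alpha> {..b}" for b :: real
  proof -
    have U: "(\<Union>i. {- real i<..b}) = {..b}"
    proof (intro equalityI subsetI)
      fix x assume "x \<in> {..b}"
      moreover obtain i where "- x < real i" using reals_Archimedean2 by blast
      ultimately show "x \<in> (\<Union>i. {- real i<..b})" by (intro UN_I[of i]) auto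
    qed auto
    have "eventually (\<lambda>i. - b < real i) sequentially"
      using filterlim_real_sequentially unfolding filterlim_at_top_dense by blast
    then have "eventually (\<lambda>i. M' * measure P0 {- real i<..b} \<le> measure \<alpha> {- real i<..b}) sequentially"
      by eventually_elim (use M'(2) in auto)
    moreover have "incseq (\<lambda>i. {- real i<..b})" by (intro incseq_SucI) auto
    ultimately show ?thesis using lim[of "\<lambda>i. {- real i<..b}"] unfolding U by (simp add: image_subset_iff)
  qed
  have high: "M' * measure P0 {a<..} \<le> measure \<alpha> {a<..}" for a :: real
  proof -
    have U: "(\<Union>i. {a<..real i}) = {a<..}"
    proof (intro equalityI subsetI)
      fix x assume "x \<in> {a<..}"
      moreover obtain i where "x < real i" using reals_Archimedean2 by blast
      ultimately show "x \<in> (\<Union>i. {a<..real i})" by (intro UN_I[of i]) auto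
    qed auto
    have "eventually (\<lambda>i. a < real i) sequentially"
      using filterlim_real_sequentially unfolding filterlim_at_top_dense by blast
    then have "eventually (\<lambda>i. M' * measure P0 {a<..real i} \<le> measure \<alpha> {a<..real i}) sequentially"
      by eventually_elim (use M'(2) in auto)
    moreover have "incseq (\<lambda>i. {a<..real i})" by (intro incseq_SucI) auto
    ultimately show ?thesis using lim[of "\<lambda>i. {a<..real i}"] unfolding U by (simp add: image_subset_iff)
  qed
  have "M' * measure P0 (Sset k \<theta> j) \<le> al \<theta> j" if \<theta>: "\<theta> \<in> Theta k" and j: "j \<in> {1..k+1}" for \<theta> j
  proof -
    consider "j = 1" | "j = k + 1" "j \<noteq> 1" | "1 \<le> j - 1" "j - 1 < j" "j \<le> k" using j by force
    then show ?thesis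
    proof cases
      case 1
      then have "Sset k \<theta> j = {..\<theta> j}" using k by (auto simp: Sset_def)
      then show ?thesis using low by simp
    next
      case 2
      then have "Sset k \<theta> j = {\<theta> (j - 1)<..}" by (auto simp: Sset_def)
      then show ?thesis using high by simp
    next
      case 3
      then have "Sset k \<theta> j = {\<theta> (j - 1)<..\<theta> j}" by (auto simp: Sset_def)
      then show ?thesis using M'(2)[OF Theta_less[OF \<theta> 3]] by simp
    qed
  qed
  with M'(1) show ?thesis by blast
qed

subsection \<open>Empirical deviations and empirical quantiles\<close>

text \<open>Centred at the level \<open>p j\<close> rather than at F_0(x), so it is nondecreasing in
  x, and its change of sign locates the empirical quantile.\<close>

definition V :: "nat \<Rightarrow> (nat \<Rightarrow> real) \<Rightarrow> nat \<Rightarrow> real \<Rightarrow> real" where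
  "V n y j x = (real (cnt n y {..x}) - real n * p j) / sqrt (real n)"

text \<open>
  The only properties of the sample that are used; each holds with probability close to one
  for large \<open>K\<close> and fixed \<open>\<eta>\<close> as \<open>n\<close> grows.
\<close>
definition good :: "nat \<Rightarrow> (nat \<Rightarrow> real) \<Rightarrow> real \<Rightarrow> real \<Rightarrow> bool" where
  "good n y K \<eta> \<longleftrightarrow> (\<forall>j\<in>{1..k}. \<bar>real (cnt n y {..\<theta>0 j}) - real n * p j\<bar> \<le> K * sqrt (real n)) \<and>
     (\<forall>j\<in>{1..k}. \<forall>h. \<bar>h\<bar> \<le> sqrt (real n) \<longrightarrow>
        \<bar>incr_dev P0 n y (\<theta>0 j) (\<theta>0 j + h / sqrt (real n))\<bar> \<le> sqrt (real n) * \<eta> * (1 + \<bar>h\<bar>)) \<and>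
     prior_weight P0 k pri n y \<le> ennreal K"

lemma V_mono: "x \<le> x' \<Longrightarrow> V n y j x \<le> V n y j x'"
  unfolding V_def by (intro divide_right_mono diff_right_mono of_nat_mono cnt_mono) auto

lemma V_center: "good n y K \<eta> \<Longrightarrow> n \<ge> 1 \<Longrightarrow> j \<in> {1..k} \<Longrightarrow> \<bar>V n y j (\<theta>0 j)\<bar> \<le> K"
  unfolding good_def V_def by (simp add: pos_divide_le_eq)

lemma V_near:
  assumes "good n y K \<eta>" "n \<ge> 1" "j \<in> {1..k}" "\<bar>h\<bar> \<le> sqrt (real n)"
  shows "\<bar>V n y j (\<theta>0 j + h / sqrt (real n)) - sqrt (real n) * (cdf P0 (\<theta>0 j + h / sqrt (real n)) - p j) - V n y j (\<theta>0 j)\<bar>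
     \<le> \<eta> * (1 + \<bar>h\<bar>)"
proof -
  define s where "s = sqrt (real n)"
  have s: "s > 0" "real n = s * s" using assms(2) by (auto simp: s_def)
  have "V n y j (\<theta>0 j + h / s) - s * (cdf P0 (\<theta>0 j + h / s) - p j) - V n y j (\<theta>0 j)
      = incr_dev P0 n y (\<theta>0 j) (\<theta>0 j + h / s) / s"
    using s(1) \<theta>0_quant assms(3) unfolding V_def incr_dev_def[OF P0] s_def[symmetric] s(2) by (simp add: field_simps)
  moreover have "\<bar>incr_dev P0 n y (\<theta>0 j) (\<theta>0 j + h / s)\<bar> \<le> s * \<eta> * (1 + \<bar>h\<bar>)"
    using assms unfolding good_def s_def by blast
  ultimately show ?thesis using s(1) unfolding s_def[symmetric] by (simp add: pos_divide_le_eq mult_ac)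
qed

text \<open>The fluctuation \<eta> (1 + |h|) uses up at most half of the slope c and a constant 1;
  the deviation at \<theta>0 costs K.\<close>

lemma V_growth:
  assumes g: "good n y K \<eta>" "n \<ge> 1" and \<eta>: "0 \<le> \<eta>" "\<eta> \<le> 1" "\<eta> \<le> c / 2" and c: "c > 0"
    and \<delta>: "\<delta> \<le> 1" "\<And>j x. j \<in> {1..k} \<Longrightarrow> \<bar>x - \<theta>0 j\<bar> \<le> \<delta> \<Longrightarrow>
      (\<theta>0 j \<le> x \<longrightarrow> c * (x - \<theta>0 j) \<le> cdf P0 x - p j) \<and> (x \<le> \<theta>0 j \<longrightarrow> cdf P0 x - p j \<le> c * (x - \<theta>0 j))"
    and j: "j \<in> {1..k}" and x: "\<bar>x - \<theta>0 j\<bar> \<le> \<delta>"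
  shows "\<theta>0 j \<le> x \<Longrightarrow> c / 2 * (sqrt (real n) * (x - \<theta>0 j)) - (K + 1) \<le> V n y j x"
    "x \<le> \<theta>0 j \<Longrightarrow> V n y j x \<le> c / 2 * (sqrt (real n) * (x - \<theta>0 j)) + (K + 1)"
proof -
  define s where "s = sqrt (real n)"
  have s: "s > 0" using g(2) by (auto simp: s_def)
  define h where "h = s * (x - \<theta>0 j)"
  have xh: "x = \<theta>0 j + h / s" using s by (simp add: h_def)
  have "\<bar>h\<bar> \<le> s * 1" unfolding h_def abs_mult using x \<delta>(1) s by (intro mult_mono) auto
  then have near: "\<bar>V n y j x - s * (cdf P0 x - p j) - V n y j (\<theta>0 j)\<bar> \<le> \<eta> * (1 + \<bar>h\<bar>)"
    using V_near[OF g j, of h] by (simp add: s_def[symmetric] xh[symmetric])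
  have "\<eta> * (1 + \<bar>h\<bar>) \<le> 1 + c / 2 * \<bar>h\<bar>"
    using mult_right_mono[OF \<eta>(3), of "\<bar>h\<bar>"] \<eta>(2) by (simp add: distrib_left)
  with near V_center[OF g j]
  have b: "\<bar>V n y j x - s * (cdf P0 x - p j)\<bar> \<le> K + 1 + c / 2 * \<bar>h\<bar>" by linarith
  show "c / 2 * (sqrt (real n) * (x - \<theta>0 j)) - (K + 1) \<le> V n y j x" if le: "\<theta>0 j \<le> x"
  proof -
    have "s * (c * (x - \<theta>0 j)) \<le> s * (cdf P0 x - p j)"
      using \<delta>(2)[OF j x] le s by (intro mult_left_mono) auto
    then have "c * h \<le> s * (cdf P0 x - p j)" by (simp add: h_def mult_ac)
    moreover have "h \<ge> 0" using le s by (simp add: h_def)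
    ultimately show ?thesis using b unfolding s_def[symmetric] h_def[symmetric] by (simp add: abs_le_iff)
  qed
  show "V n y j x \<le> c / 2 * (sqrt (real n) * (x - \<theta>0 j)) + (K + 1)" if le: "x \<le> \<theta>0 j"
  proof -
    have "s * (cdf P0 x - p j) \<le> s * (c * (x - \<theta>0 j))"
      using \<delta>(2)[OF j x] le s by (intro mult_left_mono) auto
    then have "s * (cdf P0 x - p j) \<le> c * h" by (simp add: h_def mult_ac)
    moreover have "h \<le> 0" using le s by (simp add: h_def mult_nonneg_nonpos)
    ultimately show ?thesis using b unfolding s_def[symmetric] h_def[symmetric] by (simp add: abs_le_iff)
  qed
qed

text \<open>\<open>qemp\<close> is the infimum of the points with nonnegative \<open>V\<close>. This
  set contains the sample maximum, and because p j > 0 it is bounded below by the sample minimum, so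
  the infimum is genuine.\<close>

lemma qemp_bounds:
  assumes n: "n \<ge> 1" and j: "j \<in> {1..k}"
  shows "V n y j x \<ge> 0 \<Longrightarrow> qemp n y p j \<le> x" "V n y j x < 0 \<Longrightarrow> x \<le> qemp n y p j"
proof -
  define Q where "Q = {x. real (cnt n y {..x}) / real n \<ge> p j}"
  have Q: "x \<in> Q \<longleftrightarrow> V n y j x \<ge> 0" for x
    using n by (simp add: Q_def V_def zero_le_divide_iff pos_le_divide_eq mult.commute)
  have q: "qemp n y p j = Inf Q" by (simp add: qemp_def Q_def)
  have fin: "finite (y ` {1..n})" by simp
  have "Max (y ` {1..n}) \<in> Q"
  proof -
    have "{i \<in> {1..n}. y i \<in> {..Max (y ` {1..n})}} = {1..n}" by auto
    then have "cnt n y {..Max (y ` {1..n})} = n" by (simp add: cnt_def)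
    then show ?thesis using n p_range j by (auto simp: Q_def less_imp_le)
  qed
  then have ne: "Q \<noteq> {}" by auto
  have bdd: "bdd_below Q"
  proof (rule bdd_belowI)
    fix x assume "x \<in> Q"
    then have "real (cnt n y {..x}) / real n > 0" using p_range j by (auto simp: Q_def intro: less_le_trans)
    then have "cnt n y {..x} > 0" using n by (simp add: zero_less_divide_iff)
    then obtain i where "i \<in> {1..n}" "y i \<le> x" unfolding cnt_def by (auto simp: card_gt_0_iff)
    then show "Min (y ` {1..n}) \<le> x" using fin by (meson Min_le dual_order.trans imageI)
  qed
  show "qemp n y p j \<le> x" if "V n y j x \<ge> 0"
    unfolding q using bdd that Q by (intro cInf_lower) auto
  show "x \<le> qemp n y p j" if V: "V n y j x < 0"
    unfolding q
  proof (rule cInf_greatest[OF ne])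
    fix x' assume "x' \<in> Q"
    then have "V n y j x < V n y j x'" using V Q by (auto intro: less_le_trans)
    then show "x \<le> x'" using V_mono[of x' x n y j] by linarith
  qed
qed

end

section \<open>Sequences of well-behaved samples\<close>

text \<open>K stays fixed while the tolerance 1 / (m + 1) shrinks. Such sequences are the candidates
  for a counterexample to the bound that is uniform over good samples.\<close>

locale good_sequence = quantile_model +
  fixes n :: "nat \<Rightarrow> nat" and y :: "nat \<Rightarrow> nat \<Rightarrow> real" and K :: real
  assumes K: "K > 0" and n_ge: "\<And>m. n m \<ge> m + 1"
    and good: "\<And>m. good (n m) (y m) K (1 / (real m + 1))"
begin

interpretation P0: real_distribution P0 by (rule P0)

definition s :: "nat \<Rightarrow> real" where "s m = sqrt (real (n m))"

lemma n1: "n m \<ge> 1" using n_ge[of m] by simp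

lemma s_pos: "s m \<ge> 1" "s m > 0" and s_sq: "s m * s m = real (n m)"
  using n1[of m] by (auto simp: s_def)

lemma n_at_top: "filterlim n at_top sequentially"
proof (rule filterlim_at_top_mono[OF filterlim_ident])
  show "eventually (\<lambda>m. m \<le> n m) sequentially" using add_leD1[OF n_ge] by (intro always_eventually allI)
qed

lemma real_n_at_top: "filterlim (\<lambda>m. real (n m)) at_top sequentially"
  by (rule filterlim_compose[OF filterlim_real_sequentially n_at_top])

lemma s_at_top: "filterlim s at_top sequentially"
  unfolding s_def by (rule filterlim_compose[OF sqrt_at_top real_n_at_top])

lemma eventually_s_ge: "eventually (\<lambda>m. X \<le> s m) sequentially"
  using s_at_top unfolding filterlim_at_top by blast

lemma inv_s_tendsto: "(\<lambda>m. 1 / s m) \<longlonglongrightarrow> 0"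
  using s_at_top by (intro tendsto_divide_0[OF tendsto_const] filterlim_at_top_imp_at_infinity)

text \<open>Differentiability of the cdf contributes f0 x, and the tolerance on the increments of
  the empirical process tends to 0. The argument x depends on m because it has to include the
  fluctuating position of the empirical quantile.\<close>

lemma V_linearisation:
  assumes j: "j \<in> {1..k}" and x: "eventually (\<lambda>m. \<bar>x m\<bar> \<le> X) sequentially"
  shows "(\<lambda>m. V (n m) (y m) j (\<theta>0 j + x m / s m) - V (n m) (y m) j (\<theta>0 j) - f0 (\<theta>0 j) * x m) \<longlonglongrightarrow> 0"
proof (rule tendstoI)
  fix e :: real assume e: "e > 0"
  define Y where "Y = \<bar>X\<bar>"
  have Y: "Y \<ge> 0" by (simp add: Y_def)
  define e' where "e' = e / (4 * (Y + 1))"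
  have e': "e' > 0" "e' * Y \<le> e / 4" using e Y by (auto simp: e'_def field_simps)
  obtain \<delta> where \<delta>: "\<delta> > 0" "\<And>j x. j \<in> {1..k} \<Longrightarrow> \<bar>x - \<theta>0 j\<bar> \<le> \<delta> \<Longrightarrow>
      \<bar>cdf P0 x - p j - f0 (\<theta>0 j) * (x - \<theta>0 j)\<bar> \<le> e' * \<bar>x - \<theta>0 j\<bar>"
    using F0_linear[OF e'(1)] by auto
  have "(\<lambda>m. 1 / (real m + 1) * (1 + Y)) \<longlonglongrightarrow> 0" by real_asymp
  then have ev: "eventually (\<lambda>m. 1 / (real m + 1) * (1 + Y) < e / 4) sequentially"
    by (rule order_tendstoD(2)) (use e in simp)
  show "eventually (\<lambda>m. dist (V (n m) (y m) j (\<theta>0 j + x m / s m) - V (n m) (y m) j (\<theta>0 j) - f0 (\<theta>0 j) * x m) 0 < e) sequentially"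
    using x ev eventually_s_ge[of Y] eventually_s_ge[of "Y / \<delta>"]
  proof eventually_elim
    case (elim m)
    have xY: "\<bar>x m\<bar> \<le> Y" using elim(1) by (simp add: Y_def)
    have 1: "\<bar>V (n m) (y m) j (\<theta>0 j + x m / s m) - s m * (cdf P0 (\<theta>0 j + x m / s m) - p j) - V (n m) (y m) j (\<theta>0 j)\<bar>
        \<le> 1 / (real m + 1) * (1 + \<bar>x m\<bar>)"
      using V_near[OF good n1 j, of "x m" m] xY elim(3) by (simp add: s_def)
    also have "\<dots> \<le> 1 / (real m + 1) * (1 + Y)" using xY by (intro mult_left_mono) auto
    also have "\<dots> < e / 4" by (rule elim(2))
    finally have a: "\<bar>V (n m) (y m) j (\<theta>0 j + x m / s m) - s m * (cdf P0 (\<theta>0 j + x m / s m) - p j) - V (n m) (y m) j (\<theta>0 j)\<bar> < e / 4" .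
    have "\<bar>x m\<bar> / s m \<le> \<delta>" using elim(4) xY \<delta>(1) s_pos[of m] by (simp add: divide_le_eq mult.commute)
    then have "\<bar>(\<theta>0 j + x m / s m) - \<theta>0 j\<bar> \<le> \<delta>" using s_pos[of m] by simp
    from \<delta>(2)[OF j this]
    have "\<bar>cdf P0 (\<theta>0 j + x m / s m) - p j - f0 (\<theta>0 j) * (x m / s m)\<bar> \<le> e' * \<bar>x m / s m\<bar>" by simp
    from mult_left_mono[OF this, of "s m"] s_pos[of m]
    have "\<bar>s m * (cdf P0 (\<theta>0 j + x m / s m) - p j - f0 (\<theta>0 j) * (x m / s m))\<bar> \<le> s m * (e' * \<bar>x m / s m\<bar>)"
      by (simp add: abs_mult)
    also have "\<dots> = e' * \<bar>x m\<bar>" using s_pos[of m] by simp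
    also have "\<dots> \<le> e / 4" by (rule order_trans[OF mult_left_mono[OF xY] e'(2)]) (use e' in simp)
    also have "s m * (cdf P0 (\<theta>0 j + x m / s m) - p j - f0 (\<theta>0 j) * (x m / s m))
        = s m * (cdf P0 (\<theta>0 j + x m / s m) - p j) - f0 (\<theta>0 j) * x m"
      using s_pos[of m] by (simp add: right_diff_distrib)
    finally have b: "\<bar>s m * (cdf P0 (\<theta>0 j + x m / s m) - p j) - f0 (\<theta>0 j) * x m\<bar> \<le> e / 4" .
    from a b e show ?case unfolding dist_real_def by linarith
  qed
qed

definition b :: "nat \<Rightarrow> nat \<Rightarrow> real" where
  "b j m = s m * (qemp (n m) (y m) p j - \<theta>0 j)"

text \<open>The Bahadur representation of the empirical quantile. With W the value of
  \<open>V\<close> at \<open>\<theta>0 j\<close> and f the density there, \<open>V\<close> at the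
  displacements - W / f + e / 2 and - W / f - e / 2 tends to f e / 2 and - f e / 2; its signs there
  enclose the quantile.\<close>

lemma b_tendsto:
  assumes j: "j \<in> {1..k}"
  shows "(\<lambda>m. b j m + V (n m) (y m) j (\<theta>0 j) / f0 (\<theta>0 j)) \<longlonglongrightarrow> 0"
proof (rule tendstoI)
  fix e :: real assume e: "e > 0"
  define f where "f = f0 (\<theta>0 j)"
  have f: "f > 0" using f0_pos j by (simp add: f_def)
  have Vb: "\<bar>V (n m) (y m) j (\<theta>0 j) / f\<bar> \<le> K / f" for m
    using V_center[OF good n1 j, of m] f by (simp add: divide_right_mono)
  have lim: "(\<lambda>m. V (n m) (y m) j (\<theta>0 j + (- V (n m) (y m) j (\<theta>0 j) / f + c) / s m)) \<longlonglongrightarrow> f * c" for c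
  proof -
    have bd: "\<bar>- V (n m) (y m) j (\<theta>0 j) / f + c\<bar> \<le> K / f + \<bar>c\<bar>" for m
      using Vb[of m] unfolding minus_divide_left[symmetric] by linarith
    have "(\<lambda>m. V (n m) (y m) j (\<theta>0 j + (- V (n m) (y m) j (\<theta>0 j) / f + c) / s m) - V (n m) (y m) j (\<theta>0 j)
        - f0 (\<theta>0 j) * (- V (n m) (y m) j (\<theta>0 j) / f + c)) \<longlonglongrightarrow> 0"
      by (rule V_linearisation[OF j always_eventually]) (use bd in blast)
    then have "(\<lambda>m. V (n m) (y m) j (\<theta>0 j + (- V (n m) (y m) j (\<theta>0 j) / f + c) / s m) - f * c) \<longlonglongrightarrow> 0"
      using f by (simp add: f_def[symmetric] algebra_simps)
    then show ?thesis by (simp add: LIM_zero_iff)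
  qed
  have "eventually (\<lambda>m. 0 < V (n m) (y m) j (\<theta>0 j + (- V (n m) (y m) j (\<theta>0 j) / f + e / 2) / s m)) sequentially"
    by (rule order_tendstoD(1)[OF lim]) (use f e in simp)
  moreover have "eventually (\<lambda>m. V (n m) (y m) j (\<theta>0 j + (- V (n m) (y m) j (\<theta>0 j) / f + (- e / 2)) / s m) < 0) sequentially"
    by (rule order_tendstoD(2)[OF lim]) (use f e in \<open>simp add: mult_pos_neg\<close>)
  ultimately show "eventually (\<lambda>m. dist (b j m + V (n m) (y m) j (\<theta>0 j) / f0 (\<theta>0 j)) 0 < e) sequentially"
  proof eventually_elim
    case (elim m)
    define W where "W = V (n m) (y m) j (\<theta>0 j) / f"
    have "qemp (n m) (y m) p j \<le> \<theta>0 j + (- W + e / 2) / s m"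
      using qemp_bounds(1)[OF n1 j] elim(1) by (simp add: W_def)
    then have "qemp (n m) (y m) p j - \<theta>0 j \<le> (- W + e / 2) / s m" by simp
    then have 1: "b j m \<le> - W + e / 2" using s_pos[of m] by (simp add: b_def pos_le_divide_eq mult.commute)
    have "\<theta>0 j + (- W + (- e / 2)) / s m \<le> qemp (n m) (y m) p j"
      using qemp_bounds(2)[OF n1 j] elim(2) by (simp add: W_def)
    then have "(- W + (- e / 2)) / s m \<le> qemp (n m) (y m) p j - \<theta>0 j" by simp
    then have "- W + (- e / 2) \<le> b j m" using s_pos[of m] by (simp add: b_def pos_divide_le_eq mult.commute)
    with 1 e show ?case by (simp add: dist_real_def W_def f_def abs_less_iff)
  qed
qed

lemma b_bounded: "\<exists>B\<ge>0. eventually (\<lambda>m. \<forall>j\<in>{1..k}. \<bar>b j m\<bar> \<le> B) sequentially"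
proof -
  define B where "B = (\<Sum>j\<in>{1..k}. K / f0 (\<theta>0 j)) + 1"
  have nn: "K / f0 (\<theta>0 j) \<ge> 0" if "j \<in> {1..k}" for j using f0_pos K that by (simp add: less_imp_le)
  have "eventually (\<lambda>m. \<forall>j\<in>{1..k}. \<bar>b j m\<bar> \<le> B) sequentially"
  proof (rule eventually_ball_finite, simp, rule ballI)
    fix j assume j: "j \<in> {1..k}"
    have "K / f0 (\<theta>0 j) \<le> (\<Sum>j\<in>{1..k}. K / f0 (\<theta>0 j))" using nn j by (intro member_le_sum) auto
    moreover have "eventually (\<lambda>m. \<bar>b j m + V (n m) (y m) j (\<theta>0 j) / f0 (\<theta>0 j)\<bar> < 1) sequentially"
      using tendstoD[OF b_tendsto[OF j], of 1] by (simp add: dist_real_def)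
    moreover have "\<bar>V (n m) (y m) j (\<theta>0 j) / f0 (\<theta>0 j)\<bar> \<le> K / f0 (\<theta>0 j)" for m
    proof -
      have "f0 (\<theta>0 j) > 0" using f0_pos j by blast
      then show ?thesis using V_center[OF good n1 j, of m] by (simp add: abs_divide divide_right_mono)
    qed
    ultimately have *: "eventually (\<lambda>m. \<bar>b j m + V (n m) (y m) j (\<theta>0 j) / f0 (\<theta>0 j)\<bar> < 1) sequentially"
      "\<And>m. \<bar>V (n m) (y m) j (\<theta>0 j) / f0 (\<theta>0 j)\<bar> + 1 \<le> B"
      unfolding B_def by (auto intro: order_trans)
    show "eventually (\<lambda>m. \<bar>b j m\<bar> \<le> B) sequentially"
      using *(1)
    proof eventually_elim
      case (elim m)
      then show ?case using *(2)[of m] by linarith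
    qed
  qed
  moreover have "B \<ge> 0"
  proof -
    have "(\<Sum>j\<in>{1..k}. K / f0 (\<theta>0 j)) \<ge> 0" by (rule sum_nonneg) (rule nn)
    then show ?thesis unfolding B_def by linarith
  qed
  ultimately show ?thesis by blast
qed

section \<open>Limits at a fixed local parameter h\<close>

abbreviation "pt m h \<equiv> loc (n m) (y m) h"

lemma pt_eq: "j \<in> {1..k} \<Longrightarrow> pt m h j = \<theta>0 j + (b j m + h j) / s m"
  using s_pos[of m] by (simp add: b_def s_def[symmetric] field_simps)

text \<open>The sample-dependent value of \<open>V\<close> at \<open>\<theta>0 j\<close> cancels
  against the linear term produced by \<open>b j\<close>. This is why centring at the empirical
  quantiles gives a limit free of the sample.\<close>

lemma V_pt_tendsto:
  assumes j: "j \<in> {1..k}"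
  shows "(\<lambda>m. V (n m) (y m) j (pt m h j)) \<longlonglongrightarrow> f0 (\<theta>0 j) * h j"
proof -
  define f where "f = f0 (\<theta>0 j)"
  have f: "f > 0" using f0_pos j by (simp add: f_def)
  obtain B where B: "eventually (\<lambda>m. \<forall>j\<in>{1..k}. \<bar>b j m\<bar> \<le> B) sequentially" using b_bounded by auto
  have "eventually (\<lambda>m. \<bar>b j m + h j\<bar> \<le> B + \<bar>h j\<bar>) sequentially"
    using B by eventually_elim (use j in \<open>force intro: order_trans[OF abs_triangle_ineq]\<close>)
  from V_linearisation[OF j this]
  have 1: "(\<lambda>m. V (n m) (y m) j (pt m h j) - V (n m) (y m) j (\<theta>0 j) - f * (b j m + h j)) \<longlonglongrightarrow> 0"
    using j by (simp only: pt_eq[OF j] f_def)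
  have 2: "(\<lambda>m. f * (b j m + V (n m) (y m) j (\<theta>0 j) / f)) \<longlonglongrightarrow> f * 0"
    unfolding f_def by (intro tendsto_mult_left b_tendsto j)
  from tendsto_add[OF tendsto_add[OF 1 2] tendsto_const[of "f * h j"]]
  show ?thesis using f by (simp add: f_def[symmetric] algebra_simps)
qed

lemma pt_tendsto:
  assumes j: "j \<in> {1..k}"
  shows "(\<lambda>m. pt m h j) \<longlonglongrightarrow> \<theta>0 j"
    and "\<exists>C. eventually (\<lambda>m. \<bar>pt m h j - \<theta>0 j\<bar> \<le> C * (1 / s m)) sequentially"
proof -
  obtain B where B: "eventually (\<lambda>m. \<forall>j\<in>{1..k}. \<bar>b j m\<bar> \<le> B) sequentially" using b_bounded by auto
  have ev: "eventually (\<lambda>m. \<bar>pt m h j - \<theta>0 j\<bar> \<le> (B + \<bar>h j\<bar>) * (1 / s m)) sequentially"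
    using B
  proof eventually_elim
    case (elim m)
    then have "\<bar>b j m + h j\<bar> \<le> B + \<bar>h j\<bar>" using j by (force intro: order_trans[OF abs_triangle_ineq])
    moreover have "\<bar>pt m h j - \<theta>0 j\<bar> = \<bar>b j m + h j\<bar> * (1 / s m)"
      unfolding pt_eq[OF j] using s_pos[of m] by (simp add: abs_divide)
    ultimately show ?case using s_pos[of m] by (simp only:) (intro mult_right_mono, auto)
  qed
  then show "\<exists>C. eventually (\<lambda>m. \<bar>pt m h j - \<theta>0 j\<bar> \<le> C * (1 / s m)) sequentially" by blast
  have "(\<lambda>m. pt m h j - \<theta>0 j) \<longlonglongrightarrow> 0"
    by (rule Lim_null_comparison[OF _ tendsto_mult_right_zero[OF inv_s_tendsto]]) (use ev in simp)
  then show "(\<lambda>m. pt m h j) \<longlonglongrightarrow> \<theta>0 j" by (simp add: LIM_zero_iff)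
qed

lemma eventually_close:
  assumes "\<delta> > 0"
  shows "eventually (\<lambda>m. \<forall>j\<in>{1..k}. \<bar>pt m h j - \<theta>0 j\<bar> < \<delta>) sequentially"
proof (rule eventually_ball_finite, simp, rule ballI)
  fix j assume "j \<in> {1..k}"
  from tendstoD[OF pt_tendsto(1)[OF this, of h] assms]
  show "eventually (\<lambda>m. \<bar>pt m h j - \<theta>0 j\<bar> < \<delta>) sequentially" by (simp add: dist_real_def)
qed

lemma close_imp_Theta:
  "\<exists>\<delta>>0. \<forall>\<theta>. \<theta> \<in> extensional {1..k} \<and> (\<forall>j\<in>{1..k}. \<bar>\<theta> j - \<theta>0 j\<bar> \<le> \<delta>) \<longrightarrow> \<theta> \<in> Theta k"
proof -
  \<comment> \<open>Neighbours at distance at least 3 \<delta> stay ordered when each moves by at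
    most \<delta>.\<close>
  have "\<exists>\<delta>>0. \<forall>j\<in>{1..<k}. 3 * \<delta> \<le> \<theta>0 (Suc j) - \<theta>0 j"
  proof (rule finite_min_radius)
    show "\<exists>\<delta>>0. 3 * \<delta> \<le> \<theta>0 (Suc j) - \<theta>0 j" if "j \<in> {1..<k}" for j
      using \<theta>0_Theta that by (intro exI[of _ "(\<theta>0 (Suc j) - \<theta>0 j) / 3"]) (auto simp: Theta_def)
  qed auto
  then obtain \<delta> where \<delta>: "\<delta> > 0" "\<And>j. j \<in> {1..<k} \<Longrightarrow> 3 * \<delta> \<le> \<theta>0 (Suc j) - \<theta>0 j" by auto
  have "\<theta> j < \<theta> (Suc j)" if "\<forall>j\<in>{1..k}. \<bar>\<theta> j - \<theta>0 j\<bar> \<le> \<delta>" "1 \<le> j" "j < k" for \<theta> j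
  proof -
    have "\<bar>\<theta> j - \<theta>0 j\<bar> \<le> \<delta>" "\<bar>\<theta> (Suc j) - \<theta>0 (Suc j)\<bar> \<le> \<delta>" using that by auto
    moreover have "3 * \<delta> \<le> \<theta>0 (Suc j) - \<theta>0 j" using \<delta>(2) that by auto
    ultimately show ?thesis using \<delta>(1) by linarith
  qed
  with \<delta>(1) show ?thesis by (auto simp: Theta_def)
qed

lemma eventually_pt_Theta: "eventually (\<lambda>m. pt m h \<in> Theta k) sequentially"
proof -
  obtain \<delta> where \<delta>: "\<delta> > 0" "\<And>\<theta>. \<theta> \<in> extensional {1..k} \<Longrightarrow> (\<forall>j\<in>{1..k}. \<bar>\<theta> j - \<theta>0 j\<bar> \<le> \<delta>) \<Longrightarrow> \<theta> \<in> Theta k"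
    using close_imp_Theta by blast
  show ?thesis
    using eventually_close[OF \<delta>(1), of h]
  proof eventually_elim
    case (elim m)
    then show ?case by (intro \<delta>(2)) (auto intro: less_imp_le)
  qed
qed

text \<open>At the infinite end points the empirical distribution function equals its target 0 or 1
  exactly, hence the value 0 there.\<close>

definition Vend :: "nat \<Rightarrow> (nat \<Rightarrow> real) \<Rightarrow> nat \<Rightarrow> real" where
  "Vend m \<theta> j = (if j \<in> {1..k} then V (n m) (y m) j (\<theta> j) else 0)"

lemma count_deviation:
  assumes \<theta>: "\<theta> \<in> Theta k" and j: "j \<in> {1..k+1}"
  shows "(real (N (n m) (y m) \<theta> j) - real (n m) * D j) / s m = Vend m \<theta> j - Vend m \<theta> (j - 1)"
proof -
  have e: "ends k (real (n m)) (\<lambda>x. real (cnt (n m) (y m) {..x})) \<theta> i = real (n m) * pext k p i + s m * Vend m \<theta> i"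
    if "i \<le> k + 1" for i
    using that s_pos[of m] by (auto simp: ends_def pext_def Vend_def V_def s_def[symmetric])
  have "j \<le> k + 1" "j - 1 \<le> k + 1" using j by auto
  then have "real (N (n m) (y m) \<theta> j) - real (n m) * D j = s m * (Vend m \<theta> j - Vend m \<theta> (j - 1))"
    unfolding cnt_Sset[OF \<theta> j] dp_def using e[of j] e[of "j - 1"] by (simp add: algebra_simps)
  then show ?thesis using s_pos[of m] by simp
qed

lemma Vend_pt_tendsto: "j \<le> k + 1 \<Longrightarrow> (\<lambda>m. Vend m (pt m h) j) \<longlonglongrightarrow> slope k f0 \<theta>0 j * h j"
proof (cases "j \<in> {1..k}")
  case True
  then show ?thesis unfolding Vend_def slope_def if_P[OF True] by (rule V_pt_tendsto)
next
  case False
  then show ?thesis unfolding Vend_def slope_def if_not_P[OF False] by simp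
qed

text \<open>Displacements of order 1 / sqrt n change the masses by at most the same order, and ln n
  / sqrt n tends to 0. The logarithm is the one demanded by \<open>Efac_tendsto\<close>.\<close>

lemma al_pt_tendsto:
  assumes j: "j \<in> {1..k+1}"
  shows "(\<lambda>m. (al (pt m h) j - al \<theta>0 j) * ln (real (n m))) \<longlonglongrightarrow> 0"
proof -
  obtain L \<delta> where L: "L > 0" "\<delta> > 0" "\<And>\<theta> j. \<theta> \<in> Theta k \<Longrightarrow> (\<forall>j\<in>{1..k}. \<bar>\<theta> j - \<theta>0 j\<bar> \<le> \<delta>) \<Longrightarrow> j \<in> {1..k+1} \<Longrightarrow>
     \<bar>al \<theta> j - al \<theta>0 j\<bar> \<le> L * (gap \<theta> j + gap \<theta> (j - 1))"
    using al_lipschitz by metis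
  have gb: "\<exists>C. eventually (\<lambda>m. gap (pt m h) i \<le> C * (1 / s m)) sequentially" for i
    using pt_tendsto(2)[of i h] by (cases "i \<in> {1..k}") (auto simp: gap_def intro: exI[of _ 0])
  obtain C1 where C1: "eventually (\<lambda>m. gap (pt m h) j \<le> C1 * (1 / s m)) sequentially" using gb by blast
  obtain C2 where C2: "eventually (\<lambda>m. gap (pt m h) (j - 1) \<le> C2 * (1 / s m)) sequentially" using gb by blast
  have "((\<lambda>x::real. 1 / sqrt x * ln x) \<longlongrightarrow> 0) at_top" by real_asymp
  from filterlim_compose[OF this real_n_at_top]
  have "(\<lambda>m. 1 / s m * ln (real (n m))) \<longlonglongrightarrow> 0" by (simp add: s_def)
  then have "(\<lambda>m. L * (C1 + C2) * (1 / s m * ln (real (n m)))) \<longlonglongrightarrow> 0" by (rule tendsto_mult_right_zero)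
  then show ?thesis
  proof (rule Lim_null_comparison[rotated])
    show "eventually (\<lambda>m. norm ((al (pt m h) j - al \<theta>0 j) * ln (real (n m))) \<le> L * (C1 + C2) * (1 / s m * ln (real (n m)))) sequentially"
      using C1 C2 eventually_pt_Theta[of h] eventually_close[OF L(2), of h]
    proof eventually_elim
      case (elim m)
      have "\<bar>al (pt m h) j - al \<theta>0 j\<bar> \<le> L * (gap (pt m h) j + gap (pt m h) (j - 1))"
        using elim by (intro L(3) j) (auto intro: less_imp_le)
      also have "\<dots> \<le> L * (C1 * (1 / s m) + C2 * (1 / s m))" using elim L(1) by (intro mult_left_mono add_mono) auto
      finally have "\<bar>al (pt m h) j - al \<theta>0 j\<bar> * ln (real (n m)) \<le> L * (C1 * (1 / s m) + C2 * (1 / s m)) * ln (real (n m))"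
        using n1[of m] by (intro mult_right_mono) auto
      moreover have "L * (C1 * (1 / s m) + C2 * (1 / s m)) * ln (real (n m)) = L * (C1 + C2) * (1 / s m * ln (real (n m)))"
        by (simp only: distrib_right[symmetric] mult.assoc)
      moreover have "norm ((al (pt m h) j - al \<theta>0 j) * ln (real (n m))) = \<bar>al (pt m h) j - al \<theta>0 j\<bar> * ln (real (n m))"
        using n1[of m] by (simp only: real_norm_def abs_mult) simp
      ultimately show ?case by (simp only:)
    qed
  qed
qed

lemma rel_lik_tendsto: "(\<lambda>m. rel_lik (n m) (y m) (pt m h)) \<longlonglongrightarrow> exp (log_dens h)"
proof -
  have "(\<lambda>m. Efac (D j) (al \<theta>0 j) (n m) (al (pt m h) j) (N (n m) (y m) (pt m h) j))
      \<longlonglongrightarrow> exp (- (slope k f0 \<theta>0 j * h j - slope k f0 \<theta>0 (j - 1) * h (j - 1))\<^sup>2 / (2 * D j))" if j: "j \<in> {1..k+1}" for j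
  proof (rule Efac_tendsto[OF D_pos[OF j] al0_pos[OF j] n_at_top _ al_pt_tendsto[OF j]])
    have "(\<lambda>m. Vend m (pt m h) j - Vend m (pt m h) (j - 1)) \<longlonglongrightarrow> slope k f0 \<theta>0 j * h j - slope k f0 \<theta>0 (j - 1) * h (j - 1)"
      using j by (intro tendsto_diff Vend_pt_tendsto) auto
    then show "(\<lambda>m. (real (N (n m) (y m) (pt m h) j) - real (n m) * D j) / sqrt (real (n m)))
        \<longlonglongrightarrow> slope k f0 \<theta>0 j * h j - slope k f0 \<theta>0 (j - 1) * h (j - 1)"
    proof (rule Lim_transform_eventually)
      show "eventually (\<lambda>m. Vend m (pt m h) j - Vend m (pt m h) (j - 1) =
          (real (N (n m) (y m) (pt m h) j) - real (n m) * D j) / sqrt (real (n m))) sequentially"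
        using eventually_pt_Theta[of h] by eventually_elim (use count_deviation[OF _ j] in \<open>simp add: s_def\<close>)
    qed
  qed (rule cnt_le)
  then have "(\<lambda>m. \<Prod>j\<in>{1..k+1}. Efac (D j) (al \<theta>0 j) (n m) (al (pt m h) j) (N (n m) (y m) (pt m h) j))
      \<longlonglongrightarrow> (\<Prod>j\<in>{1..k+1}. exp (- (slope k f0 \<theta>0 j * h j - slope k f0 \<theta>0 (j - 1) * h (j - 1))\<^sup>2 / (2 * D j)))"
    by (rule tendsto_prod)
  then show ?thesis unfolding rel_lik_def log_dens_def by (simp only: exp_sum finite_atLeastAtMost)
qed

lemma rel_post_tendsto: "(\<lambda>m. rel_post (n m) (y m) (pt m h)) \<longlonglongrightarrow> pri \<theta>0 * exp (log_dens h)"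
proof -
  have pri: "(\<lambda>m. pri (pt m h)) \<longlonglongrightarrow> pri \<theta>0"
  proof (rule tendstoI)
    fix e :: real assume "e > 0"
    then obtain \<delta> where \<delta>: "\<delta> > 0" "\<And>\<theta>. \<theta> \<in> Theta k \<Longrightarrow> (\<forall>j\<in>{1..k}. \<bar>\<theta> j - \<theta>0 j\<bar> < \<delta>) \<Longrightarrow> \<bar>pri \<theta> - pri \<theta>0\<bar> < e"
      using pri_cont by blast
    show "eventually (\<lambda>m. dist (pri (pt m h)) (pri \<theta>0) < e) sequentially"
      using eventually_pt_Theta[of h] eventually_close[OF \<delta>(1), of h]
      by eventually_elim (use \<delta>(2) in \<open>auto simp: dist_real_def\<close>)
  qed
  have "(\<lambda>m. rel_lik (n m) (y m) (pt m h) * pri (pt m h)) \<longlonglongrightarrow> exp (log_dens h) * pri \<theta>0"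
    by (intro tendsto_mult rel_lik_tendsto pri)
  then have "(\<lambda>m. rel_post (n m) (y m) (pt m h)) \<longlonglongrightarrow> exp (log_dens h) * pri \<theta>0"
    by (rule Lim_transform_eventually)
      (use eventually_pt_Theta[of h] in \<open>auto elim!: eventually_mono simp: rel_post_def\<close>)
  then show ?thesis by (simp add: mult.commute)
qed

end

section \<open>Dominating the posterior density\<close>

context quantile_model
begin

interpretation P0: real_distribution P0 by (rule P0)

text \<open>The power of sqrt x is the Jacobian of the rescaling; the bracket is the constant of one
  cell in \<open>Efac_far_bound\<close>. Only polynomial growth matters, so the exponent
  \<open>B\<close> is chosen generously.\<close>

lemma poly_exp_tendsto_0:
  fixes a c M :: real
  assumes "c > 0" "M > 0" "a \<ge> 0"
  shows "((\<lambda>x. sqrt x ^ k * ((exp (3 + a) * exp (a * (1 + ln x)) * (1 + a * x / M)) ^ (k + 1) * exp (- c * x))) \<longlongrightarrow> 0) at_top"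
proof -
  define C where "C = (exp (3 + a) * exp a * (1 + a / M)) ^ (k + 1)"
  define B where "B = real k + (a + 1) * real (k + 1)"
  have lim: "((\<lambda>x::real. C * (x powr B * exp (- c * x))) \<longlongrightarrow> 0) at_top"
  proof (rule tendsto_mult_right_zero)
    have "B > 0" using assms by (simp add: B_def add_nonneg_pos)
    then show "((\<lambda>x::real. x powr B * exp (- c * x)) \<longlongrightarrow> 0) at_top" using assms(1) by real_asymp
  qed
  show ?thesis
  proof (rule Lim_null_comparison[OF _ lim])
    show "eventually (\<lambda>x. norm (sqrt x ^ k * ((exp (3 + a) * exp (a * (1 + ln x)) * (1 + a * x / M)) ^ (k + 1) * exp (- c * x)))
        \<le> C * (x powr B * exp (- c * x))) at_top"
      using eventually_ge_at_top[of 1]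
    proof eventually_elim
      case (elim x)
      have e: "exp (a * (1 + ln x)) = exp a * x powr a"
        using elim by (simp add: powr_def distrib_left exp_add mult.commute)
      have l: "1 + a * x / M \<le> (1 + a / M) * x" using elim by (simp add: distrib_right)
      have nn: "0 \<le> a * x / M" "0 \<le> a / M" using elim assms by auto
      have "exp (3 + a) * exp (a * (1 + ln x)) * (1 + a * x / M) \<le> exp (3 + a) * (exp a * x powr a) * ((1 + a / M) * x)"
        unfolding e using l nn elim by (intro mult_left_mono) auto
      also have "\<dots> = (exp (3 + a) * exp a * (1 + a / M)) * x powr (a + 1)"
        using elim by (simp add: powr_add mult_ac)
      finally have "(exp (3 + a) * exp (a * (1 + ln x)) * (1 + a * x / M)) ^ (k + 1) \<le> ((exp (3 + a) * exp a * (1 + a / M)) * x powr (a + 1)) ^ (k + 1)"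
        using nn by (intro power_mono) auto
      also have "\<dots> = C * x powr ((a + 1) * real (k + 1))"
      proof -
        have "(x powr (a + 1)) ^ (k + 1) = (x powr (a + 1)) powr real (k + 1)"
          using elim by (intro powr_realpow[symmetric]) auto
        also have "\<dots> = x powr ((a + 1) * real (k + 1))" by (rule powr_powr)
        finally show ?thesis unfolding C_def by (simp only: power_mult_distrib)
      qed
      finally have 1: "(exp (3 + a) * exp (a * (1 + ln x)) * (1 + a * x / M)) ^ (k + 1) \<le> C * x powr ((a + 1) * real (k + 1))" .
      have "sqrt x \<le> x" using elim real_sqrt_le_mono[of x "x * x"] by (simp add: real_sqrt_mult)
      then have "sqrt x ^ k \<le> x ^ k" using elim by (intro power_mono) auto
      also have "\<dots> = x powr real k" using elim by (simp add: powr_realpow)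
      finally have 2: "sqrt x ^ k \<le> x powr real k" .
      have "sqrt x ^ k * ((exp (3 + a) * exp (a * (1 + ln x)) * (1 + a * x / M)) ^ (k + 1) * exp (- c * x))
          \<le> x powr real k * (C * x powr ((a + 1) * real (k + 1)) * exp (- c * x))"
        using 1 2 nn by (intro mult_mono mult_right_mono mult_nonneg_nonneg zero_le_power) auto
      also have "\<dots> = C * (x powr B * exp (- c * x))" unfolding B_def powr_add by (simp add: mult_ac)
      finally show ?case using nn elim by (simp add: abs_of_nonneg)
    qed
  qed
qed

text \<open>An empty cell contributes no inverse mass, and for a nonempty cell of F_0-mass 0 the
  right-hand side is infinite. Otherwise al \<theta> j \<ge> M' \<mu> > 0 with \<mu> the F_0-mass,
  so the singular factor A / al \<theta> j is at most A n / M' times N / (n \<mu>).\<close>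

lemma Efac_far_bound:
  assumes M': "M' > 0" and low: "M' * measure P0 (Sset k \<theta> j) \<le> al \<theta> j"
    and \<theta>: "\<theta> \<in> Theta k" and j: "j \<in> {1..k+1}" and n: "n \<ge> 1" "real n * D j \<ge> 1"
  shows "ennreal (Efac (D j) (al \<theta>0 j) n (al \<theta> j) (N n y \<theta> j)) \<le>
     ennreal (exp (3 + A) * exp (A * (1 + ln (real n))) * (1 + A * real n / M') * exp (- (real (N n y \<theta> j) - real n * D j)\<^sup>2 / (4 * real n)))
      * (1 + of_nat (N n y \<theta> j) / (of_nat n * mass P0 k \<theta> j))"
proof -
  define a where "a = al \<theta> j"
  define a0 where "a0 = al \<theta>0 j"
  define M where "M = N n y \<theta> j"
  define g where "g = exp (- (real M - real n * D j)\<^sup>2 / (4 * real n))"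
  define u where "u = exp (A * (1 + ln (real n)))"
  define w where "w = 1 + A * real n / M'"
  have a0: "a0 > 0" "a0 \<le> A" using al0_pos[OF j] al_le by (auto simp: a0_def)
  have aA: "0 \<le> a" by (simp add: a_def)
  have Mn: "M \<le> n" by (simp add: M_def cnt_le)
  have D: "0 < D j" "D j \<le> 1" using D_pos[OF j] D_le_1[OF j] by auto
  have g: "g > 0" by (simp add: g_def)
  have u: "u \<ge> 1" using n A_pos by (simp add: u_def)
  have w: "w \<ge> 1" using M' A_pos by (simp add: w_def)
  have e3: "exp (3 + a0) \<le> exp (3 + A)" using a0 by simp
  define N' where "N' = min M (nat \<lfloor>real n * D j\<rfloor>)"
  have base: "Efac (D j) a0 n x M \<le> pochhammer a0 N' / pochhammer x N' * exp (3 + A) * g" if "x > 0" for x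
  proof -
    have "Efac (D j) a0 n x M \<le> pochhammer a0 N' / pochhammer x N' * exp (3 + a0) * g"
      using Efac_bound[OF that a0(1) D n(2) Mn] by (simp add: N'_def g_def)
    also have "\<dots> \<le> pochhammer a0 N' / pochhammer x N' * exp (3 + A) * g"
      using e3 g pochhammer_pos[OF a0(1), of N'] pochhammer_pos[OF that, of N']
      by (intro mult_right_mono mult_left_mono) (auto intro: less_imp_le divide_nonneg_nonneg)
    finally show ?thesis .
  qed
  have "ennreal (Efac (D j) a0 n a M) \<le> ennreal (exp (3 + A) * u * w * g) * (1 + of_nat M / (of_nat n * mass P0 k \<theta> j))"
  proof (cases "M = 0")
    case True
    \<comment> \<open>\<open>pochhammer a 0 = 1\<close> for every a, so a possibly zero mass may be
      replaced by 1, to which \<open>base\<close> applies.\<close>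
    have "Efac (D j) a0 n a M = Efac (D j) a0 n 1 M" by (simp add: True Efac_def)
    also have "\<dots> \<le> 1 * exp (3 + A) * g" using base[of 1] by (simp add: True N'_def)
    also have "\<dots> \<le> exp (3 + A) * u * w * g"
    proof -
      have "1 \<le> u * w" using mult_mono[OF u w] u by simp
      then have "exp (3 + A) * g * 1 \<le> exp (3 + A) * g * (u * w)" using g by (intro mult_left_mono) auto
      then show ?thesis by (simp add: mult_ac)
    qed
    finally show ?thesis by (simp add: True ennreal_leI)
  next
    case False
    show ?thesis
    proof (cases "measure P0 (Sset k \<theta> j) = 0")
      case True
      then have "mass P0 k \<theta> j = 0" using mass_eq[OF P0 \<theta> j] by (simp add: P0.emeasure_eq_measure)
      then have "of_nat M / (of_nat n * mass P0 k \<theta> j) = (\<top> :: ennreal)" using False by simp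
      moreover have "ennreal (exp (3 + A) * u * w * g) * \<top> = \<top>"
      proof -
        have "exp (3 + A) * u * w * g > 0" using u w g by simp
        then show ?thesis using u w g by (auto simp: ennreal_mult_eq_top_iff)
      qed
      ultimately show ?thesis by simp
    next
      case False
      define \<mu> where "\<mu> = measure P0 (Sset k \<theta> j)"
      have \<mu>: "\<mu> > 0" using False by (simp add: \<mu>_def zero_less_measure_iff)
      have ap: "a \<ge> M' * \<mu>" using low by (simp add: a_def \<mu>_def)
      have a: "a > 0" using mult_pos_pos[OF M' \<mu>] ap by linarith
      define X where "X = real M / (real n * \<mu>)"
      have X: "X \<ge> 0" using \<mu> by (simp add: X_def)
      have rat: "pochhammer a0 N' / pochhammer a N' \<le> u * w * (1 + X)"
      proof (cases "N' = 0")
        case True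
        have "1 \<le> u * w * (1 + X)"
          using mult_mono[OF mult_mono[OF u w] , of 1 "1 + X"] u w X by simp
        then show ?thesis using True by simp
      next
        case False
        have N'n: "N' \<le> n" using Mn by (simp add: N'_def)
        have "pochhammer a0 N' / pochhammer a N' \<le> A / a * u"
          unfolding u_def using pochhammer_ratio_le_poly[OF a a0(1,2) _ N'n] False by simp
        also have "A / a \<le> w * (1 + X)"
        proof -
          have "A / a \<le> A / (M' * \<mu>)" using ap A_pos M' \<mu> a by (intro divide_left_mono) auto
          also have "\<dots> = A * real n / M' * (1 / (real n * \<mu>))" using n by simp
          \<comment> \<open>The cell is not empty, so M \<ge> 1 can be inserted in the
            numerator.\<close>
          also have "\<dots> \<le> A * real n / M' * X"
            unfolding X_def using \<open>M \<noteq> 0\<close> A_pos M' \<mu> n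
            by (intro mult_left_mono divide_right_mono) auto
          also have "\<dots> \<le> w * (1 + X)" unfolding w_def using X A_pos M' by (intro mult_mono) auto
          finally show ?thesis .
        qed
        finally show ?thesis using u by (simp add: mult_ac)
      qed
      have "Efac (D j) a0 n a M \<le> u * w * (1 + X) * exp (3 + A) * g"
        using base[OF a] rat g by (meson exp_ge_zero less_imp_le mult_right_mono order_trans)
      then have "ennreal (Efac (D j) a0 n a M) \<le> ennreal ((exp (3 + A) * u * w * g) * (1 + X))"
        by (intro ennreal_leI) (simp add: mult_ac)
      also have "\<dots> = ennreal (exp (3 + A) * u * w * g) * ennreal (1 + X)"
        using u w g X by (intro ennreal_mult) auto
      also have "ennreal (1 + X) = 1 + of_nat M / (of_nat n * mass P0 k \<theta> j)"
      proof -
        have "mass P0 k \<theta> j = ennreal \<mu>" using mass_eq[OF P0 \<theta> j] by (simp add: P0.emeasure_eq_measure \<mu>_def)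
        then have "of_nat n * mass P0 k \<theta> j = ennreal (real n * \<mu>)"
          using \<mu> by (simp add: ennreal_of_nat_eq_real_of_nat ennreal_mult)
        then show ?thesis using X n \<mu>
          by (simp add: X_def ennreal_of_nat_eq_real_of_nat divide_ennreal ennreal_plus)
      qed
      finally show ?thesis .
    qed
  qed
  then show ?thesis by (simp add: a_def a0_def M_def g_def u_def w_def)
qed

end

context good_sequence
begin

interpretation P0: real_distribution P0 by (rule P0)

text \<open>V at the j-th coordinate is the telescoping sum of the cell deviations up to j, and
  Cauchy-Schwarz applies. A single displaced coordinate thus already makes the exponent of the
  likelihood large.\<close>

lemma V_sq_le_sum:
  assumes j: "j \<in> {1..k}"
  shows "(V (n m) (y m) j (\<theta> j))\<^sup>2 \<le> real (k + 1) * (\<Sum>i\<in>{1..k+1}. (Vend m \<theta> i - Vend m \<theta> (i - 1))\<^sup>2)"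
proof -
  define z where "z i = Vend m \<theta> i - Vend m \<theta> (i - 1)" for i
  have "(\<Sum>i\<in>{Suc 0..j}. Vend m \<theta> i - Vend m \<theta> (i - 1)) = Vend m \<theta> j - Vend m \<theta> 0"
    by (rule sum_telescope'') simp
  then have "V (n m) (y m) j (\<theta> j) = (\<Sum>i\<in>{1..j}. z i)" using j by (simp add: z_def Vend_def)
  then have "\<bar>V (n m) (y m) j (\<theta> j)\<bar> \<le> (\<Sum>i\<in>{1..j}. \<bar>z i\<bar>)" by (simp add: sum_abs)
  also have "\<dots> \<le> (\<Sum>i\<in>{1..k+1}. \<bar>z i\<bar>)" using j by (intro sum_mono2) auto
  finally have "(V (n m) (y m) j (\<theta> j))\<^sup>2 \<le> (\<Sum>i\<in>{1..k+1}. \<bar>z i\<bar>)\<^sup>2"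
    by (metis abs_ge_zero power2_abs power_mono)
  also have "\<dots> \<le> real (card {1..k+1}) * (\<Sum>i\<in>{1..k+1}. \<bar>z i\<bar>\<^sup>2)"
    using sum_squared_le_sum_of_squares[of "\<lambda>i. \<bar>z i\<bar>" "{1..k+1}"] by (simp only: mult.commute)
  finally show ?thesis by (simp add: z_def)
qed

lemma eventually_nD: "eventually (\<lambda>m. \<forall>j\<in>{1..k+1}. real (n m) * D j \<ge> 1) sequentially"
proof (rule eventually_ball_finite, simp, rule ballI)
  fix j assume j: "j \<in> {1..k+1}"
  have "eventually (\<lambda>m. 1 / D j \<le> real (n m)) sequentially"
    using real_n_at_top unfolding filterlim_at_top by blast
  then show "eventually (\<lambda>m. 1 \<le> real (n m) * D j) sequentially"
    by eventually_elim (use D_pos[OF j] in \<open>simp add: pos_divide_le_eq\<close>)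
qed

lemma eventually_eta: "c > 0 \<Longrightarrow> eventually (\<lambda>m. 1 / (real m + 1) \<le> c) sequentially"
proof -
  assume c: "c > 0"
  have "(\<lambda>m. 1 / (real m + 1)) \<longlonglongrightarrow> 0" by real_asymp
  from order_tendstoD(2)[OF this c] show ?thesis by eventually_elim simp
qed

text \<open>V is monotone, so a coordinate farther than \<delta> from \<open>\<theta>0 j\<close>
  inherits the bound at \<open>\<theta>0 j\<close> plus or minus \<delta>: eventually |V| is at
  least c \<delta> / 2 times sqrt n minus K + 1, hence at least c \<delta> / 4 times sqrt n.
  \<open>V_sq_le_sum\<close> and the rate 1 / 4 of the cells turn this into exp (- d n), which is
  where \<open>d\<close> comes from.\<close>

lemma far_bound:
  assumes c: "c > 0" and \<delta>: "0 < \<delta>" "\<delta> \<le> 1"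
    and growth: "\<And>j x. j \<in> {1..k} \<Longrightarrow> \<bar>x - \<theta>0 j\<bar> \<le> \<delta> \<Longrightarrow>
      (\<theta>0 j \<le> x \<longrightarrow> c * (x - \<theta>0 j) \<le> cdf P0 x - p j) \<and> (x \<le> \<theta>0 j \<longrightarrow> cdf P0 x - p j \<le> c * (x - \<theta>0 j))"
  shows "\<exists>\<kappa>. (\<forall>m. \<kappa> m \<ge> 0) \<and> (\<lambda>m. s m ^ k * \<kappa> m) \<longlonglongrightarrow> 0 \<and>
     eventually (\<lambda>m. \<forall>\<theta>\<in>Theta k. (\<exists>j\<in>{1..k}. \<delta> < \<bar>\<theta> j - \<theta>0 j\<bar>) \<longrightarrow>
        ennreal (rel_lik (n m) (y m) \<theta>) \<le> ennreal (\<kappa> m) * sample_weight P0 (n m) k (y m) \<theta>) sequentially"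
proof -
  obtain M' where M': "M' > 0" "\<And>\<theta> j. \<theta> \<in> Theta k \<Longrightarrow> j \<in> {1..k+1} \<Longrightarrow> M' * measure P0 (Sset k \<theta> j) \<le> al \<theta> j"
    using al_lower by blast
  define d where "d = (c * \<delta> / 4)\<^sup>2 / (4 * real (k + 1))"
  have d: "d > 0" using c \<delta> by (simp add: d_def)
  define Q where "Q m = exp (3 + A) * exp (A * (1 + ln (real (n m)))) * (1 + A * real (n m) / M')" for m
  have Q: "Q m \<ge> 0" for m using A_pos M' by (simp add: Q_def)
  define \<kappa> where "\<kappa> m = Q m ^ (k + 1) * exp (- d * real (n m))" for m
  have \<kappa>0: "\<kappa> m \<ge> 0" for m using Q by (simp add: \<kappa>_def)
  have lim: "(\<lambda>m. s m ^ k * \<kappa> m) \<longlonglongrightarrow> 0"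
    using filterlim_compose[OF poly_exp_tendsto_0[OF d M'(1), of A] real_n_at_top] A_pos
    by (simp add: s_def \<kappa>_def Q_def less_imp_le)
  have ev_eta: "eventually (\<lambda>m. 1 / (real m + 1) \<le> min 1 (c / 2)) sequentially"
    by (rule eventually_eta) (use c in simp)
  have "eventually (\<lambda>m. \<forall>\<theta>\<in>Theta k. (\<exists>j\<in>{1..k}. \<delta> < \<bar>\<theta> j - \<theta>0 j\<bar>) \<longrightarrow>
        ennreal (rel_lik (n m) (y m) \<theta>) \<le> ennreal (\<kappa> m) * sample_weight P0 (n m) k (y m) \<theta>) sequentially"
    using eventually_nD ev_eta eventually_s_ge[of "4 * (K + 1) / (c * \<delta>)"]
  proof eventually_elim
    case (elim m)
    have eta: "0 \<le> 1 / (real m + 1)" "1 / (real m + 1) \<le> 1" "1 / (real m + 1) \<le> c / 2" using elim(2) c by auto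
    have s1: "K + 1 \<le> c * \<delta> / 4 * s m" using elim(3) c \<delta> by (simp add: pos_divide_le_eq mult_ac)
    show ?case
    proof (intro ballI impI)
      fix \<theta> assume \<theta>: "\<theta> \<in> Theta k" and "\<exists>j\<in>{1..k}. \<delta> < \<bar>\<theta> j - \<theta>0 j\<bar>"
      then obtain j where j: "j \<in> {1..k}" "\<delta> < \<bar>\<theta> j - \<theta>0 j\<bar>" by blast
      have "c * \<delta> / 4 * s m \<le> \<bar>V (n m) (y m) j (\<theta> j)\<bar>"
      proof (cases "\<theta>0 j \<le> \<theta> j")
        case True
        have "c / 2 * (s m * ((\<theta>0 j + \<delta>) - \<theta>0 j)) - (K + 1) \<le> V (n m) (y m) j (\<theta>0 j + \<delta>)"
          unfolding s_def by (rule V_growth(1)[OF good n1 eta c \<delta>(2) growth j(1)]) (use \<delta> in auto)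
        also have "\<dots> \<le> V (n m) (y m) j (\<theta> j)" using True j(2) by (intro V_mono) auto
        finally show ?thesis using s1 by (simp add: mult_ac)
      next
        case False
        have "V (n m) (y m) j (\<theta> j) \<le> V (n m) (y m) j (\<theta>0 j - \<delta>)" using False j(2) by (intro V_mono) auto
        also have "\<dots> \<le> c / 2 * (s m * ((\<theta>0 j - \<delta>) - \<theta>0 j)) + (K + 1)"
          unfolding s_def by (rule V_growth(2)[OF good n1 eta c \<delta>(2) growth j(1)]) (use \<delta> in auto)
        finally show ?thesis using s1 by (simp add: mult_ac)
      qed
      then have "(c * \<delta> / 4 * s m)\<^sup>2 \<le> (V (n m) (y m) j (\<theta> j))\<^sup>2"
        using c \<delta> s_pos[of m] by (metis abs_le_square_iff abs_of_nonneg divide_nonneg_nonneg less_imp_le mult_nonneg_nonneg zero_le_numeral)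
      also have "\<dots> \<le> real (k + 1) * (\<Sum>i\<in>{1..k+1}. (Vend m \<theta> i - Vend m \<theta> (i - 1))\<^sup>2)"
        by (rule V_sq_le_sum[OF j(1)])
      finally have "d * real (n m) \<le> (\<Sum>i\<in>{1..k+1}. (Vend m \<theta> i - Vend m \<theta> (i - 1))\<^sup>2) / 4"
        using s_sq[of m] by (simp add: d_def power_mult_distrib power2_eq_square[of "s m"] field_simps)
      also have "\<dots> = (\<Sum>i\<in>{1..k+1}. (real (N (n m) (y m) \<theta> i) - real (n m) * D i)\<^sup>2 / (4 * real (n m)))"
        unfolding sum_divide_distrib
      proof (rule sum.cong[OF refl])
        fix i assume i: "i \<in> {1..k+1}"
        show "(Vend m \<theta> i - Vend m \<theta> (i - 1))\<^sup>2 / 4 = (real (N (n m) (y m) \<theta> i) - real (n m) * D i)\<^sup>2 / (4 * real (n m))"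
          unfolding count_deviation[OF \<theta> i, symmetric] power_divide by (simp add: s_sq power2_eq_square[of "s m"])
      qed
      finally have dn: "d * real (n m) \<le> (\<Sum>i\<in>{1..k+1}. (real (N (n m) (y m) \<theta> i) - real (n m) * D i)\<^sup>2 / (4 * real (n m)))" .
      have "ennreal (rel_lik (n m) (y m) \<theta>) \<le> (\<Prod>i\<in>{1..k+1}.
          ennreal (Q m * exp (- (real (N (n m) (y m) \<theta> i) - real (n m) * D i)\<^sup>2 / (4 * real (n m))))
          * (1 + of_nat (N (n m) (y m) \<theta> i) / (of_nat (n m) * mass P0 k \<theta> i)))"
        unfolding rel_lik_def
      proof (rule ennreal_prod_le)
        fix i assume i: "i \<in> {1..k+1}"
        show "0 \<le> Efac (D i) (al \<theta>0 i) (n m) (al \<theta> i) (N (n m) (y m) \<theta> i)"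
          using al0_pos[OF i] D_pos[OF i] by (intro Efac_nonneg) auto
        show "ennreal (Efac (D i) (al \<theta>0 i) (n m) (al \<theta> i) (N (n m) (y m) \<theta> i))
            \<le> ennreal (Q m * exp (- (real (N (n m) (y m) \<theta> i) - real (n m) * D i)\<^sup>2 / (4 * real (n m))))
            * (1 + of_nat (N (n m) (y m) \<theta> i) / (of_nat (n m) * mass P0 k \<theta> i))"
          unfolding Q_def using elim(1) i by (intro Efac_far_bound[OF M'(1) M'(2)[OF \<theta> i] \<theta> i n1]) auto
      qed
      also have "\<dots> = ennreal (Q m ^ (k + 1) * exp (- (\<Sum>i\<in>{1..k+1}. (real (N (n m) (y m) \<theta> i) - real (n m) * D i)\<^sup>2 / (4 * real (n m)))))
          * (\<Prod>i\<in>{1..k+1}. 1 + of_nat (N (n m) (y m) \<theta> i) / (of_nat (n m) * mass P0 k \<theta> i))"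
      proof -
        have "(\<Prod>i\<in>{1..k+1}. ennreal (Q m * exp (- (real (N (n m) (y m) \<theta> i) - real (n m) * D i)\<^sup>2 / (4 * real (n m)))))
           = ennreal (\<Prod>i\<in>{1..k+1}. Q m * exp (- (real (N (n m) (y m) \<theta> i) - real (n m) * D i)\<^sup>2 / (4 * real (n m))))"
          by (rule prod_ennreal) (use Q in simp)
        also have "(\<Prod>i\<in>{1..k+1}. Q m * exp (- (real (N (n m) (y m) \<theta> i) - real (n m) * D i)\<^sup>2 / (4 * real (n m))))
           = Q m ^ (k + 1) * exp (\<Sum>i\<in>{1..k+1}. - (real (N (n m) (y m) \<theta> i) - real (n m) * D i)\<^sup>2 / (4 * real (n m)))"
          unfolding prod.distrib prod_constant exp_sum[OF finite_atLeastAtMost] by simp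
        also have "(\<Sum>i\<in>{1..k+1}. - (real (N (n m) (y m) \<theta> i) - real (n m) * D i)\<^sup>2 / (4 * real (n m)))
           = - (\<Sum>i\<in>{1..k+1}. (real (N (n m) (y m) \<theta> i) - real (n m) * D i)\<^sup>2 / (4 * real (n m)))"
          by (simp only: sum_negf[symmetric] minus_divide_left)
        finally show ?thesis by (simp only: prod.distrib)
      qed
      also have "\<dots> \<le> ennreal (\<kappa> m) * sample_weight P0 (n m) k (y m) \<theta>"
        using dn Q[of m] by (intro mult_mono sample_weight_ge[OF P0 \<theta>] ennreal_leI) (auto simp: \<kappa>_def intro!: mult_left_mono)
      finally show "ennreal (rel_lik (n m) (y m) \<theta>) \<le> ennreal (\<kappa> m) * sample_weight P0 (n m) k (y m) \<theta>" .
    qed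
  qed
  with \<kappa>0 lim show ?thesis by blast
qed

section \<open>Gaussian domination near the true quantiles\<close>

lemma sum_gap: "(\<Sum>j\<in>{1..k+1}. gap \<theta> j + gap \<theta> (j - 1)) = 2 * (\<Sum>j\<in>{1..k}. \<bar>\<theta> j - \<theta>0 j\<bar>)"
proof -
  have "(\<Sum>j\<in>{1..k+1}. gap \<theta> j) = (\<Sum>j\<in>{1..k}. gap \<theta> j)" by (simp add: gap_def)
  moreover have "(\<Sum>j\<in>{1..k+1}. gap \<theta> (j - 1)) = (\<Sum>j\<in>{0..k}. gap \<theta> j)"
    by (rule sum.reindex_bij_witness[of _ Suc "\<lambda>i. i - 1"]) auto
  moreover have "(\<Sum>j\<in>{0..k}. gap \<theta> j) = gap \<theta> 0 + (\<Sum>j\<in>{1..k}. gap \<theta> j)"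
    by (simp add: sum.atLeast_Suc_atMost)
  moreover have "(\<Sum>j\<in>{1..k}. gap \<theta> j) = (\<Sum>j\<in>{1..k}. \<bar>\<theta> j - \<theta>0 j\<bar>)"
    by (intro sum.cong) (auto simp: gap_def)
  ultimately show ?thesis by (simp add: sum.distrib gap_def)
qed

text \<open>Two exponents compete. Once L (1 / lo + 1 + ln n) \<le> s m / 2, the rising factorials
  contribute at most the sum of |b j m + h j|, which is linear in h. The counts contribute - z^2 / 4
  per cell, quadratic in h by \<open>V_growth\<close>. Half of the quadratic rate absorbs the linear
  term.\<close>

lemma near_bound:
  assumes c: "c > 0" and \<delta>: "0 < \<delta>" "\<delta> \<le> 1"
    and growth: "\<And>j x. j \<in> {1..k} \<Longrightarrow> \<bar>x - \<theta>0 j\<bar> \<le> \<delta> \<Longrightarrow>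
      (\<theta>0 j \<le> x \<longrightarrow> c * (x - \<theta>0 j) \<le> cdf P0 x - p j) \<and> (x \<le> \<theta>0 j \<longrightarrow> cdf P0 x - p j \<le> c * (x - \<theta>0 j))"
    and L: "L > 0" and lip: "\<And>\<theta> j. \<theta> \<in> Theta k \<Longrightarrow> (\<forall>j\<in>{1..k}. \<bar>\<theta> j - \<theta>0 j\<bar> \<le> \<delta>) \<Longrightarrow> j \<in> {1..k+1} \<Longrightarrow>
      \<bar>al \<theta> j - al \<theta>0 j\<bar> \<le> L * (gap \<theta> j + gap \<theta> (j - 1))"
    and lo: "lo > 0" "\<And>\<theta> j. \<theta> \<in> Theta k \<Longrightarrow> (\<forall>j\<in>{1..k}. \<bar>\<theta> j - \<theta>0 j\<bar> \<le> \<delta>) \<Longrightarrow> j \<in> {1..k+1} \<Longrightarrow> lo \<le> al \<theta> j"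
    and pri: "\<And>\<theta>. \<theta> \<in> Theta k \<Longrightarrow> (\<forall>j\<in>{1..k}. \<bar>\<theta> j - \<theta>0 j\<bar> \<le> \<delta>) \<Longrightarrow> pri \<theta> \<le> 2 * pri \<theta>0"
  shows "\<exists>C e. C \<ge> 0 \<and> e > 0 \<and> eventually (\<lambda>m. \<forall>h. (\<forall>j\<in>{1..k}. \<bar>pt m h j - \<theta>0 j\<bar> \<le> \<delta>) \<longrightarrow>
     rel_post (n m) (y m) (pt m h) \<le> C * (\<Prod>j\<in>{1..k}. exp (- e * (h j)\<^sup>2 / 2))) sequentially"
proof -
  obtain B where B: "B \<ge> 0" "eventually (\<lambda>m. \<forall>j\<in>{1..k}. \<bar>b j m\<bar> \<le> B) sequentially" using b_bounded by blast
  \<comment> \<open>Summing \<open>V_sq_le_sum\<close> over the k coordinates yields \<nu>, so each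
    V^2 keeps the rate \<nu> / 4. The bound V^2 \<ge> c^2 / 8 * x^2 - (K + 1)^2 with x = b + h turns
    this into q = \<nu> / 4 * c^2 / 8; \<open>C0\<close> collects what is left over.\<close>
  define \<nu> where "\<nu> = 1 / (real k * real (k + 1))"
  have \<nu>: "\<nu> > 0" using k by (simp add: \<nu>_def)
  define q where "q = \<nu> * c\<^sup>2 / 32"
  have q: "q > 0" using \<nu> c by (simp add: q_def)
  define C0 where "C0 = 1 / (2 * q) + q / 2 * B\<^sup>2 + \<nu> / 4 * (K + 1)\<^sup>2"
  define C1 where "C1 = real (k + 1) * (3 + A) + real k * C0"
  have ev_eta: "eventually (\<lambda>m. 1 / (real m + 1) \<le> min 1 (c / 2)) sequentially"
    by (rule eventually_eta) (use c in simp)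
  have "((\<lambda>x::real. L * (1 / lo + 1 + ln x) / sqrt x) \<longlongrightarrow> 0) at_top" using L lo(1) by real_asymp
  from filterlim_compose[OF this real_n_at_top]
  have "(\<lambda>m. L * (1 / lo + 1 + ln (real (n m))) / s m) \<longlonglongrightarrow> 0" by (simp add: s_def)
  then have "eventually (\<lambda>m. L * (1 / lo + 1 + ln (real (n m))) / s m < 1 / 2) sequentially"
    by (rule order_tendstoD(2)) simp
  then have "eventually (\<lambda>m. \<forall>h. (\<forall>j\<in>{1..k}. \<bar>pt m h j - \<theta>0 j\<bar> \<le> \<delta>) \<longrightarrow>
     rel_post (n m) (y m) (pt m h) \<le> 2 * pri \<theta>0 * exp C1 * (\<Prod>j\<in>{1..k}. exp (- (q / 2) * (h j)\<^sup>2 / 2))) sequentially"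
    using B(2) eventually_nD ev_eta
  proof eventually_elim
    case (elim m)
    have eta: "0 \<le> 1 / (real m + 1)" "1 / (real m + 1) \<le> 1" "1 / (real m + 1) \<le> c / 2" using elim(4) c by auto
    have Lln: "L * (1 / lo + 1 + ln (real (n m))) \<le> s m / 2"
      using elim(1) s_pos[of m] by (simp add: pos_divide_less_eq)
    show ?case
    proof (intro allI impI)
      fix h assume near: "\<forall>j\<in>{1..k}. \<bar>pt m h j - \<theta>0 j\<bar> \<le> \<delta>"
      define \<theta> where "\<theta> = pt m h"
      have near\<theta>: "\<forall>j\<in>{1..k}. \<bar>\<theta> j - \<theta>0 j\<bar> \<le> \<delta>" using near by (simp only: \<theta>_def)
      have hp: "s m * (\<theta> j - \<theta>0 j) = b j m + h j" if "j \<in> {1..k}" for j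
        unfolding \<theta>_def pt_eq[OF that] using s_pos[of m] by simp
      show "rel_post (n m) (y m) (pt m h) \<le> 2 * pri \<theta>0 * exp C1 * (\<Prod>j\<in>{1..k}. exp (- (q / 2) * (h j)\<^sup>2 / 2))"
      proof (cases "\<theta> \<in> Theta k")
        case False
        have "rel_post (n m) (y m) \<theta> = 0" using False by (simp add: rel_post_def)
        moreover have "0 \<le> 2 * pri \<theta>0 * exp C1 * (\<Prod>j\<in>{1..k}. exp (- (q / 2) * (h j)\<^sup>2 / 2))"
          using pri_pos by (intro mult_nonneg_nonneg prod_nonneg) auto
        ultimately show ?thesis by (simp only: \<theta>_def)
      next
        case True
        define z where "z i = Vend m \<theta> i - Vend m \<theta> (i - 1)" for i
        have fac: "Efac (D j) (al \<theta>0 j) (n m) (al \<theta> j) (N (n m) (y m) \<theta> j)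
            \<le> exp (s m / 2 * (gap \<theta> j + gap \<theta> (j - 1)) + (3 + A) - (z j)\<^sup>2 / 4)" if j: "j \<in> {1..k+1}" for j
        proof -
          define M where "M = N (n m) (y m) \<theta> j"
          define N' where "N' = min M (nat \<lfloor>real (n m) * D j\<rfloor>)"
          have a: "lo \<le> al \<theta> j" "lo \<le> al \<theta>0 j"
            using lo(2)[OF True near\<theta> j] lo(2)[OF \<theta>0_Theta _ j] \<delta> by auto
          have Mn: "M \<le> n m" by (simp add: M_def cnt_le)
          have zz: "(real M - real (n m) * D j)\<^sup>2 / (4 * real (n m)) = (z j)\<^sup>2 / 4"
            unfolding z_def count_deviation[OF True j, symmetric] M_def power_divide by (simp add: s_sq power2_eq_square[of "s m"])
          have "Efac (D j) (al \<theta>0 j) (n m) (al \<theta> j) M \<le> pochhammer (al \<theta>0 j) N' / pochhammer (al \<theta> j) N' * exp (3 + al \<theta>0 j)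
             * exp (- (real M - real (n m) * D j)\<^sup>2 / (4 * real (n m)))"
            unfolding N'_def using a lo(1) D_pos[OF j] D_le_1[OF j] elim(3) j Mn by (intro Efac_bound) auto
          also have "\<dots> \<le> exp (s m / 2 * (gap \<theta> j + gap \<theta> (j - 1))) * exp (3 + A) * exp (- (real M - real (n m) * D j)\<^sup>2 / (4 * real (n m)))"
          proof (intro mult_right_mono mult_mono)
            have "pochhammer (al \<theta>0 j) N' / pochhammer (al \<theta> j) N' \<le> exp (\<bar>al \<theta> j - al \<theta>0 j\<bar> * (1 / lo + 1 + ln (real (n m))))"
              using Mn n1[of m] by (intro pochhammer_ratio_le[OF lo(1) a]) (auto simp: N'_def)
            also have "\<bar>al \<theta> j - al \<theta>0 j\<bar> * (1 / lo + 1 + ln (real (n m)))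
                \<le> L * (gap \<theta> j + gap \<theta> (j - 1)) * (1 / lo + 1 + ln (real (n m)))"
              using lip[OF True near\<theta> j] lo(1) n1[of m] by (intro mult_right_mono) auto
            also have "\<dots> = (gap \<theta> j + gap \<theta> (j - 1)) * (L * (1 / lo + 1 + ln (real (n m))))" by (simp only: mult_ac)
            also have "\<dots> \<le> (gap \<theta> j + gap \<theta> (j - 1)) * (s m / 2)"
              using Lln by (intro mult_left_mono) (auto simp: gap_def)
            finally show "pochhammer (al \<theta>0 j) N' / pochhammer (al \<theta> j) N' \<le> exp (s m / 2 * (gap \<theta> j + gap \<theta> (j - 1)))"
              by (simp add: mult.commute)
          qed (use al_le in auto)
          also have "\<dots> = exp (s m / 2 * (gap \<theta> j + gap \<theta> (j - 1)) + (3 + A) - (z j)\<^sup>2 / 4)"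
            by (simp only: exp_add[symmetric] minus_divide_left[symmetric] zz) simp
          finally show ?thesis by (simp only: M_def)
        qed
        have "rel_lik (n m) (y m) \<theta> \<le> (\<Prod>j\<in>{1..k+1}. exp (s m / 2 * (gap \<theta> j + gap \<theta> (j - 1)) + (3 + A) - (z j)\<^sup>2 / 4))"
          unfolding rel_lik_def
          using fac al0_pos D_pos by (intro prod_mono conjI Efac_nonneg) (auto intro: less_imp_le)
        also have "\<dots> = exp (\<Sum>j\<in>{1..k+1}. s m / 2 * (gap \<theta> j + gap \<theta> (j - 1)) + (3 + A) - (z j)\<^sup>2 / 4)"
          by (rule exp_sum[symmetric]) simp
        also have "(\<Sum>j\<in>{1..k+1}. s m / 2 * (gap \<theta> j + gap \<theta> (j - 1)) + (3 + A) - (z j)\<^sup>2 / 4)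
            = (\<Sum>j\<in>{1..k}. \<bar>b j m + h j\<bar>) + real (k + 1) * (3 + A) - (\<Sum>j\<in>{1..k+1}. (z j)\<^sup>2) / 4"
        proof -
          have "(\<Sum>j\<in>{1..k+1}. s m / 2 * (gap \<theta> j + gap \<theta> (j - 1))) = s m / 2 * (2 * (\<Sum>j\<in>{1..k}. \<bar>\<theta> j - \<theta>0 j\<bar>))"
            by (simp only: sum_distrib_left[symmetric] sum_gap)
          also have "\<dots> = (\<Sum>j\<in>{1..k}. \<bar>s m * (\<theta> j - \<theta>0 j)\<bar>)"
            using s_pos[of m] by (simp add: sum_distrib_left abs_mult)
          also have "\<dots> = (\<Sum>j\<in>{1..k}. \<bar>b j m + h j\<bar>)" using hp by (intro sum.cong) auto
          finally have gaps: "(\<Sum>j\<in>{1..k+1}. s m / 2 * (gap \<theta> j + gap \<theta> (j - 1))) = (\<Sum>j\<in>{1..k}. \<bar>b j m + h j\<bar>)" .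
          have const: "(\<Sum>j\<in>{1..k+1}. 3 + A) = real (k + 1) * (3 + A)" by (simp add: algebra_simps)
          show ?thesis unfolding sum_subtractf sum.distrib[of _ "\<lambda>_. 3 + A"] gaps const sum_divide_distrib ..
        qed
        also have "\<dots> \<le> C1 - (\<Sum>j\<in>{1..k}. q / 2 * (h j)\<^sup>2 / 2)"
        proof -
          have each: "\<bar>b j m + h j\<bar> - \<nu> / 4 * (V (n m) (y m) j (\<theta> j))\<^sup>2 \<le> C0 - q / 2 * (h j)\<^sup>2 / 2" if j: "j \<in> {1..k}" for j
          proof -
            define x where "x = b j m + h j"
            define v where "v = \<bar>V (n m) (y m) j (\<theta> j)\<bar>"
            have nj: "\<bar>\<theta> j - \<theta>0 j\<bar> \<le> \<delta>" using near\<theta> j by blast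
            have sx: "sqrt (real (n m)) * (\<theta> j - \<theta>0 j) = x" using hp[OF j] by (simp add: s_def x_def)
            have "c / 2 * \<bar>x\<bar> \<le> v + (K + 1)"
            proof (cases "\<theta>0 j \<le> \<theta> j")
              case True
              then have "x \<ge> 0" using sx[symmetric] by simp
              then show ?thesis
                using V_growth(1)[OF good n1 eta c \<delta>(2) growth j nj True] unfolding sx v_def by simp
            next
              case False
              then have le: "\<theta> j \<le> \<theta>0 j" by simp
              then have "x \<le> 0" using sx[symmetric] by (simp add: mult_nonneg_nonpos)
              then show ?thesis
                using V_growth(2)[OF good n1 eta c \<delta>(2) growth j nj le] unfolding sx v_def by simp
            qed
            then have "(c / 2 * \<bar>x\<bar>)\<^sup>2 \<le> (v + (K + 1))\<^sup>2" using c by (intro power_mono) auto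
            also have "\<dots> \<le> 2 * v\<^sup>2 + 2 * (K + 1)\<^sup>2"
              using zero_le_power2[of "v - (K + 1)"] by (simp add: power2_eq_square algebra_simps)
            finally have "c\<^sup>2 / 8 * x\<^sup>2 - (K + 1)\<^sup>2 \<le> v\<^sup>2" by (simp add: power_mult_distrib power_divide)
            from mult_left_mono[OF this, of "\<nu> / 4"] \<nu>
            have 1: "q * x\<^sup>2 - \<nu> / 4 * (K + 1)\<^sup>2 \<le> \<nu> / 4 * v\<^sup>2" by (simp add: q_def right_diff_distrib mult_ac)
            \<comment> \<open>Completing the square spends q / 2 on the linear term, half of the
              available rate.\<close>
            have 2: "\<bar>x\<bar> \<le> 1 / (2 * q) + q / 2 * x\<^sup>2"
            proof -
              have "0 \<le> (q * \<bar>x\<bar> - 1)\<^sup>2 / (2 * q)" using q by simp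
              also have "\<dots> = q / 2 * x\<^sup>2 - \<bar>x\<bar> + 1 / (2 * q)"
              proof -
                have "(q * t - 1)\<^sup>2 / (2 * q) = q / 2 * t\<^sup>2 - t + 1 / (2 * q)" for t :: real
                  using q by (simp add: field_simps power2_eq_square)
                from this[of "\<bar>x\<bar>"] show ?thesis by simp
              qed
              finally show ?thesis by simp
            qed
            \<comment> \<open>Returning from x = b + h to h halves the rate once more and costs the
              bound B on b.\<close>
            have 3: "(h j)\<^sup>2 / 2 - B\<^sup>2 \<le> x\<^sup>2"
            proof -
              have "\<bar>b j m\<bar> \<le> B" using elim(2) j by blast
              then have "(b j m)\<^sup>2 \<le> B\<^sup>2" by (metis abs_ge_zero power2_abs power_mono)
              moreover have "(h j)\<^sup>2 \<le> 2 * x\<^sup>2 + 2 * (b j m)\<^sup>2"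
                using zero_le_power2[of "2 * b j m + h j"] by (simp add: x_def power2_eq_square algebra_simps)
              ultimately show ?thesis by linarith
            qed
            from mult_left_mono[OF 3, of "q / 2"] q
            have 4: "q / 2 * ((h j)\<^sup>2 / 2) - q / 2 * B\<^sup>2 \<le> q / 2 * x\<^sup>2" by (simp only: right_diff_distrib)
            have vv: "v\<^sup>2 = (V (n m) (y m) j (\<theta> j))\<^sup>2" by (simp add: v_def)
            show ?thesis
              using 1 2 4 unfolding vv C0_def x_def[symmetric] by simp
          qed
          have "\<nu> * (\<Sum>j\<in>{1..k}. (V (n m) (y m) j (\<theta> j))\<^sup>2) \<le> (\<Sum>i\<in>{1..k+1}. (z i)\<^sup>2)"
          proof -
            have "(\<Sum>j\<in>{1..k}. (V (n m) (y m) j (\<theta> j))\<^sup>2) \<le> (\<Sum>j\<in>{1..k}. real (k + 1) * (\<Sum>i\<in>{1..k+1}. (z i)\<^sup>2))"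
              unfolding z_def by (intro sum_mono V_sq_le_sum)
            also have "\<dots> = real k * real (k + 1) * (\<Sum>i\<in>{1..k+1}. (z i)\<^sup>2)" by simp
            finally show ?thesis using k unfolding \<nu>_def by (simp add: pos_divide_le_eq mult_ac)
          qed
          then have "(\<Sum>j\<in>{1..k}. \<bar>b j m + h j\<bar>) + real (k + 1) * (3 + A) - (\<Sum>j\<in>{1..k+1}. (z j)\<^sup>2) / 4
              \<le> (\<Sum>j\<in>{1..k}. \<bar>b j m + h j\<bar>) + real (k + 1) * (3 + A) - \<nu> / 4 * (\<Sum>j\<in>{1..k}. (V (n m) (y m) j (\<theta> j))\<^sup>2)"
            by simp
          also have "\<dots> = (\<Sum>j\<in>{1..k}. \<bar>b j m + h j\<bar> - \<nu> / 4 * (V (n m) (y m) j (\<theta> j))\<^sup>2) + real (k + 1) * (3 + A)"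
            by (simp only: sum_subtractf sum_distrib_left)
          also have "\<dots> \<le> (\<Sum>j\<in>{1..k}. C0 - q / 2 * (h j)\<^sup>2 / 2) + real (k + 1) * (3 + A)"
            using each by (intro add_right_mono sum_mono) auto
          also have "\<dots> = C1 - (\<Sum>j\<in>{1..k}. q / 2 * (h j)\<^sup>2 / 2)" by (simp add: sum_subtractf C1_def)
          finally show ?thesis .
        qed
        finally have "rel_lik (n m) (y m) \<theta> \<le> exp (C1 - (\<Sum>j\<in>{1..k}. q / 2 * (h j)\<^sup>2 / 2))" by simp
        also have "\<dots> = exp C1 * (\<Prod>j\<in>{1..k}. exp (- (q / 2) * (h j)\<^sup>2 / 2))"
        proof -
          have "(\<Prod>j\<in>{1..k}. exp (- (q / 2) * (h j)\<^sup>2 / 2)) = exp (\<Sum>j\<in>{1..k}. - (q / 2) * (h j)\<^sup>2 / 2)"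
            by (rule exp_sum[symmetric]) simp
          also have "(\<Sum>j\<in>{1..k}. - (q / 2) * (h j)\<^sup>2 / 2) = - (\<Sum>j\<in>{1..k}. q / 2 * (h j)\<^sup>2 / 2)"
            by (simp add: sum_negf)
          finally show ?thesis by (simp only: exp_add[symmetric] diff_conv_add_uminus)
        qed
        finally have "rel_lik (n m) (y m) \<theta> * pri \<theta> \<le> (exp C1 * (\<Prod>j\<in>{1..k}. exp (- (q / 2) * (h j)\<^sup>2 / 2))) * (2 * pri \<theta>0)"
          using pri[OF True near\<theta>] pri_nonneg True rel_lik_nonneg
          by (intro mult_mono) (auto intro!: mult_nonneg_nonneg prod_nonneg)
        then have "rel_post (n m) (y m) \<theta> \<le> 2 * pri \<theta>0 * exp C1 * (\<Prod>j\<in>{1..k}. exp (- (q / 2) * (h j)\<^sup>2 / 2))"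
          using True by (simp add: rel_post_def mult_ac)
        then show ?thesis by (simp only: \<theta>_def)
      qed
    qed
  qed
  then show ?thesis using q pri_pos by (intro exI[of _ "2 * pri \<theta>0 * exp C1"] exI[of _ "q / 2"]) auto
qed

end

section \<open>Convergence in total variation\<close>

context good_sequence
begin

interpretation P0: real_distribution P0 by (rule P0)

lemma near_far_bounds:
  "\<exists>\<delta>>0. (\<exists>C e. C \<ge> 0 \<and> e > 0 \<and> eventually (\<lambda>m. \<forall>h. (\<forall>j\<in>{1..k}. \<bar>pt m h j - \<theta>0 j\<bar> \<le> \<delta>) \<longrightarrow>
     rel_post (n m) (y m) (pt m h) \<le> C * (\<Prod>j\<in>{1..k}. exp (- e * (h j)\<^sup>2 / 2))) sequentially) \<and>
   (\<exists>\<kappa>. (\<forall>m. \<kappa> m \<ge> 0) \<and> (\<lambda>m. s m ^ k * \<kappa> m) \<longlonglongrightarrow> 0 \<and>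
     eventually (\<lambda>m. \<forall>\<theta>\<in>Theta k. (\<exists>j\<in>{1..k}. \<delta> < \<bar>\<theta> j - \<theta>0 j\<bar>) \<longrightarrow>
        ennreal (rel_lik (n m) (y m) \<theta>) \<le> ennreal (\<kappa> m) * sample_weight P0 (n m) k (y m) \<theta>) sequentially)"
proof -
  obtain c \<delta>1 where c: "c > 0" "\<delta>1 > 0" "\<And>j x. j \<in> {1..k} \<Longrightarrow> \<bar>x - \<theta>0 j\<bar> \<le> \<delta>1 \<Longrightarrow>
      (\<theta>0 j \<le> x \<longrightarrow> c * (x - \<theta>0 j) \<le> cdf P0 x - p j) \<and> (x \<le> \<theta>0 j \<longrightarrow> cdf P0 x - p j \<le> c * (x - \<theta>0 j))"
    using F0_growth by metis
  obtain L \<delta>2 where L: "L > 0" "\<delta>2 > 0" "\<And>\<theta> j. \<theta> \<in> Theta k \<Longrightarrow> (\<forall>j\<in>{1..k}. \<bar>\<theta> j - \<theta>0 j\<bar> \<le> \<delta>2) \<Longrightarrow> j \<in> {1..k+1} \<Longrightarrow>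
     \<bar>al \<theta> j - al \<theta>0 j\<bar> \<le> L * (gap \<theta> j + gap \<theta> (j - 1))"
    using al_lipschitz by metis
  obtain \<delta>3 where \<delta>3: "\<delta>3 > 0" "\<And>\<theta>. \<theta> \<in> Theta k \<Longrightarrow> (\<forall>j\<in>{1..k}. \<bar>\<theta> j - \<theta>0 j\<bar> < \<delta>3) \<Longrightarrow> \<bar>pri \<theta> - pri \<theta>0\<bar> < pri \<theta>0"
    using pri_cont pri_pos by blast
  have "\<exists>lo>0. \<forall>j\<in>{1..k+1}. 2 * lo \<le> al \<theta>0 j"
  proof (rule finite_min_radius)
    show "\<exists>\<delta>>0. 2 * \<delta> \<le> al \<theta>0 j" if "j \<in> {1..k+1}" for j
      using al0_pos[OF that] by (intro exI[of _ "al \<theta>0 j / 2"]) auto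
  qed auto
  then obtain lo where lo: "lo > 0" "\<And>j. j \<in> {1..k+1} \<Longrightarrow> 2 * lo \<le> al \<theta>0 j" by auto
  \<comment> \<open>Within this radius each mass moves by at most 2 L \<delta> \<le> lo from a value
    of at least 2 lo, so it stays above lo.\<close>
  define d where "d = lo / (2 * L)"
  have d: "d > 0" using lo(1) L(1) by (simp add: d_def)
  define \<delta> where "\<delta> = min (min 1 \<delta>1) (min \<delta>2 (min (\<delta>3 / 2) d))"
  have \<delta>': "\<delta> > 0" "\<delta> \<le> 1" "\<delta> \<le> \<delta>1" "\<delta> \<le> \<delta>2" "\<delta> \<le> \<delta>3 / 2" "\<delta> \<le> d"
    using c(2) L(2) \<delta>3(1) d by (simp_all add: \<delta>_def min_le_iff_disj)
  then have \<delta>: "\<delta> > 0" "\<delta> \<le> 1" "\<delta> \<le> \<delta>1" "\<delta> \<le> \<delta>2" "\<delta> < \<delta>3" "\<delta> \<le> lo / (2 * L)"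
    using \<delta>3(1) by (simp_all add: d_def)
  have growth: "\<And>j x. j \<in> {1..k} \<Longrightarrow> \<bar>x - \<theta>0 j\<bar> \<le> \<delta> \<Longrightarrow>
      (\<theta>0 j \<le> x \<longrightarrow> c * (x - \<theta>0 j) \<le> cdf P0 x - p j) \<and> (x \<le> \<theta>0 j \<longrightarrow> cdf P0 x - p j \<le> c * (x - \<theta>0 j))"
    using c(3) \<delta>(3) by (meson order_trans)
  have lip: "\<bar>al \<theta> j - al \<theta>0 j\<bar> \<le> L * (gap \<theta> j + gap \<theta> (j - 1))"
    if "\<theta> \<in> Theta k" "\<forall>j\<in>{1..k}. \<bar>\<theta> j - \<theta>0 j\<bar> \<le> \<delta>" "j \<in> {1..k+1}" for \<theta> j
    using L(3) that \<delta>(4) by (meson order_trans)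
  have lo2: "lo \<le> al \<theta> j"
    if "\<theta> \<in> Theta k" and near: "\<forall>j\<in>{1..k}. \<bar>\<theta> j - \<theta>0 j\<bar> \<le> \<delta>" and j: "j \<in> {1..k+1}" for \<theta> j
  proof -
    have gap_le: "gap \<theta> i \<le> \<delta>" for i
      unfolding gap_def using near \<delta>(1) by (cases "i \<in> {1..k}") (simp_all only: if_True if_False less_imp_le)
    have "gap \<theta> j + gap \<theta> (j - 1) \<le> 2 * \<delta>" using gap_le[of j] gap_le[of "j - 1"] by linarith
    then have "L * (gap \<theta> j + gap \<theta> (j - 1)) \<le> L * (2 * \<delta>)" using L(1) by (intro mult_left_mono) auto
    also have "\<dots> \<le> lo" using \<delta>(6) L(1) by (simp add: pos_le_divide_eq mult_ac)
    finally show ?thesis using lip[OF that] lo(2)[OF j] by linarith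
  qed
  have pri: "pri \<theta> \<le> 2 * pri \<theta>0" if "\<theta> \<in> Theta k" "\<forall>j\<in>{1..k}. \<bar>\<theta> j - \<theta>0 j\<bar> \<le> \<delta>" for \<theta>
  proof -
    have "\<bar>pri \<theta> - pri \<theta>0\<bar> < pri \<theta>0" using that \<delta>(5) by (intro \<delta>3(2)) (auto intro: le_less_trans)
    then show ?thesis by linarith
  qed
  have "\<exists>C e. C \<ge> 0 \<and> e > 0 \<and> eventually (\<lambda>m. \<forall>h. (\<forall>j\<in>{1..k}. \<bar>pt m h j - \<theta>0 j\<bar> \<le> \<delta>) \<longrightarrow>
     rel_post (n m) (y m) (pt m h) \<le> C * (\<Prod>j\<in>{1..k}. exp (- e * (h j)\<^sup>2 / 2))) sequentially"
    by (rule near_bound[OF c(1) \<delta>(1,2) growth L(1) lip lo(1) lo2 pri])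
  moreover have "\<exists>\<kappa>. (\<forall>m. \<kappa> m \<ge> 0) \<and> (\<lambda>m. s m ^ k * \<kappa> m) \<longlonglongrightarrow> 0 \<and>
     eventually (\<lambda>m. \<forall>\<theta>\<in>Theta k. (\<exists>j\<in>{1..k}. \<delta> < \<bar>\<theta> j - \<theta>0 j\<bar>) \<longrightarrow>
        ennreal (rel_lik (n m) (y m) \<theta>) \<le> ennreal (\<kappa> m) * sample_weight P0 (n m) k (y m) \<theta>) sequentially"
    by (rule far_bound[OF c(1) \<delta>(1,2) growth])
  ultimately show ?thesis using \<delta>(1) by blast
qed

text \<open>On the box S of radius \<delta> around \<theta>0 the Gaussian bound permits dominated
  convergence. Off S only the total mass is bounded: it is at most s^k \<kappa> K, with s^k the
  Jacobian and K the bound on \<open>prior_weight\<close>, and this tends to 0.\<close>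

lemma L1_convergence:
  assumes \<epsilon>: "\<epsilon> > 0"
  shows "eventually (\<lambda>m. (\<integral>\<^sup>+ h. ennreal \<bar>rel_post (n m) (y m) (pt m h) - pri \<theta>0 * exp (log_dens h)\<bar> \<partial>lebk k) \<le> ennreal \<epsilon>) sequentially"
proof -
  obtain \<delta> C e \<kappa> where \<delta>: "\<delta> > 0" and C: "C \<ge> 0" "e > 0"
    and near: "eventually (\<lambda>m. \<forall>h. (\<forall>j\<in>{1..k}. \<bar>pt m h j - \<theta>0 j\<bar> \<le> \<delta>) \<longrightarrow>
     rel_post (n m) (y m) (pt m h) \<le> C * (\<Prod>j\<in>{1..k}. exp (- e * (h j)\<^sup>2 / 2))) sequentially"
    and \<kappa>: "\<And>m. \<kappa> m \<ge> 0" "(\<lambda>m. s m ^ k * \<kappa> m) \<longlonglongrightarrow> 0"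
    and far: "eventually (\<lambda>m. \<forall>\<theta>\<in>Theta k. (\<exists>j\<in>{1..k}. \<delta> < \<bar>\<theta> j - \<theta>0 j\<bar>) \<longrightarrow>
        ennreal (rel_lik (n m) (y m) \<theta>) \<le> ennreal (\<kappa> m) * sample_weight P0 (n m) k (y m) \<theta>) sequentially"
    using near_far_bounds by blast
  define S where "S = {\<theta> \<in> space (lebk k). \<forall>j\<in>{1..k}. \<bar>\<theta> j - \<theta>0 j\<bar> \<le> \<delta>}"
  have S: "S \<in> sets (lebk k)"
  proof -
    have "{\<theta> \<in> space (lebk k). \<bar>\<theta> j - \<theta>0 j\<bar> \<le> \<delta>} \<in> sets (lebk k)" if "j \<in> {1..k}" for j
      using that by (intro borel_measurable_le borel_measurable_abs borel_measurable_diff borel_measurable_const measurable_lebk_component)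
    then show ?thesis unfolding S_def by (intro sets.sets_Collect_finite_All) auto
  qed
  have ptsp: "pt m h \<in> space (lebk k)" for m h by (simp add: space_lebk)
  have ptS: "pt m h \<in> S \<longleftrightarrow> (\<forall>j\<in>{1..k}. \<bar>pt m h j - \<theta>0 j\<bar> \<le> \<delta>)" for m h
    unfolding S_def using ptsp[of m h] by blast
  define u where "u m h = indicator S (pt m h) * rel_post (n m) (y m) (pt m h)" for m h
  define g where "g h = pri \<theta>0 * exp (log_dens h)" for h
  define w where "w h = C * (\<Prod>j\<in>{1..k}. exp (- e * (h j)\<^sup>2 / 2))" for h :: "nat \<Rightarrow> real"
  have um: "u m \<in> borel_measurable (lebk k)" for m
    unfolding u_def
    by (rule measurable_compose[OF measurable_lebk_affine, where g = "\<lambda>\<theta>. indicator S \<theta> * rel_post (n m) (y m) \<theta>"])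
      (intro borel_measurable_times borel_measurable_indicator S rel_post_measurable)
  have gm: "g \<in> borel_measurable (lebk k)"
    unfolding g_def using log_dens_measurable by measurable
  have wm: "w \<in> borel_measurable (lebk k)"
    unfolding w_def
    by (intro borel_measurable_times borel_measurable_const borel_measurable_prod borel_measurable_exp
      borel_measurable_divide borel_measurable_power measurable_lebk_component measurable_compose[OF _ borel_measurable_exp])
  have u0: "u m h \<ge> 0" for m h unfolding u_def using rel_post_nonneg by simp
  obtain M0 where M0: "\<And>m h. m \<ge> M0 \<Longrightarrow> (\<forall>j\<in>{1..k}. \<bar>pt m h j - \<theta>0 j\<bar> \<le> \<delta>) \<Longrightarrow>
     rel_post (n m) (y m) (pt m h) \<le> w h"
    using near unfolding eventually_sequentially w_def by blast
  have w0: "w h \<ge> 0" for h unfolding w_def using C by (intro mult_nonneg_nonneg prod_nonneg) auto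
  have uw: "u (m + M0) h \<le> w h" for m h
  proof (cases "pt (m + M0) h \<in> S")
    case True
    have "u (m + M0) h = rel_post (n (m + M0)) (y (m + M0)) (pt (m + M0) h)"
      unfolding u_def using True by (simp only: indicator_simps mult_1)
    also have "\<dots> \<le> w h" by (rule M0[OF le_add2]) (use True in \<open>simp only: ptS\<close>)
    finally show ?thesis .
  next
    case False
    have "u (m + M0) h = 0" unfolding u_def indicator_simps(2)[OF False] by (rule mult_zero_left)
    then show ?thesis using w0[of h] by simp
  qed
  have wfin: "(\<integral>\<^sup>+ h. ennreal (w h) \<partial>lebk k) < \<infinity>"
  proof -
    have "(\<integral>\<^sup>+ h. ennreal (w h) \<partial>lebk k) = (\<integral>\<^sup>+ h. ennreal C * (\<Prod>j\<in>{1..k}. ennreal (exp (- e * (h j - 0 * (if j = k then 0 else h (Suc j)))\<^sup>2 / 2))) \<partial>lebk k)"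
      unfolding w_def using C by (intro nn_integral_cong) (simp add: prod_ennreal ennreal_mult prod_nonneg)
    also have "\<dots> = ennreal C * (\<integral>\<^sup>+ h. (\<Prod>j\<in>{1..k}. ennreal (exp (- e * (h j - 0 * (if j = k then 0 else h (Suc j)))\<^sup>2 / 2))) \<partial>lebk k)"
    proof (rule nn_integral_cmult)
      have "(\<lambda>h. \<Prod>j\<in>{1..k}. ennreal (exp (- e * (h j)\<^sup>2 / 2))) \<in> borel_measurable (lebk k)"
        by (intro borel_measurable_prod_ennreal measurable_compose[OF _ measurable_ennreal] measurable_compose[OF _ borel_measurable_exp]
          borel_measurable_divide borel_measurable_times borel_measurable_const borel_measurable_power measurable_lebk_component)
      then show "(\<lambda>h. \<Prod>j\<in>{1..k}. ennreal (exp (- e * (h j - 0 * (if j = k then 0 else h (Suc j)))\<^sup>2 / 2))) \<in> borel_measurable (lebk k)" by simp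
    qed
    also have "\<dots> = ennreal C * (\<Prod>j\<in>{1..k}. ennreal (sqrt (2 * pi / e)))"
      using nn_integral_triangular_gaussian[of k "\<lambda>_. e" "\<lambda>_. 0" 0] C(2) by simp
    also have "\<dots> < \<infinity>"
      by (simp add: ennreal_mult_less_top power_less_top_ennreal)
    finally show ?thesis .
  qed
  have pw: "(\<lambda>m. u m h) \<longlonglongrightarrow> g h" for h
    using rel_post_tendsto[of h] unfolding g_def
  proof (rule Lim_transform_eventually)
    show "eventually (\<lambda>m. rel_post (n m) (y m) (pt m h) = u m h) sequentially"
      using eventually_close[OF \<delta>, of h]
    proof eventually_elim
      case (elim m)
      then have "pt m h \<in> S" unfolding ptS using less_imp_le by blast
      then show ?case unfolding u_def by (simp only: indicator_simps mult_1)
    qed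
  qed
  \<comment> \<open>The domination holds from M0 on, so the sequence is shifted by M0 first.\<close>
  have "(\<lambda>m. \<integral>\<^sup>+ h. ennreal (norm (g h - u (m + M0) h)) \<partial>lebk k) \<longlonglongrightarrow> 0"
  proof (rule nn_integral_dominated_convergence_norm[where w = w])
    show "AE h in lebk k. norm (u (m + M0) h) \<le> w h" for m using uw u0 by simp
    show "AE h in lebk k. (\<lambda>m. u (m + M0) h) \<longlonglongrightarrow> g h"
      using pw LIMSEQ_ignore_initial_segment by blast
  qed (use um gm wm wfin in auto)
  then have "(\<lambda>m. \<integral>\<^sup>+ h. ennreal (norm (g h - u m h)) \<partial>lebk k) \<longlonglongrightarrow> 0"
    by (rule LIMSEQ_offset)
  then have ev1: "eventually (\<lambda>m. (\<integral>\<^sup>+ h. ennreal (norm (g h - u m h)) \<partial>lebk k) < ennreal (\<epsilon> / 2)) sequentially"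
    by (rule order_tendstoD(2)) (use \<epsilon> in simp)
  have "(\<lambda>m. s m ^ k * \<kappa> m * K) \<longlonglongrightarrow> 0 * K" by (intro tendsto_mult_right \<kappa>(2))
  then have ev2: "eventually (\<lambda>m. s m ^ k * \<kappa> m * K < \<epsilon> / 2) sequentially"
    by (rule order_tendstoD(2)) (use \<epsilon> in simp)
  show ?thesis
    using ev1 ev2 far
  proof eventually_elim
    case (elim m)
    define v where "v \<theta> = ennreal (indicator (space (lebk k) - S) \<theta> * rel_post (n m) (y m) \<theta>)" for \<theta>
    have vm: "v \<in> borel_measurable (lebk k)"
      unfolding v_def using S
      by (intro measurable_compose[OF _ measurable_ennreal] borel_measurable_times borel_measurable_indicator rel_post_measurable) auto
    have vle: "v \<theta> \<le> ennreal (\<kappa> m) * (ennreal (indicator (Theta k) \<theta> * pri \<theta>) * sample_weight P0 (n m) k (y m) \<theta>)" for \<theta>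
    proof (cases "\<theta> \<in> space (lebk k) - S \<and> \<theta> \<in> Theta k")
      case True
      then have "ennreal (rel_lik (n m) (y m) \<theta>) \<le> ennreal (\<kappa> m) * sample_weight P0 (n m) k (y m) \<theta>"
        using elim(3) by (auto simp: S_def not_le)
      then have "ennreal (rel_lik (n m) (y m) \<theta>) * ennreal (pri \<theta>) \<le> (ennreal (\<kappa> m) * sample_weight P0 (n m) k (y m) \<theta>) * ennreal (pri \<theta>)"
        by (intro mult_right_mono) auto
      then show ?thesis
        using True rel_lik_nonneg pri_nonneg by (simp add: v_def rel_post_def ennreal_mult mult_ac)
    next
      case False
      then have "indicator (space (lebk k) - S) \<theta> * rel_post (n m) (y m) \<theta> = 0" by (auto simp: rel_post_def)
      then have "v \<theta> = 0" unfolding v_def by (simp only: ennreal_0)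
      then show ?thesis by simp
    qed
    have ysp: "y m \<in> space (PiM UNIV (\<lambda>_. P0))" by (simp add: space_PiM)
    have wsm: "(\<lambda>\<theta>. ennreal (indicator (Theta k) \<theta> * pri \<theta>) * sample_weight P0 (n m) k (y m) \<theta>) \<in> borel_measurable (lebk k)"
      using measurable_compose[OF measurable_Pair1'[OF ysp] prior_weight_integrand_measurable[OF P0 pri_meas]] by simp
    have "(\<integral>\<^sup>+ h. v (pt m h) \<partial>lebk k) = ennreal (s m ^ k) * (\<integral>\<^sup>+ \<theta>. v \<theta> \<partial>lebk k)"
      unfolding s_def by (rule nn_integral_lebk_affine[OF _ vm]) (use n1[of m] in auto)
    also have "\<dots> \<le> ennreal (s m ^ k) * (\<integral>\<^sup>+ \<theta>. ennreal (\<kappa> m) * (ennreal (indicator (Theta k) \<theta> * pri \<theta>) * sample_weight P0 (n m) k (y m) \<theta>) \<partial>lebk k)"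
      using vle by (intro mult_left_mono nn_integral_mono) auto
    also have "\<dots> = ennreal (s m ^ k) * (ennreal (\<kappa> m) * prior_weight P0 k pri (n m) (y m))"
      unfolding prior_weight_def[OF P0] using wsm by (simp add: nn_integral_cmult)
    also have "\<dots> \<le> ennreal (s m ^ k) * (ennreal (\<kappa> m) * ennreal K)"
      using good[of m] unfolding good_def by (intro mult_left_mono) auto
    also have "\<dots> = ennreal (s m ^ k * \<kappa> m * K)"
      using s_pos[of m] \<kappa>(1)[of m] K by (simp add: ennreal_mult mult.assoc)
    also have "\<dots> \<le> ennreal (\<epsilon> / 2)" using elim(2) by (intro ennreal_leI) simp
    finally have vb: "(\<integral>\<^sup>+ h. v (pt m h) \<partial>lebk k) \<le> ennreal (\<epsilon> / 2)" .
    have vpm: "(\<lambda>h. v (pt m h)) \<in> borel_measurable (lebk k)"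
      by (rule measurable_compose[OF measurable_lebk_affine vm])
    have "(\<integral>\<^sup>+ h. ennreal \<bar>rel_post (n m) (y m) (pt m h) - g h\<bar> \<partial>lebk k)
        \<le> (\<integral>\<^sup>+ h. ennreal (norm (g h - u m h)) + v (pt m h) \<partial>lebk k)"
    proof (rule nn_integral_mono)
      fix h
      show "ennreal \<bar>rel_post (n m) (y m) (pt m h) - g h\<bar> \<le> ennreal (norm (g h - u m h)) + v (pt m h)"
      proof (cases "pt m h \<in> S")
        case True
        have "u m h = rel_post (n m) (y m) (pt m h)" unfolding u_def using True by (simp only: indicator_simps mult_1)
        then show ?thesis by (simp only: real_norm_def abs_minus_commute[of "g h"]) (rule add_increasing2, auto)
      next
        case False
        have "u m h = 0" unfolding u_def indicator_simps(2)[OF False] by (rule mult_zero_left)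
        moreover have "v (pt m h) = ennreal (rel_post (n m) (y m) (pt m h))"
          unfolding v_def using False ptsp[of m h] by (simp only: Diff_iff indicator_simps mult_1 simp_thms)
        moreover have "\<bar>rel_post (n m) (y m) (pt m h) - g h\<bar> \<le> \<bar>g h\<bar> + rel_post (n m) (y m) (pt m h)"
          using rel_post_nonneg[of "n m" "y m" "pt m h"] by linarith
        ultimately show ?thesis
          using rel_post_nonneg[of "n m" "y m" "pt m h"]
          by (simp only: diff_0_right real_norm_def ennreal_plus[symmetric] abs_ge_zero ennreal_leI)
      qed
    qed
    also have "\<dots> = (\<integral>\<^sup>+ h. ennreal (norm (g h - u m h)) \<partial>lebk k) + (\<integral>\<^sup>+ h. v (pt m h) \<partial>lebk k)"
      by (rule nn_integral_add) (use gm um vpm in auto)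
    also have "\<dots> \<le> ennreal (\<epsilon> / 2) + ennreal (\<epsilon> / 2)" using elim(1) vb by (intro add_mono) auto
    also have "\<dots> = ennreal \<epsilon>" using \<epsilon> by (simp flip: ennreal_plus)
    finally show ?case by (simp only: g_def)
  qed
qed

lemma tv_convergence:
  assumes \<epsilon>: "\<epsilon> > 0"
  shows "eventually (\<lambda>m. tv_dist (posterior_loc k p \<alpha> pri (n m) (y m)) (normal_prec k (SigmaInv k p f0 \<theta>0)) \<le> \<epsilon>) sequentially"
proof -
  define G where "G = pri \<theta>0 / norm_const"
  have G: "G > 0" using pri_pos nn_integral_log_dens(1) by (simp add: G_def)
  \<comment> \<open>The first bound makes 2 e / G \<le> \<epsilon>; the second makes e < G, which
    keeps the posterior mass positive.\<close>
  define e where "e = min (\<epsilon> * G / 2) (G / 2)"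
  have e: "e > 0" "e < G" "2 * e / G \<le> \<epsilon>" using \<epsilon> G by (auto simp: e_def min_def field_simps)
  have gm: "(\<lambda>h. pri \<theta>0 * exp (log_dens h)) \<in> borel_measurable (lebk k)"
    using log_dens_measurable by measurable
  have em: "(\<lambda>h. ennreal (exp (log_dens h))) \<in> borel_measurable (lebk k)"
    using log_dens_measurable by measurable
  have Gi: "(\<integral>\<^sup>+ h. ennreal (pri \<theta>0 * exp (log_dens h)) \<partial>lebk k) = ennreal G"
  proof -
    have "(\<integral>\<^sup>+ h. ennreal (pri \<theta>0 * exp (log_dens h)) \<partial>lebk k) = (\<integral>\<^sup>+ h. ennreal (pri \<theta>0) * ennreal (exp (log_dens h)) \<partial>lebk k)"
      using pri_pos by (simp add: ennreal_mult)
    also have "\<dots> = ennreal (pri \<theta>0) * ennreal (1 / norm_const)"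
      by (simp only: nn_integral_cmult[OF em] nn_integral_log_dens(2))
    also have "\<dots> = ennreal G"
      using pri_pos nn_integral_log_dens(1) by (simp add: G_def flip: ennreal_mult)
    finally show ?thesis .
  qed
  show ?thesis
    using L1_convergence[OF e(1)]
  proof eventually_elim
    case (elim m)
    have pm: "(\<lambda>h. rel_post (n m) (y m) (pt m h)) \<in> borel_measurable (lebk k)"
      by (rule measurable_compose[OF measurable_lebk_affine rel_post_measurable])
    have "tv_dist (posterior_loc k p \<alpha> pri (n m) (y m)) (normal_prec k (SigmaInv k p f0 \<theta>0)) \<le> 2 * e / G"
      unfolding posterior_loc_eq[OF n1] normal_prec_eq G_def[symmetric]
      by (rule tv_dist_normalized_le[OF pm rel_post_nonneg gm _ Gi G elim e(2)]) (use pri_pos e in auto)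
    then show ?case using e(3) by linarith
  qed
qed

end

section \<open>From sequences of samples back to probability\<close>

context quantile_model
begin

text \<open>If every \<eta> and n0 failed, the choices 1 / (m + 1) and m + 1 would produce a
  \<open>good_sequence\<close> along which the distance stays above \<epsilon>, against
  \<open>tv_convergence\<close>.\<close>

lemma tv_small_if_good:
  assumes K: "K > 0" and \<epsilon>: "\<epsilon> > 0"
  shows "\<exists>\<eta>>0. \<exists>n0\<ge>1. \<forall>n\<ge>n0. \<forall>y. good n y K \<eta> \<longrightarrow>
    tv_dist (posterior_loc k p \<alpha> pri n y) (normal_prec k (SigmaInv k p f0 \<theta>0)) \<le> \<epsilon>"
proof (rule ccontr)
  assume neg: "\<not> ?thesis"
  have "\<exists>n y. n \<ge> m + 1 \<and> good n y K (1 / (real m + 1)) \<and>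
      \<not> tv_dist (posterior_loc k p \<alpha> pri n y) (normal_prec k (SigmaInv k p f0 \<theta>0)) \<le> \<epsilon>" for m :: nat
  proof -
    have "1 / (real m + 1) > 0" "m + 1 \<ge> 1" by auto
    then show ?thesis using neg by blast
  qed
  then obtain n y where ny: "\<And>m. n m \<ge> m + 1" "\<And>m. good (n m) (y m) K (1 / (real m + 1))"
      "\<And>m. \<not> tv_dist (posterior_loc k p \<alpha> pri (n m) (y m)) (normal_prec k (SigmaInv k p f0 \<theta>0)) \<le> \<epsilon>"
    by metis
  interpret good_sequence k p P0 f0 \<theta>0 pri \<alpha> n y K
    by unfold_locales (use K ny in auto)
  from tv_convergence[OF \<epsilon>] ny(3) show False by simp
qed

text \<open>A Lipschitz density is bounded on a bounded interval around \<open>\<theta>0 j\<close>;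
  the radius 2 covers all grid points used for the increments.\<close>

lemma cdf_local_lipschitz:
  "\<exists>C>0. \<forall>j\<in>{1..k}. \<forall>x x'. \<bar>x - \<theta>0 j\<bar> \<le> 2 \<longrightarrow> \<bar>x' - \<theta>0 j\<bar> \<le> 2 \<longrightarrow> \<bar>cdf P0 x - cdf P0 x'\<bar> \<le> C * \<bar>x - x'\<bar>"
proof -
  obtain L where L: "\<And>x x'. \<bar>f0 x - f0 x'\<bar> \<le> L * \<bar>x - x'\<bar>" using f0_lip by auto
  define C where "C = (\<Sum>j\<in>{1..k}. \<bar>f0 (\<theta>0 j)\<bar>) + 2 * \<bar>L\<bar> + 1"
  have "(\<Sum>j\<in>{1..k}. \<bar>f0 (\<theta>0 j)\<bar>) \<ge> 0" by (intro sum_nonneg) auto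
  then have C: "C > 0" unfolding C_def by linarith
  have "\<bar>cdf P0 x - cdf P0 x'\<bar> \<le> C * \<bar>x - x'\<bar>"
    if j: "j \<in> {1..k}" and x: "\<bar>x - \<theta>0 j\<bar> \<le> 2" "\<bar>x' - \<theta>0 j\<bar> \<le> 2" for j x x'
  proof -
    have "norm (cdf P0 x - cdf P0 x') \<le> C * norm (x - x')"
    proof (rule field_differentiable_bound[where S = "{\<theta>0 j - 2..\<theta>0 j + 2}"])
      show "(cdf P0 has_field_derivative f0 z) (at z within {\<theta>0 j - 2..\<theta>0 j + 2})" for z
        using F0_deriv has_field_derivative_at_within by blast
      show "norm (f0 z) \<le> C" if z: "z \<in> {\<theta>0 j - 2..\<theta>0 j + 2}" for z
      proof -
        have "\<bar>f0 z - f0 (\<theta>0 j)\<bar> \<le> \<bar>L\<bar> * \<bar>z - \<theta>0 j\<bar>" using L[of z "\<theta>0 j"] abs_ge_self[of L] by (meson abs_ge_zero mult_right_mono order_trans)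
        also have "\<dots> \<le> \<bar>L\<bar> * 2" using z by (intro mult_left_mono) auto
        finally have "\<bar>f0 z\<bar> \<le> \<bar>f0 (\<theta>0 j)\<bar> + 2 * \<bar>L\<bar>" by linarith
        moreover have "\<bar>f0 (\<theta>0 j)\<bar> \<le> (\<Sum>j\<in>{1..k}. \<bar>f0 (\<theta>0 j)\<bar>)" using j by (intro member_le_sum) auto
        ultimately show ?thesis by (simp add: C_def)
      qed
    qed (use x in auto)
    then show ?thesis by simp
  qed
  with C show ?thesis by blast
qed

text \<open>Each clause of \<open>good\<close> accounts for one term: exponential tails at the k
  quantiles, Markov's inequality for \<open>prior_weight\<close>, and an allowance 1 / K for the
  grid events, whose probability tends to 0. \<open>Bad\<close> is measurable although
  \<open>good\<close> quantifies over a continuum of h.\<close>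

lemma good_with_high_probability:
  assumes K: "K > 0" and \<eta>: "\<eta> > 0"
  shows "\<exists>Bad. (\<forall>n. Bad n \<in> sets (PiM UNIV (\<lambda>_. P0))) \<and>
    (\<forall>n\<ge>1. \<forall>y\<in>space (PiM UNIV (\<lambda>_. P0)) - Bad n. good n y K \<eta>) \<and>
    eventually (\<lambda>n. measure (PiM UNIV (\<lambda>_. P0)) (Bad n) \<le> real k * (2 * exp (1 - K)) + exp (real k + 1) / K + 1 / K) sequentially"
proof -
  let ?M = "PiM (UNIV :: nat set) (\<lambda>_. P0)"
  interpret M: prob_space ?M by (rule PI_prob_space[OF P0])
  obtain C where C: "C > 0" "\<And>j x x'. j \<in> {1..k} \<Longrightarrow> \<bar>x - \<theta>0 j\<bar> \<le> 2 \<Longrightarrow> \<bar>x' - \<theta>0 j\<bar> \<le> 2 \<Longrightarrow> \<bar>cdf P0 x - cdf P0 x'\<bar> \<le> C * \<bar>x - x'\<bar>"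
    using cdf_local_lipschitz by blast
  \<comment> \<open>A mesh this fine keeps C e \<le> \<eta> / 4, the share that
    \<open>not_grid_bad\<close> reserves for the probability of one grid cell.\<close>
  define e where "e = min (1 / 2) (\<eta> / (4 * C))"
  have e: "0 < e" "e \<le> 1 / 2" "C * e \<le> \<eta> / 4" using C \<eta> by (auto simp: e_def min_def field_simps)
  define B1 where "B1 j n = {y \<in> space ?M. \<bar>real (cnt n y {..\<theta>0 j}) - real n * p j\<bar> > K * sqrt (real n)}" for j n
  define B2 where "B2 j n = grid_bad P0 (\<theta>0 j) e (\<eta> / 4) n" for j n
  define B3 where "B3 n = {y \<in> space ?M. prior_weight P0 k pri n y > ennreal K}" for n
  define Bad where "Bad n = ((\<Union>j\<in>{1..k}. B1 j n) \<union> (\<Union>j\<in>{1..k}. B2 j n)) \<union> B3 n" for n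
  have B1: "B1 j n \<in> sets ?M" for j n
  proof -
    have [measurable]: "(\<lambda>y. real (cnt n y {..\<theta>0 j})) \<in> borel_measurable ?M" by (rule cnt_measurable[OF P0]) simp
    show ?thesis unfolding B1_def by measurable
  qed
  have B2: "B2 j n \<in> sets ?M" for j n unfolding B2_def by (rule grid_bad_sets[OF P0])
  have B3: "B3 n \<in> sets ?M" for n
  proof -
    have [measurable]: "prior_weight P0 k pri n \<in> borel_measurable ?M" by (rule prior_weight_measurable[OF P0 pri_meas])
    show ?thesis unfolding B3_def by measurable
  qed
  have Bad: "Bad n \<in> sets ?M" for n unfolding Bad_def using B1 B2 B3 by auto
  have good: "good n y K \<eta>" if n: "n \<ge> 1" and y: "y \<in> space ?M - Bad n" for n y
    unfolding good_def
  proof (intro conjI ballI allI impI)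
    fix j assume j: "j \<in> {1..k}"
    show "\<bar>real (cnt n y {..\<theta>0 j}) - real n * p j\<bar> \<le> K * sqrt (real n)"
      using y j by (auto simp: Bad_def B1_def not_less)
    fix h assume h: "\<bar>h\<bar> \<le> sqrt (real n)"
    show "\<bar>incr_dev P0 n y (\<theta>0 j) (\<theta>0 j + h / sqrt (real n))\<bar> \<le> sqrt (real n) * \<eta> * (1 + \<bar>h\<bar>)"
      by (rule not_grid_bad[OF P0 C(2)[OF j] C(1) e \<eta> n _ _ h]) (use y j in \<open>auto simp: Bad_def B2_def\<close>)
  next
    show "prior_weight P0 k pri n y \<le> ennreal K" using y by (auto simp: Bad_def B3_def not_less)
  qed
  have "(\<lambda>n. \<Sum>j\<in>{1..k}. measure ?M (B2 j n)) \<longlonglongrightarrow> (\<Sum>j\<in>{1..k}. 0)"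
  proof (rule tendsto_sum)
    fix j assume j: "j \<in> {1..k}"
    show "(\<lambda>n. measure ?M (B2 j n)) \<longlonglongrightarrow> 0"
      unfolding B2_def by (rule grid_bad_tendsto[OF P0 _ C(1) e(1,2)]) (use C(2)[OF j] \<eta> in auto)
  qed
  then have "eventually (\<lambda>n. (\<Sum>j\<in>{1..k}. measure ?M (B2 j n)) < 1 / K) sequentially"
    by (rule order_tendstoD(2)) (use K in simp)
  then have ev: "eventually (\<lambda>n. measure ?M (Bad n) \<le> real k * (2 * exp (1 - K)) + exp (real k + 1) / K + 1 / K) sequentially"
    using eventually_ge_at_top[of 1]
  proof eventually_elim
    case (elim n)
    have U1: "measure ?M (\<Union>j\<in>{1..k}. B1 j n) \<le> (\<Sum>j\<in>{1..k}. 2 * exp (1 - K))"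
    proof (rule order_trans[OF measure_UNION_le])
      show "(\<Sum>j\<in>{1..k}. measure ?M (B1 j n)) \<le> (\<Sum>j\<in>{1..k}. 2 * exp (1 - K))"
        unfolding B1_def using \<theta>0_quant
        by (intro sum_mono quantile_deviation[OF P0 elim(2)]) (auto simp: cdf_def)
    qed (use B1 in auto)
    have U2: "measure ?M (\<Union>j\<in>{1..k}. B2 j n) \<le> (\<Sum>j\<in>{1..k}. measure ?M (B2 j n))"
      by (rule measure_UNION_le) (use B2 in auto)
    have U3: "measure ?M (B3 n) \<le> exp (real k + 1) / K"
      unfolding B3_def by (rule prior_weight_tail[OF P0 pri_meas elim(2) K pri_dens])
    have S1: "(\<Union>j\<in>{1..k}. B1 j n) \<in> sets ?M" "(\<Union>j\<in>{1..k}. B2 j n) \<in> sets ?M" using B1 B2 by auto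
    have "measure ?M (Bad n) \<le> measure ?M ((\<Union>j\<in>{1..k}. B1 j n) \<union> (\<Union>j\<in>{1..k}. B2 j n)) + measure ?M (B3 n)"
      unfolding Bad_def using S1 B3 by (intro measure_Un_le) auto
    also have "measure ?M ((\<Union>j\<in>{1..k}. B1 j n) \<union> (\<Union>j\<in>{1..k}. B2 j n)) \<le> measure ?M (\<Union>j\<in>{1..k}. B1 j n) + measure ?M (\<Union>j\<in>{1..k}. B2 j n)"
      using S1 by (intro measure_Un_le) auto
    finally show ?case using U1 U2 U3 elim(1) by simp
  qed
  from Bad good ev show ?thesis by blast
qed

end

text \<open>Letting \<rho> n minimise over r \<le> n gives f (\<rho> n) n \<le> f r n as soon as n
  \<ge> r, for every r at once.\<close>

lemma diagonal_selection:
  fixes f :: "nat \<Rightarrow> nat \<Rightarrow> real"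
  assumes nn: "\<And>r n. f r n \<ge> 0" and small: "\<And>\<tau>. \<tau> > 0 \<Longrightarrow> \<exists>r. eventually (\<lambda>n. f r n \<le> \<tau>) sequentially"
  shows "\<exists>\<rho>. (\<lambda>n. f (\<rho> n) n) \<longlonglongrightarrow> 0"
proof -
  have "\<exists>r\<in>{..n}. \<forall>r'\<in>{..n}. f r n \<le> f r' n" for n
    using ex_is_arg_min_if_finite[of "{..n}" "\<lambda>r. f r n"] by (auto simp: is_arg_min_linorder)
  then obtain \<rho> where \<rho>: "\<And>n r'. r' \<le> n \<Longrightarrow> f (\<rho> n) n \<le> f r' n" by (metis atMost_iff)
  have "(\<lambda>n. f (\<rho> n) n) \<longlonglongrightarrow> 0"
  proof (rule tendstoI)
    fix e :: real assume e: "e > 0"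
    then obtain r where "eventually (\<lambda>n. f r n \<le> e / 2) sequentially" using small[of "e / 2"] by auto
    then show "eventually (\<lambda>n. dist (f (\<rho> n) n) 0 < e) sequentially"
      using eventually_ge_at_top[of r]
    proof eventually_elim
      case (elim n)
      then show ?case using \<rho>[of r n] nn[of "\<rho> n" n] e by (simp add: dist_real_def)
    qed
  qed
  then show ?thesis by blast
qed

lemma (in quantile_model) posterior_normality:
  assumes \<epsilon>: "\<epsilon> > 0"
  shows "\<exists>B :: nat \<Rightarrow> (nat \<Rightarrow> real) set.
           (\<forall>n. B n \<in> sets (PiM UNIV (\<lambda>_. P0))) \<and>
           (\<forall>n. {y \<in> space (PiM UNIV (\<lambda>_. P0)).
                   tv_dist (posterior_loc k p \<alpha> pri n y) (normal_prec k (SigmaInv k p f0 \<theta>0)) > \<epsilon>}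
                 \<subseteq> B n) \<and>
           (\<lambda>n. measure (PiM UNIV (\<lambda>_. P0)) (B n)) \<longlonglongrightarrow> 0"
proof -
  let ?M = "PiM (UNIV :: nat set) (\<lambda>_. P0)"
  let ?E = "\<lambda>n. {y \<in> space ?M. tv_dist (posterior_loc k p \<alpha> pri n y) (normal_prec k (SigmaInv k p f0 \<theta>0)) > \<epsilon>}"
  have step: "\<exists>B. (\<forall>n. B n \<in> sets ?M \<and> ?E n \<subseteq> B n) \<and>
      eventually (\<lambda>n. measure ?M (B n) \<le> real k * (2 * exp (1 - K)) + exp (real k + 1) / K + 1 / K) sequentially"
    if K: "K > 0" for K
  proof -
    obtain \<eta> n0 where \<eta>: "\<eta> > 0" "n0 \<ge> 1" "\<And>n y. n \<ge> n0 \<Longrightarrow> good n y K \<eta> \<Longrightarrow>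
        tv_dist (posterior_loc k p \<alpha> pri n y) (normal_prec k (SigmaInv k p f0 \<theta>0)) \<le> \<epsilon>"
      using tv_small_if_good[OF K \<epsilon>] by blast
    obtain Bad where Bad: "\<And>n. Bad n \<in> sets ?M" "\<And>n y. n \<ge> 1 \<Longrightarrow> y \<in> space ?M - Bad n \<Longrightarrow> good n y K \<eta>"
       "eventually (\<lambda>n. measure ?M (Bad n) \<le> real k * (2 * exp (1 - K)) + exp (real k + 1) / K + 1 / K) sequentially"
      using good_with_high_probability[OF K \<eta>(1)] by blast
    \<comment> \<open>Below n0 nothing is known about the distance, and the whole space is a valid
      choice since only large n count.\<close>
    define B where "B n = (if n \<ge> n0 then Bad n else space ?M)" for n
    have "B n \<in> sets ?M \<and> ?E n \<subseteq> B n" for n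
    proof (cases "n \<ge> n0")
      case True
      have "y \<in> Bad n" if "y \<in> ?E n" for y
      proof (rule ccontr)
        assume "y \<notin> Bad n"
        with that have "good n y K \<eta>" using True \<eta>(2) by (intro Bad(2)) auto
        from \<eta>(3)[OF True this] that show False by auto
      qed
      then show ?thesis using True Bad(1) by (auto simp: B_def)
    qed (auto simp: B_def)
    moreover have "eventually (\<lambda>n. measure ?M (B n) \<le> real k * (2 * exp (1 - K)) + exp (real k + 1) / K + 1 / K) sequentially"
      using Bad(3) eventually_ge_at_top[of n0] by eventually_elim (simp add: B_def)
    ultimately show ?thesis by blast
  qed
  have "\<forall>r::nat. \<exists>B. (\<forall>n. B n \<in> sets ?M \<and> ?E n \<subseteq> B n) \<and>
      eventually (\<lambda>n. measure ?M (B n) \<le> real k * (2 * exp (1 - (real r + 1))) + exp (real k + 1) / (real r + 1) + 1 / (real r + 1)) sequentially"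
  proof
    fix r :: nat
    have "real r + 1 > 0" by simp
    from step[OF this] show "\<exists>B. (\<forall>n. B n \<in> sets ?M \<and> ?E n \<subseteq> B n) \<and>
      eventually (\<lambda>n. measure ?M (B n) \<le> real k * (2 * exp (1 - (real r + 1))) + exp (real k + 1) / (real r + 1) + 1 / (real r + 1)) sequentially" .
  qed
  from choice[OF this] obtain Br where Br': "\<forall>r. (\<forall>n. Br r n \<in> sets ?M \<and> ?E n \<subseteq> Br r n) \<and>
      eventually (\<lambda>n. measure ?M (Br r n) \<le> real k * (2 * exp (1 - (real r + 1))) + exp (real k + 1) / (real r + 1) + 1 / (real r + 1)) sequentially" ..
  have Br: "Br r n \<in> sets ?M" "?E n \<subseteq> Br r n" for r n using Br' by blast+
  have Br_ev: "eventually (\<lambda>n. measure ?M (Br r n) \<le> real k * (2 * exp (1 - (real r + 1))) + exp (real k + 1) / (real r + 1) + 1 / (real r + 1)) sequentially" for r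
    using Br' by blast
  have "\<exists>\<rho>. (\<lambda>n. measure ?M (Br (\<rho> n) n)) \<longlonglongrightarrow> 0"
  proof (rule diagonal_selection)
    fix \<tau> :: real assume \<tau>: "\<tau> > 0"
    have "(\<lambda>r. real k * (2 * exp (1 - (real r + 1))) + exp (real k + 1) / (real r + 1) + 1 / (real r + 1)) \<longlonglongrightarrow> 0"
    proof -
      have "(\<lambda>r. c * (2 * exp (1 - (real r + 1))) + d / (real r + 1) + 1 / (real r + 1)) \<longlonglongrightarrow> 0" for c d :: real
      proof -
        have "(\<lambda>r. 2 * exp (1 - (real r + 1))) \<longlonglongrightarrow> 0" "(\<lambda>r. 1 / (real r + 1)) \<longlonglongrightarrow> 0" by real_asymp+
        then have "(\<lambda>r. c * (2 * exp (1 - (real r + 1))) + d * (1 / (real r + 1)) + 1 / (real r + 1)) \<longlonglongrightarrow> c * 0 + d * 0 + 0"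
          by (intro tendsto_intros)
        then show ?thesis by simp
      qed
      then show ?thesis .
    qed
    from eventually_happens'[OF sequentially_bot order_tendstoD(2)[OF this \<tau>]] obtain r where
      r: "real k * (2 * exp (1 - (real r + 1))) + exp (real k + 1) / (real r + 1) + 1 / (real r + 1) < \<tau>" ..
    have "eventually (\<lambda>n. measure ?M (Br r n) \<le> \<tau>) sequentially"
      using Br_ev[of r] by eventually_elim (use r in linarith)
    then show "\<exists>r. eventually (\<lambda>n. measure ?M (Br r n) \<le> \<tau>) sequentially" ..
  qed simp
  then obtain \<rho> where "(\<lambda>n. measure ?M (Br (\<rho> n) n)) \<longlonglongrightarrow> 0" by blast
  with Br show ?thesis by (intro exI[of _ "\<lambda>n. Br (\<rho> n) n"] conjI allI)
qed

theorem mainTheorem6: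
  fixes k :: nat and p :: "nat \<Rightarrow> real"
    and P0 :: "real measure" and f0 :: "real \<Rightarrow> real"
    and \<theta>0 :: "nat \<Rightarrow> real" and pri :: "(nat \<Rightarrow> real) \<Rightarrow> real"
    and \<alpha> :: "real measure"
  assumes k: "k \<ge> 1"
    and p_range: "\<forall>j\<in>{1..k}. 0 < p j \<and> p j < 1"
    and p_mono: "\<forall>j. 1 \<le> j \<longrightarrow> j < k \<longrightarrow> p j < p (Suc j)"
    and P0: "real_distribution P0"
    and F0_deriv: "\<forall>x. (cdf P0 has_real_derivative f0 x) (at x)"
    and f0_lip: "\<exists>L. \<forall>x x'. \<bar>f0 x - f0 x'\<bar> \<le> L * \<bar>x - x'\<bar>"
    and \<theta>0_ext: "\<theta>0 \<in> extensional {1..k}"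
    and \<theta>0_quant: "\<forall>j\<in>{1..k}. cdf P0 (\<theta>0 j) = p j"
    and f0_pos: "\<forall>j\<in>{1..k}. f0 (\<theta>0 j) > 0"
    and pri_meas: "pri \<in> borel_measurable (lebk k)"
    and pri_nonneg: "\<forall>\<theta>\<in>Theta k. pri \<theta> \<ge> 0"
    and pri_dens: "(\<integral>\<^sup>+ \<theta>. ennreal (indicator (Theta k) \<theta> * pri \<theta>) \<partial>lebk k) = 1"
    and pri_cont: "\<forall>\<epsilon>>0. \<exists>\<delta>>0. \<forall>\<theta>\<in>Theta k.
                     (\<forall>j\<in>{1..k}. \<bar>\<theta> j - \<theta>0 j\<bar> < \<delta>) \<longrightarrow> \<bar>pri \<theta> - pri \<theta>0\<bar> < \<epsilon>"
    and pri_pos: "pri \<theta>0 > 0"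
    and \<alpha>_fin: "finite_measure \<alpha>"
    and \<alpha>_sets: "sets \<alpha> = sets borel"
    and A_pos: "measure \<alpha> UNIV > 0"
    and Qn1: "\<exists>L>0. \<forall>j\<in>{1..k}. \<exists>\<delta>>0. \<forall>x x'. x < x' \<and> \<bar>x - \<theta>0 j\<bar> < \<delta> \<and> \<bar>x' - \<theta>0 j\<bar> < \<delta>
                  \<longrightarrow> measure \<alpha> {x<..x'} \<le> L * \<bar>x - x'\<bar>"
    and Qn2: "\<forall>j\<in>{1..k+1}. measure \<alpha> (Sset k \<theta>0 j) > 0"
    and Qn3: "\<exists>M'>0. \<forall>a b. a < b \<longrightarrow> measure \<alpha> {a<..b} \<ge> M' * measure P0 {a<..b}"
  shows "\<forall>\<epsilon>>0. \<exists>B :: nat \<Rightarrow> (nat \<Rightarrow> real) set.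
           (\<forall>n. B n \<in> sets (PiM UNIV (\<lambda>_. P0))) \<and>
           (\<forall>n. {y \<in> space (PiM UNIV (\<lambda>_. P0)).
                   tv_dist (posterior_loc k p \<alpha> pri n y) (normal_prec k (SigmaInv k p f0 \<theta>0)) > \<epsilon>}
                 \<subseteq> B n) \<and>
           (\<lambda>n. measure (PiM UNIV (\<lambda>_. P0)) (B n)) \<longlonglongrightarrow> 0"
proof (intro allI impI)
  fix \<epsilon> :: real assume "\<epsilon> > 0"
  interpret quantile_model k p P0 f0 \<theta>0 pri \<alpha>
    by (rule quantile_model.intro; fact)
  from \<open>\<epsilon> > 0\<close> show "\<exists>B :: nat \<Rightarrow> (nat \<Rightarrow> real) set.
           (\<forall>n. B n \<in> sets (PiM UNIV (\<lambda>_. P0))) \<and>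
           (\<forall>n. {y \<in> space (PiM UNIV (\<lambda>_. P0)).
                   tv_dist (posterior_loc k p \<alpha> pri n y) (normal_prec k (SigmaInv k p f0 \<theta>0)) > \<epsilon>}
                 \<subseteq> B n) \<and>
           (\<lambda>n. measure (PiM UNIV (\<lambda>_. P0)) (B n)) \<longlonglongrightarrow> 0"
    by (rule posterior_normality)
qed

end
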